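(* Let $V$ be a finite-dimensional real inner product space and $0<i<\dim V$. The following square commutes: $$\begin{array}{ccc}\Sigma\mathrm{ST}(V)_i&\xrightarrow{\ (\theta_2^V)_i\ }&\bigvee_{\dim U=i}\Sigma\mathrm{ST}(U)\wedge\Sigma\mathrm{ST}(V\ominus U)\\ {\scriptstyle\cong}\big\downarrow&&\big\uparrow{\scriptstyle\simeq}\\ \Sigma|F^V_\bullet|&\xrightarrow{\ \Sigma D_i\ }&\bigvee_{\dim U=i}\Sigma|F^U_\bullet\,\tilde\star\,F^{V\ominus U}_\bullet|\end{array}$$ Here the wedges are over $i$-dimensional subspaces $U\subseteq V$, the left vertical map is the canonical homeomorphism $\Sigma\mathrm{ST}(V)_i\cong\Sigma\mathrm{ST}(V)\cong\Sigma|F^V_\bullet|$, the right vertical map is the weak equivalence $h$ of the context, $D_i$ is the Campbell–Zakharevich derived Dehn invariant, and $(\theta_2^V)_i$ is the restriction of the coproduct $\theta_2^V$ to $\Sigma\mathrm{ST}(V)_i$.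
   Context: $V\ominus U$ denotes the orthogonal complement of $U$ in $V$. **$\Sigma\mathrm{ST}(V)$.** $\Sigma\mathrm{ST}(V)=|\{0\subseteq U\subseteq V\}|/(|\{0\subseteq U\subsetneq V\}|\cup|\{0\subsetneq U\subseteq V\}|)$, realizations of posets of linear subspaces. A non-basepoint element is represented by an order-preserving step function $\phi:[0,1]\to\{\text{subspaces of }V\}$, modulo changes at finitely many points, with first value $0$ and last value $V$. If its values are $0=U_0\subsetneq\dots\subsetneq U_n=V$, with step lengths $t_0,\dots,t_n>0$, it corresponds to the point of the simplex $\langle U_0,\dots,U_n\rangle$ with barycentric coordinates $(t_0,\dots,t_n)$. The cut points are the points where $\phi$ jumps. **Coproduct.** $D_1(2)$ is the space of pairs $e=(e_1,e_2)$ of increasing affine embeddings $[0,1]\to[0,1]$ whose images have disjoint interiors. For $e_1(1)<e_2(1)$, the map $\theta_2^V:D_1(2)_+\wedge\Sigma\mathrm{ST}(V)\to\bigvee_{U\subseteq V}\Sigma\mathrm{ST}(U)\wedge\Sigma\mathrm{ST}(V\ominus U)$ sends $(e,\phi)$ to $(\phi_1,\phi_2)$ in the summand $U=\phi(e_1(1))$, where $\phi_1=\phi\circ e_1$ and $\phi_2(t)=\phi(e_2(t))\ominus U$. The value is the basepoint if $e_1(1)$ or $e_2(1)$ is a cut point of $\phi$, or if $\phi_1$ (resp. $\phi_2$) does not begin with $0$ and end with $U$ (resp. $V\ominus U$). **$\Sigma\mathrm{ST}(V)_i$.** This is the subspace of $\Sigma\mathrm{ST}(V)\wedge D_1(2)_+$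 of pairs $(\phi,e)$ where $e_1$ has image $[0,t]$ and $e_2$ has image $[t,1]$. Here $t$ is the midpoint of the step of $\phi$ whose value has dimension $i$, if there is one; otherwise $t$ is the cut point where $\phi$ jumps from dimension $<i$ to dimension $>i$. The forgetful map $\Sigma\mathrm{ST}(V)_i\to\Sigma\mathrm{ST}(V)$ is a homeomorphism. **RT-building.** $F^V_\bullet=N_\bullet(0\subsetneq U\subseteq V)/N_\bullet(0\subsetneq U\subsetneq V)$, a pointed simplicial set whose non-basepoint $n$-simplices are chains $0\subsetneq U_0\subseteq\dots\subseteq U_n=V$. The reduced join has $(F\,\tilde\star\,F')_n=\bigvee_{j=0}^{n-1}F_j\wedge F'_{n-j-1}$. For a quotient $X/A$ of realizations we use $\Sigma(X/A)\cong CX/(CA\cup X)$ with cone vertex added as an initial vertex. For $F^V_\bullet$ this vertex is the subspace $0$, giving the identification $\Sigma|F^V_\bullet|\cong\Sigma\mathrm{ST}(V)$. **Derived Dehn invariant.** $D_i:F^V_\bullet\to\bigvee_{\dim U=i}F^U_\bullet\,\tilde\star\,F^{V\ominus U}_\bullet$ sends a chain $0\subsetneq U_0\subseteq\dots\subseteq U_n=V$ to the basepoint if no $U_j$ has dimension $i$. Otherwise, with $j$ maximal such that $\dim U_j=i$, it sends the chain to the pair of chains $(U_0\subseteq\dots\subseteq U_j)$ in $F^{U_j}_j$ and $(U_{j+1}\ominus U_j\subseteq\dots\subseteq U_n\ominus U_j)$ in $F^{V\ominus U_j}_{n-j-1}$. **The map $h$.** $h:\Sigma|F^U_\bullet\,\tilde\star\,F^{V\ominus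 U}_\bullet|\to\Sigma\mathrm{ST}(U)\wedge\Sigma\mathrm{ST}(V\ominus U)$ is defined as follows. Consider the $n$-simplex of the source consisting of the cone vertex together with chains $0\subsetneq U_1\subsetneq\dots\subsetneq U_j=U$ and $0\subsetneq V_1\subsetneq\dots\subsetneq V_{n-j}=V\ominus U$, and its point with barycentric coordinates $(t_0,\dots,t_n)$, $t_0$ being the weight of the cone vertex. It is sent to the point of the product of the simplices $\langle 0,U_1,\dots,U_j\rangle$ and $\langle 0,V_1,\dots,V_{n-j}\rangle$ with coordinates $$\Big(\big(\tfrac{t_0}{s_a},\dots,\tfrac{t_{j-1}}{s_a},\tfrac{t_j/2}{s_a}\big),\big(\tfrac{t_j/2}{s_b},\tfrac{t_{j+1}}{s_b},\dots,\tfrac{t_n}{s_b}\big)\Big),\quad s_a=\sum_{l<j}t_l+\tfrac12t_j,\ \ s_b=\tfrac12t_j+\sum_{l>j}t_l .$$ This is a well-defined weak homotopy equivalence. *)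

theory Defs
  imports "HOL-Analysis.Analysis" "HOL-Homology.Homology"
begin

section \<open>Pointed spaces\<close>

text \<open>The topology on \<open>S\<close> coinduced by maps \<open>f k : X k \<rightarrow> S\<close>, i.e. the finest one making all of
  them continuous. Every colimit below (realization, wedge, smash, disjoint basepoint) is
  topologized this way.\<close>

definition coinduced_topology ::
    "'b set \<Rightarrow> ('k \<Rightarrow> 'a topology) \<Rightarrow> 'k set \<Rightarrow> ('k \<Rightarrow> 'a \<Rightarrow> 'b) \<Rightarrow> 'b topology" where
  "coinduced_topology S X I f =
     topology (\<lambda>U. U \<subseteq> S \<and> (\<forall>k\<in>I. openin (X k) {x \<in> topspace (X k). f k x \<in> U}))"

lemma openin_coinduced_topology:
  "openin (coinduced_topology S X I f) U \<longleftrightarrow>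
     U \<subseteq> S \<and> (\<forall>k\<in>I. openin (X k) {x \<in> topspace (X k). f k x \<in> U})"
proof -
  have 1: "{x \<in> topspace (X k). f k x \<in> A \<inter> B} =
      {x \<in> topspace (X k). f k x \<in> A} \<inter> {x \<in> topspace (X k). f k x \<in> B}" for A B k
    by auto
  have 2: "{x \<in> topspace (X k). f k x \<in> \<Union> \<K>} = (\<Union>A\<in>\<K>. {x \<in> topspace (X k). f k x \<in> A})" for \<K> k
    by auto
  have "istopology (\<lambda>U. U \<subseteq> S \<and> (\<forall>k\<in>I. openin (X k) {x \<in> topspace (X k). f k x \<in> U}))"
    unfolding istopology_def 1 2 by blast
  then show ?thesis
    by (simp add: coinduced_topology_def)
qed

record 'a pspace =
  space_of :: "'a topology"
  base_of :: "'a"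

definition pointed_map :: "'a pspace \<Rightarrow> 'b pspace \<Rightarrow> ('a \<Rightarrow> 'b) \<Rightarrow> bool" where
  "pointed_map X Y f \<longleftrightarrow>
     continuous_map (space_of X) (space_of Y) f \<and> f (base_of X) = base_of Y"

text \<open>In wedges, smash products and spaces with a disjoint basepoint, the basepoint is \<open>None\<close>.\<close>

definition plus_space :: "'a topology \<Rightarrow> 'a option pspace" where
  "plus_space X = \<lparr>space_of = coinduced_topology (insert None (Some ` topspace X))
                                (\<lambda>_::unit. X) UNIV (\<lambda>_. Some),
                   base_of = None\<rparr>"

definition wedge_in :: "('i \<Rightarrow> 'a pspace) \<Rightarrow> 'i \<Rightarrow> 'a \<Rightarrow> ('i \<times> 'a) option" where
  "wedge_in X u x = (if x = base_of (X u) then None else Some (u, x))"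

definition wedge :: "'i set \<Rightarrow> ('i \<Rightarrow> 'a pspace) \<Rightarrow> ('i \<times> 'a) option pspace" where
  "wedge I X =
     \<lparr>space_of = coinduced_topology
        (insert None (\<Union>u\<in>I. wedge_in X u ` topspace (space_of (X u))))
        (\<lambda>u. space_of (X u)) I (wedge_in X),
      base_of = None\<rparr>"

definition wedge_map ::
    "('i \<Rightarrow> 'b pspace) \<Rightarrow> ('i \<Rightarrow> 'a \<Rightarrow> 'b) \<Rightarrow> ('i \<times> 'a) option \<Rightarrow> ('i \<times> 'b) option" where
  "wedge_map Y f z = (case z of None \<Rightarrow> None | Some (u, x) \<Rightarrow> wedge_in Y u (f u x))"

definition smash_in :: "'a pspace \<Rightarrow> 'b pspace \<Rightarrow> 'a \<Rightarrow> 'b \<Rightarrow> ('a \<times> 'b) option" where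
  "smash_in X Y x y = (if x = base_of X \<or> y = base_of Y then None else Some (x, y))"

definition smash :: "'a pspace \<Rightarrow> 'b pspace \<Rightarrow> ('a \<times> 'b) option pspace" where
  "smash X Y =
     \<lparr>space_of = coinduced_topology
        (insert None (case_prod (smash_in X Y) ` (topspace (space_of X) \<times> topspace (space_of Y))))
        (\<lambda>_::unit. prod_topology (space_of X) (space_of Y)) UNIV
        (\<lambda>_. case_prod (smash_in X Y)),
      base_of = None\<rparr>"


section \<open>Pointed simplicial sets\<close>

text \<open>\<open>cells X n\<close> are the non-basepoint \<open>n\<close>-simplices; \<open>None\<close> is the basepoint in every degree.
  For a monotone \<open>\<alpha> : {0..m} \<rightarrow> {0..n}\<close>, \<open>act X m n \<alpha>\<close> is the induced operator from \<open>n\<close>-simplices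
  to \<open>m\<close>-simplices.\<close>

record 's psset =
  cells :: "nat \<Rightarrow> 's set"
  act :: "nat \<Rightarrow> nat \<Rightarrow> (nat \<Rightarrow> nat) \<Rightarrow> 's \<Rightarrow> 's option"

definition simplices :: "'s psset \<Rightarrow> nat \<Rightarrow> 's option set" where
  "simplices X n = insert None (Some ` cells X n)"

definition op_simplex :: "'s psset \<Rightarrow> nat \<Rightarrow> nat \<Rightarrow> (nat \<Rightarrow> nat) \<Rightarrow> 's option \<Rightarrow> 's option" where
  "op_simplex X m n \<alpha> x = Option.bind x (act X m n \<alpha>)"

definition push_coords :: "nat \<Rightarrow> (nat \<Rightarrow> nat) \<Rightarrow> (nat \<Rightarrow> real) \<Rightarrow> nat \<Rightarrow> real" where
  "push_coords m \<alpha> s k = (\<Sum>l | l \<le> m \<and> \<alpha> l = k. s l)"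

type_synonym 's gpoint = "(nat \<times> 's option \<times> (nat \<Rightarrow> real)) set"

definition gluing ::
    "'s psset \<Rightarrow> ((nat \<times> 's option \<times> (nat \<Rightarrow> real)) \<times> (nat \<times> 's option \<times> (nat \<Rightarrow> real))) set" where
  "gluing X = {((m, op_simplex X m n \<alpha> x, s), (n, x, push_coords m \<alpha> s)) | m n \<alpha> x s.
      mono_on {..m} \<alpha> \<and> \<alpha> ` {..m} \<subseteq> {..n} \<and> x \<in> simplices X n \<and> s \<in> standard_simplex m}"

definition geo_pt :: "'s psset \<Rightarrow> nat \<Rightarrow> 's option \<Rightarrow> (nat \<Rightarrow> real) \<Rightarrow> 's gpoint" where
  "geo_pt X n x t = (gluing X \<union> (gluing X)\<inverse>)\<^sup>* `` {(n, x, t)}"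

definition realization :: "'s psset \<Rightarrow> 's gpoint pspace" where
  "realization X =
     \<lparr>space_of = coinduced_topology
        {geo_pt X n x t | n x t. x \<in> simplices X n \<and> t \<in> standard_simplex n}
        (\<lambda>(n, x). subtopology (powertop_real UNIV) (standard_simplex n))
        {(n, x). x \<in> simplices X n}
        (\<lambda>(n, x) t. geo_pt X n x t),
      base_of = geo_pt X 0 None (\<lambda>k. if k = 0 then 1 else 0)\<rparr>"

text \<open>The map out of a realization given on each simplex \<open>x\<close> of degree \<open>n\<close> by \<open>g n x\<close>.\<close>

definition descend ::
    "'s psset \<Rightarrow> (nat \<Rightarrow> 's option \<Rightarrow> (nat \<Rightarrow> real) \<Rightarrow> 'b) \<Rightarrow> 's gpoint \<Rightarrow> 'b" where
  "descend X g p =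
     (THE q. \<exists>n x t. x \<in> simplices X n \<and> t \<in> standard_simplex n \<and> p = geo_pt X n x t \<and> q = g n x t)"

text \<open>The quotient \<open>CX / (CA \<union> X)\<close> of the simplicial cone with initial cone vertex, for a pointed
  simplicial set \<open>X/A\<close>. The simplex \<open>(k, x)\<close> consists of \<open>k\<close> copies of the cone vertex followed
  by the simplex \<open>x\<close>; it is collapsed when one of the two parts is empty. Hence
  \<open>realization (susp X)\<close> is the suspension of the realization of \<open>X\<close>.\<close>

definition susp :: "'s psset \<Rightarrow> (nat \<times> 's) psset" where
  "susp X =
     \<lparr>cells = (\<lambda>n. {(k, x). 1 \<le> k \<and> k \<le> n \<and> x \<in> cells X (n - k)}),
      act = (\<lambda>m n \<alpha> (k, x).
        let k' = card {l. l \<le> m \<and> \<alpha> l < k} in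
        if k' = 0 \<or> k' = Suc m then None
        else map_option (Pair k') (act X (m - k') (n - k) (\<lambda>l. \<alpha> (l + k') - k) x))\<rparr>"

text \<open>The reduced join. The simplex \<open>(j, x, y)\<close> of degree \<open>n\<close> lies in the summand
  \<open>F\<^sub>j \<and> F'\<^sub>n\<^sub>-\<^sub>j\<^sub>-\<^sub>1\<close>; an operator leaving no vertex of \<open>x\<close> or none of \<open>y\<close> gives the basepoint.\<close>

definition reduced_join :: "'s psset \<Rightarrow> 't psset \<Rightarrow> (nat \<times> 's \<times> 't) psset" where
  "reduced_join F F' =
     \<lparr>cells = (\<lambda>n. {(j, x, y). j < n \<and> x \<in> cells F j \<and> y \<in> cells F' (n - j - 1)}),
      act = (\<lambda>m n \<alpha> (j, x, y).
        let k = card {l. l \<le> m \<and> \<alpha> l \<le> j} in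
        if k = 0 \<or> k = Suc m then None
        else (case (act F (k - 1) j \<alpha> x,
                    act F' (m - k) (n - j - 1) (\<lambda>l. \<alpha> (l + k) - (j + 1)) y) of
                (Some x', Some y') \<Rightarrow> Some (k - 1, x', y')
              | _ \<Rightarrow> None))\<rparr>"

definition nerve :: "'a set set \<Rightarrow> nat \<Rightarrow> 'a set list set" where
  "nerve P n = {c. length c = Suc n \<and> set c \<subseteq> P \<and> sorted_wrt (\<subseteq>) c}"

text \<open>The nerve of the poset \<open>P\<close> modulo the union of the nerves of the subposets in \<open>\<Q>\<close>.\<close>

definition nerve_quot :: "'a set set \<Rightarrow> 'a set set set \<Rightarrow> 'a set list psset" where
  "nerve_quot P \<Q> =
     \<lparr>cells = (\<lambda>n. nerve P n - (\<Union>Q\<in>\<Q>. nerve Q n)),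
      act = (\<lambda>m n \<alpha> c.
        let c' = map (\<lambda>l. c ! \<alpha> l) [0..<Suc m] in
        if c' \<in> (\<Union>Q\<in>\<Q>. nerve Q m) then None else Some c')\<rparr>"


section \<open>Suspended Steinberg spaces and step functions\<close>

definition ominus :: "'a::euclidean_space set \<Rightarrow> 'a set \<Rightarrow> 'a set" (infixl "\<ominus>\<^sub>\<bottom>" 65) where
  "V \<ominus>\<^sub>\<bottom> U = V \<inter> U\<^sup>\<bottom>"

definition subs :: "'a::euclidean_space set \<Rightarrow> 'a set set" where
  "subs V = {U. subspace U \<and> U \<subseteq> V}"

definition subs_dim :: "'a::euclidean_space set \<Rightarrow> nat \<Rightarrow> 'a set set" where
  "subs_dim V i = {U \<in> subs V. dim U = i}"

definition ST_sset :: "'a::euclidean_space set \<Rightarrow> 'a set list psset" where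
  "ST_sset V = nerve_quot (subs V) {subs V - {V}, subs V - {{0}}}"

definition SigmaST :: "'a::euclidean_space set \<Rightarrow> 'a set list gpoint pspace" where
  "SigmaST V = realization (ST_sset V)"

text \<open>The non-basepoint element \<open>p\<close> lies in the interior of the simplex on the strict chain \<open>c\<close>,
  from \<open>0\<close> to \<open>V\<close>, with barycentric coordinates \<open>t\<close>.\<close>

definition has_steps ::
    "'a::euclidean_space set \<Rightarrow> 'a set list gpoint \<Rightarrow> nat \<Rightarrow> 'a set list \<Rightarrow> (nat \<Rightarrow> real) \<Rightarrow> bool" where
  "has_steps V p n c t \<longleftrightarrow>
     c \<in> cells (ST_sset V) n \<and> sorted_wrt (\<subset>) c \<and>
     t \<in> standard_simplex n \<and> (\<forall>k\<le>n. 0 < t k) \<and> p = geo_pt (ST_sset V) n (Some c) t"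

text \<open>Step functions are considered on \<open>[0,1]\<close> only, modulo changes at finitely many points.\<close>

definition represents ::
    "'a::euclidean_space set \<Rightarrow> (real \<Rightarrow> 'a set) \<Rightarrow> 'a set list gpoint \<Rightarrow> bool" where
  "represents V \<phi> p \<longleftrightarrow>
     (\<exists>n c t. has_steps V p n c t \<and>
        (\<forall>k\<le>n. finite {x. (\<Sum>l<k. t l) < x \<and> x < (\<Sum>l\<le>k. t l) \<and> \<phi> x \<noteq> c ! k}))"

definition point_of :: "'a::euclidean_space set \<Rightarrow> (real \<Rightarrow> 'a set) \<Rightarrow> 'a set list gpoint" where
  "point_of V \<phi> = (THE p. represents V \<phi> p)"

definition step_fun :: "'a::euclidean_space set \<Rightarrow> 'a set list gpoint \<Rightarrow> real \<Rightarrow> 'a set" where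
  "step_fun V p = (SOME \<phi>. represents V \<phi> p)"

text \<open>The next notions are expressed by punctured or one-sided germs, so they do not depend on
  the values at finitely many points.\<close>

definition cut_point :: "(real \<Rightarrow> 'a set) \<Rightarrow> real \<Rightarrow> bool" where
  "cut_point \<phi> x \<longleftrightarrow> 0 < x \<and> x < 1 \<and> \<not> (\<exists>W. \<forall>\<^sub>F y in at x. \<phi> y = W)"

definition step_value :: "(real \<Rightarrow> 'a set) \<Rightarrow> real \<Rightarrow> 'a set" where
  "step_value \<phi> x = (THE W. \<forall>\<^sub>F y in at x. \<phi> y = W)"

definition begins_with :: "(real \<Rightarrow> 'a set) \<Rightarrow> 'a set \<Rightarrow> bool" where
  "begins_with \<phi> W \<longleftrightarrow> (\<forall>\<^sub>F y in at_right 0. \<phi> y = W)"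

definition ends_with :: "(real \<Rightarrow> 'a set) \<Rightarrow> 'a set \<Rightarrow> bool" where
  "ends_with \<phi> W \<longleftrightarrow> (\<forall>\<^sub>F y in at_left 1. \<phi> y = W)"


section \<open>The coproduct and its restriction\<close>

text \<open>An affine embedding of \<open>[0,1]\<close> is encoded by its unique affine extension to the real line.
  The topology is that of pointwise convergence, which on affine functions agrees with uniform
  convergence on \<open>[0,1]\<close>.\<close>

definition affine_emb :: "(real \<Rightarrow> real) set" where
  "affine_emb = {e. (\<exists>a b. 0 < a \<and> e = (\<lambda>t. a * t + b)) \<and> e ` {0..1} \<subseteq> {0..1}}"

definition little_intervals :: "((real \<Rightarrow> real) \<times> (real \<Rightarrow> real)) set" where
  "little_intervals = {(e1, e2). e1 \<in> affine_emb \<and> e2 \<in> affine_emb \<and>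
                          interior (e1 ` {0..1}) \<inter> interior (e2 ` {0..1}) = {}}"

definition D12_plus :: "((real \<Rightarrow> real) \<times> (real \<Rightarrow> real)) option pspace" where
  "D12_plus = plus_space (top_of_set little_intervals)"

definition ST_smash ::
    "'a::euclidean_space set \<Rightarrow> 'a set
       \<Rightarrow> ('a set list gpoint \<times> 'a set list gpoint) option pspace" where
  "ST_smash V U = smash (SigmaST U) (SigmaST (V \<ominus>\<^sub>\<bottom> U))"

text \<open>The coproduct on \<open>D\<^sub>1(2)\<^sub>+ \<and> \<Sigma>ST(V)\<close>. The formula applies on the component
  \<open>e\<^sub>1(1) < e\<^sub>2(1)\<close>, which is the only one used here; nothing is specified on the other one.\<close>

definition theta2 ::
    "'a::euclidean_space set
       \<Rightarrow> (((real \<Rightarrow> real) \<times> (real \<Rightarrow> real)) option \<times> 'a set list gpoint) option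
       \<Rightarrow> ('a set \<times> ('a set list gpoint \<times> 'a set list gpoint) option) option" where
  "theta2 V z = (case z of
       Some (Some (e1, e2), p) \<Rightarrow>
         if e1 1 < e2 1 then
           (let \<phi> = step_fun V p;
                U = step_value \<phi> (e1 1);
                \<phi>1 = \<phi> \<circ> e1;
                \<phi>2 = (\<lambda>t. \<phi> (e2 t) \<ominus>\<^sub>\<bottom> U)
            in if cut_point \<phi> (e1 1) \<or> cut_point \<phi> (e2 1)
                  \<or> \<not> (begins_with \<phi>1 {0} \<and> ends_with \<phi>1 U)
                  \<or> \<not> (begins_with \<phi>2 {0} \<and> ends_with \<phi>2 (V \<ominus>\<^sub>\<bottom> U))
               then None
               else wedge_in (ST_smash V) U
                      (smash_in (SigmaST U) (SigmaST (V \<ominus>\<^sub>\<bottom> U))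
                         (point_of U \<phi>1) (point_of (V \<ominus>\<^sub>\<bottom> U) \<phi>2)))
         else undefined
     | _ \<Rightarrow> None)"

definition split_time :: "'a::euclidean_space set \<Rightarrow> nat \<Rightarrow> 'a set list gpoint \<Rightarrow> real \<Rightarrow> bool" where
  "split_time V i p s \<longleftrightarrow>
     (\<exists>n c t. has_steps V p n c t \<and>
        ((\<exists>k\<le>n. dim (c ! k) = i \<and> s = (\<Sum>l<k. t l) + t k / 2) \<or>
         (\<forall>k\<le>n. dim (c ! k) \<noteq> i) \<and>
         (\<exists>k<n. dim (c ! k) < i \<and> i < dim (c ! Suc k) \<and> s = (\<Sum>l\<le>k. t l))))"

definition SigmaST_i ::
    "'a::euclidean_space set \<Rightarrow> nat
       \<Rightarrow> ('a set list gpoint \<times> ((real \<Rightarrow> real) \<times> (real \<Rightarrow> real)) option) option pspace" where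
  "SigmaST_i V i =
     \<lparr>space_of = subtopology (space_of (smash (SigmaST V) D12_plus))
        (insert None {Some (p, Some (e1, e2)) | p e1 e2.
           (e1, e2) \<in> little_intervals \<and>
           (\<exists>s. split_time V i p s \<and> e1 ` {0..1} = {0..s} \<and> e2 ` {0..1} = {s..1})}),
      base_of = None\<rparr>"

definition theta2_i ::
    "'a::euclidean_space set \<Rightarrow> nat
       \<Rightarrow> ('a set list gpoint \<times> ((real \<Rightarrow> real) \<times> (real \<Rightarrow> real)) option) option
       \<Rightarrow> ('a set \<times> ('a set list gpoint \<times> 'a set list gpoint) option) option" where
  "theta2_i V i = restrict (\<lambda>z. theta2 V (map_option prod.swap z)) (topspace (space_of (SigmaST_i V i)))"


section \<open>RT-buildings and the derived Dehn invariant\<close>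

definition RT :: "'a::euclidean_space set \<Rightarrow> 'a set list psset" where
  "RT V = nerve_quot (subs V - {{0}}) {subs V - {{0}, V}}"

definition RT_join ::
    "'a::euclidean_space set \<Rightarrow> 'a set \<Rightarrow> (nat \<times> 'a set list \<times> 'a set list) psset" where
  "RT_join V U = reduced_join (RT U) (RT (V \<ominus>\<^sub>\<bottom> U))"

definition dehn_invariant ::
    "nat \<Rightarrow> 'a::euclidean_space set list
       \<Rightarrow> ('a set \<times> (nat \<times> 'a set list \<times> 'a set list)) option" where
  "dehn_invariant i c =
     (if \<exists>j<length c. dim (c ! j) = i
      then (let j = Max {j. j < length c \<and> dim (c ! j) = i}; U = c ! j
            in Some (U, j, take (Suc j) c, map (\<lambda>W. W \<ominus>\<^sub>\<bottom> U) (drop (Suc j) c)))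
      else None)"

abbreviation Sigma_join ::
    "'a::euclidean_space set \<Rightarrow> 'a set \<Rightarrow> (nat \<times> nat \<times> 'a set list \<times> 'a set list) gpoint pspace" where
  "Sigma_join V U \<equiv> realization (susp (RT_join V U))"

definition Sigma_dehn ::
    "'a::euclidean_space set \<Rightarrow> nat \<Rightarrow> (nat \<times> 'a set list) gpoint
       \<Rightarrow> ('a set \<times> (nat \<times> nat \<times> 'a set list \<times> 'a set list) gpoint) option" where
  "Sigma_dehn V i =
     descend (susp (RT V))
       (\<lambda>n x t. case x of
            None \<Rightarrow> None
          | Some (k, c) \<Rightarrow>
              (case dehn_invariant i c of
                 None \<Rightarrow> None
               | Some (U, z) \<Rightarrow>
                   wedge_in (Sigma_join V) U (geo_pt (susp (RT_join V U)) n (Some (k, z)) t)))"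


section \<open>The vertical maps\<close>

definition forget ::
    "'a::euclidean_space set
       \<Rightarrow> ('a set list gpoint \<times> ((real \<Rightarrow> real) \<times> (real \<Rightarrow> real)) option) option
       \<Rightarrow> 'a set list gpoint" where
  "forget V z = (case z of None \<Rightarrow> base_of (SigmaST V) | Some (p, e) \<Rightarrow> p)"

text \<open>The identification of \<open>\<Sigma>ST(V)\<close> with the suspension of the RT-building (for \<open>V \<noteq> 0\<close>): the
  vertex \<open>0\<close> of a chain is the cone vertex.\<close>

definition ST_to_RT ::
    "'a::euclidean_space set \<Rightarrow> 'a set list gpoint \<Rightarrow> (nat \<times> 'a set list) gpoint" where
  "ST_to_RT V =
     descend (ST_sset V)
       (\<lambda>n x t. geo_pt (susp (RT V)) n
          (map_option (\<lambda>c. (length (takeWhile (\<lambda>W. W = {0}) c), dropWhile (\<lambda>W. W = {0}) c)) x) t)"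

definition left_map ::
    "'a::euclidean_space set
       \<Rightarrow> ('a set list gpoint \<times> ((real \<Rightarrow> real) \<times> (real \<Rightarrow> real)) option) option
       \<Rightarrow> (nat \<times> 'a set list) gpoint" where
  "left_map V = ST_to_RT V \<circ> forget V"

text \<open>In the formula for \<open>h\<close>, \<open>A\<close> and \<open>B\<close> are the two strict chains, so that \<open>j = length A\<close> and
  the last vertex of \<open>A\<close>, of weight \<open>t j\<close>, is \<open>U\<close>. Off the basepoint, \<open>t 0\<close>, \<open>t j\<close> and \<open>t n\<close> are
  positive, so the denominators do not vanish.\<close>

definition h_map ::
    "'a::euclidean_space set \<Rightarrow> 'a set
       \<Rightarrow> (nat \<times> nat \<times> 'a set list \<times> 'a set list) gpoint
       \<Rightarrow> ('a set list gpoint \<times> 'a set list gpoint) option" where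
  "h_map V U p =
     (if p = base_of (Sigma_join V U) then None
      else THE q. \<exists>n j A B t.
        length A = j \<and> (1, j - 1, A, B) \<in> cells (susp (RT_join V U)) n \<and>
        sorted_wrt (\<subset>) A \<and> sorted_wrt (\<subset>) B \<and> t \<in> standard_simplex n \<and>
        p = geo_pt (susp (RT_join V U)) n (Some (1, j - 1, A, B)) t \<and>
        (let sa = (\<Sum>l<j. t l) + t j / 2;
             sb = t j / 2 + (\<Sum>l\<in>{j<..n}. t l);
             a = (\<lambda>l. if l < j then t l / sa else if l = j then t j / 2 / sa else 0);
             b = (\<lambda>l. if l = 0 then t j / 2 / sb else if l \<le> n - j then t (j + l) / sb else 0)
         in q = smash_in (SigmaST U) (SigmaST (V \<ominus>\<^sub>\<bottom> U))
                  (geo_pt (ST_sset U) j (Some ({0} # A)) a)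
                  (geo_pt (ST_sset (V \<ominus>\<^sub>\<bottom> U)) (n - j) (Some ({0} # B)) b)))"

definition right_map ::
    "'a::euclidean_space set
       \<Rightarrow> ('a set \<times> (nat \<times> nat \<times> 'a set list \<times> 'a set list) gpoint) option
       \<Rightarrow> ('a set \<times> ('a set list gpoint \<times> 'a set list gpoint) option) option" where
  "right_map V = wedge_map (ST_smash V) (h_map V)"

end

theory Submission
  imports Defs
begin

text \<open>A point of the realization of a poset of chains is determined by the weights of the subspaces in
  its support. A simplex of the suspended join \<open>\<Sigma>|F\<^sup>U \<star> F\<^sup>V\<^sup>\<ominus>\<^sup>U|\<close> is a chain of subspaces of \<open>V\<close> through
  \<open>0\<close>, \<open>U\<close> and \<open>V\<close>: replace the members \<open>W\<close> of the second chain by \<open>U + W\<close>. In these coordinates the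
  derived Dehn invariant leaves the chain and the weights unchanged if the chain has a member \<open>U\<close> of
  dimension \<open>i\<close>, and gives the basepoint otherwise, while \<open>h\<close> cuts the chain at \<open>U\<close> and divides the weight
  of \<open>U\<close> equally between the two pieces. Cutting the corresponding step function at the midpoint of its
  step \<open>U\<close> and rescaling both halves gives the same pair of weights; without a step of dimension \<open>i\<close>, the
  splitting time is a cut point and the coproduct is the basepoint as well. Since the square commutes
  pointwise, the continuity of the restricted coproduct follows from that of the three other maps.\<close>

section \<open>Coinduced topologies\<close>

text \<open>The relation \<open>gluing\<close> only generates the identifications, so it gives no
  direct test for two points to be equal. Weights give one: they are constant under gluing, a strict
  chain with positive coordinates can be read off from its weights, and every point off the
  basepoint has such a representative. The main obstacle is the continuity of \<open>h\<close>. Its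
  formula is stated on strict chains, whereas a map out of a realization needs compatible continuous
  values on all simplices, and its denominators vanish on some faces. At such a face the normalized
  coordinates of one factor need not converge; the map is continuous only because the other factor
  tends to its basepoint, which the smash product collapses. A compact space of triples, consisting
  of a point and a choice of coordinates in both factors, takes the place of the missing limits. The
  constants of the two constructions agree because the denominators of \<open>h\<close> are the
  lengths of the two intervals: if s is the midpoint of the step \<open>U\<close>, then
  \<open>low_mass\<close> is s and \<open>high_mass\<close> is 1 - s.\<close>

lemma topspace_coinduced_topology:
  assumes "\<And>k x. k \<in> I \<Longrightarrow> x \<in> topspace (X k) \<Longrightarrow> f k x \<in> S"
  shows "topspace (coinduced_topology S X I f) = S"
proof
  show "topspace (coinduced_topology S X I f) \<subseteq> S"
    using openin_topspace[of "coinduced_topology S X I f"]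
    unfolding openin_coinduced_topology by (rule conjunct1)
  have "{x \<in> topspace (X k). f k x \<in> S} = topspace (X k)" if "k \<in> I" for k
    using assms that by auto
  then have "openin (coinduced_topology S X I f) S"
    by (simp add: openin_coinduced_topology)
  then show "S \<subseteq> topspace (coinduced_topology S X I f)"
    by (rule openin_subset)
qed

lemma continuous_map_into_coinduced:
  assumes "\<And>k x. k \<in> I \<Longrightarrow> x \<in> topspace (X k) \<Longrightarrow> f k x \<in> S" and "k \<in> I"
  shows "continuous_map (X k) (coinduced_topology S X I f) (f k)"
proof -
  have "topspace (coinduced_topology S X I f) = S"
    by (rule topspace_coinduced_topology) (use assms in auto)
  then show ?thesis
    unfolding continuous_map_def using assms by (auto simp: openin_coinduced_topology)
qed

lemma continuous_map_from_coinduced: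
  assumes "\<And>k x. k \<in> I \<Longrightarrow> x \<in> topspace (X k) \<Longrightarrow> f k x \<in> S"
    and "\<And>k. k \<in> I \<Longrightarrow> continuous_map (X k) Y (\<lambda>x. g (f k x))"
    and "g ` S \<subseteq> topspace Y"
  shows "continuous_map (coinduced_topology S X I f) Y g"
  unfolding continuous_map_def
proof (intro conjI allI impI)
  show "g \<in> topspace (coinduced_topology S X I f) \<rightarrow> topspace Y"
    using assms(3) by (subst topspace_coinduced_topology[OF assms(1)]) auto
next
  fix U assume U: "openin Y U"
  have "openin (X k) {x \<in> topspace (X k). f k x \<in> {x \<in> S. g x \<in> U}}" if k: "k \<in> I" for k
  proof -
    have "{x \<in> topspace (X k). f k x \<in> {x \<in> S. g x \<in> U}} = {x \<in> topspace (X k). g (f k x) \<in> U}"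
      using assms(1)[OF k] by auto
    then show ?thesis
      using assms(2)[OF k] U by (simp add: continuous_map_def)
  qed
  then show "openin (coinduced_topology S X I f) {x \<in> topspace (coinduced_topology S X I f). g x \<in> U}"
    by (subst topspace_coinduced_topology[OF assms(1)]) (auto simp: openin_coinduced_topology)
qed

lemma topspace_wedge:
  "topspace (space_of (wedge I X)) = insert None (\<Union>u\<in>I. wedge_in X u ` topspace (space_of (X u)))"
  unfolding wedge_def pspace.simps by (rule topspace_coinduced_topology) auto

lemma continuous_map_wedge_in:
  "u \<in> I \<Longrightarrow> continuous_map (space_of (X u)) (space_of (wedge I X)) (wedge_in X u)"
  unfolding wedge_def pspace.simps
  by (rule continuous_map_into_coinduced[where X = "\<lambda>u. space_of (X u)" and f = "wedge_in X"]) auto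

lemma topspace_smash:
  "topspace (space_of (smash X Y)) =
    insert None (case_prod (smash_in X Y) ` (topspace (space_of X) \<times> topspace (space_of Y)))"
  unfolding smash_def pspace.simps by (rule topspace_coinduced_topology) auto

lemma continuous_map_smash_in:
  "continuous_map (prod_topology (space_of X) (space_of Y)) (space_of (smash X Y)) (case_prod (smash_in X Y))"
  unfolding smash_def pspace.simps
  by (rule continuous_map_into_coinduced[where f = "\<lambda>_::unit. case_prod (smash_in X Y)"]) auto

lemma topspace_plus_space: "topspace (space_of (plus_space X)) = insert None (Some ` topspace X)"
  unfolding plus_space_def pspace.simps by (rule topspace_coinduced_topology) auto

lemma wedge_in_base [simp]: "wedge_in X u (base_of (X u)) = None"
  by (simp add: wedge_in_def)

lemma pointed_map_wedge_map:
  assumes "\<And>u. u \<in> I \<Longrightarrow> pointed_map (X u) (Y u) (f u)"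
  shows "pointed_map (wedge I X) (wedge I Y) (wedge_map Y f)"
proof -
  have eq: "wedge_map Y f (wedge_in X u x) = wedge_in Y u (f u x)" if "u \<in> I" for u x
    using assms[OF that] by (auto simp: wedge_map_def wedge_in_def pointed_map_def)
  have cont: "continuous_map (space_of (X u)) (space_of (wedge I Y)) (\<lambda>x. wedge_in Y u (f u x))"
    if "u \<in> I" for u
    using continuous_map_compose[OF _ continuous_map_wedge_in[OF that, of Y], of "space_of (X u)" "f u"]
      assms[OF that] by (auto simp: pointed_map_def o_def)
  have "continuous_map (space_of (wedge I X)) (space_of (wedge I Y)) (wedge_map Y f)"
    unfolding wedge_def[of I X] pspace.simps
  proof (rule continuous_map_from_coinduced)
    show "continuous_map (space_of (X u)) (space_of (wedge I Y)) (\<lambda>x. wedge_map Y f (wedge_in X u x))"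
      if "u \<in> I" for u
      using cont[OF that] by (simp add: eq that)
    show "wedge_map Y f ` insert None (\<Union>u\<in>I. wedge_in X u ` topspace (space_of (X u)))
      \<subseteq> topspace (space_of (wedge I Y))"
    proof
      fix z assume "z \<in> wedge_map Y f ` insert None (\<Union>u\<in>I. wedge_in X u ` topspace (space_of (X u)))"
      then consider "z = wedge_map Y f None"
        | u x where "u \<in> I" "x \<in> topspace (space_of (X u))" "z = wedge_map Y f (wedge_in X u x)"
        by blast
      then show "z \<in> topspace (space_of (wedge I Y))"
      proof cases
        case 1
        then show ?thesis
          by (simp add: wedge_map_def topspace_wedge)
      next
        case 2
        then show ?thesis
          using cont[OF 2(1)] eq by (auto simp: continuous_map_def)
      qed
    qed
  qed auto
  then show ?thesis
    by (simp add: pointed_map_def wedge_def wedge_map_def)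
qed


section \<open>Maps out of realizations\<close>

text \<open>The condition under which \<open>descend\<close> is well defined. It is imposed on
  single operators, which generate the identifications; \<open>glue_invariant_cong\<close> extends
  it to their closure.\<close>

definition glue_invariant :: "'s psset \<Rightarrow> (nat \<Rightarrow> 's option \<Rightarrow> (nat \<Rightarrow> real) \<Rightarrow> 'b) \<Rightarrow> bool" where
  "glue_invariant X g \<longleftrightarrow> (\<forall>m n \<alpha> x s. mono_on {..m} \<alpha> \<longrightarrow> \<alpha> ` {..m} \<subseteq> {..n} \<longrightarrow> x \<in> simplices X n \<longrightarrow>
     s \<in> standard_simplex m \<longrightarrow> g m (op_simplex X m n \<alpha> x) s = g n x (push_coords m \<alpha> s))"

text \<open>A point is the set of all triples reachable from a representative, so equality of points
  is reachability because the relation has been symmetrized.\<close>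

lemma geo_pt_eq_iff:
  "geo_pt X n x t = geo_pt X m y s \<longleftrightarrow> ((n, x, t), (m, y, s)) \<in> (gluing X \<union> (gluing X)\<inverse>)\<^sup>*"
proof -
  have *: "sym ((gluing X \<union> (gluing X)\<inverse>)\<^sup>*)"
    by (intro sym_rtrancl) (auto simp: sym_def)
  show ?thesis
    unfolding geo_pt_def
  proof
    assume "(gluing X \<union> (gluing X)\<inverse>)\<^sup>* `` {(n, x, t)} = (gluing X \<union> (gluing X)\<inverse>)\<^sup>* `` {(m, y, s)}"
    then show "((n, x, t), m, y, s) \<in> (gluing X \<union> (gluing X)\<inverse>)\<^sup>*"
      by blast
  next
    assume "((n, x, t), m, y, s) \<in> (gluing X \<union> (gluing X)\<inverse>)\<^sup>*"
    then show "(gluing X \<union> (gluing X)\<inverse>)\<^sup>* `` {(n, x, t)} = (gluing X \<union> (gluing X)\<inverse>)\<^sup>* `` {(m, y, s)}"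
      using symD[OF *] by (meson Image_singleton_iff rtrancl_trans subsetI subset_antisym)
  qed
qed

lemma glue_invariant_cong:
  assumes g: "glue_invariant X g" and eq: "geo_pt X n x t = geo_pt X m y s"
  shows "g n x t = g m y s"
proof -
  let ?G = "\<lambda>(n, x, t). g n x t"
  have step: "?G p = ?G q" if rel: "(p, q) \<in> gluing X" for p q
  proof -
    obtain m n \<alpha> x s where "mono_on {..m} \<alpha>" "\<alpha> ` {..m} \<subseteq> {..n}" "x \<in> simplices X n" "s \<in> standard_simplex m"
      and pq: "p = (m, op_simplex X m n \<alpha> x, s)" "q = (n, x, push_coords m \<alpha> s)"
      using rel unfolding gluing_def by auto
    then have "g m (op_simplex X m n \<alpha> x) s = g n x (push_coords m \<alpha> s)"
      using g unfolding glue_invariant_def by blast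
    then show ?thesis
      by (simp add: pq)
  qed
  have "((n, x, t), (m, y, s)) \<in> (gluing X \<union> (gluing X)\<inverse>)\<^sup>*"
    using eq by (simp add: geo_pt_eq_iff)
  then have "?G (n, x, t) = ?G (m, y, s)"
  proof (induction rule: rtrancl_induct)
    case (step y z)
    then have "?G y = ?G z"
      using \<open>\<And>p q. (p, q) \<in> gluing X \<Longrightarrow> ?G p = ?G q\<close> by (metis UnE converseD)
    then show ?case
      using step.IH by metis
  qed simp
  then show ?thesis
    by simp
qed

lemma glue_invariant_geo_pt: "glue_invariant X (geo_pt X)"
  unfolding glue_invariant_def
proof (intro allI impI)
  fix m n and \<alpha> :: "nat \<Rightarrow> nat" and x s
  assume "mono_on {..m} \<alpha>" "\<alpha> ` {..m} \<subseteq> {..n}" "x \<in> simplices X n" "s \<in> standard_simplex m"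
  then have "((m, op_simplex X m n \<alpha> x, s), (n, x, push_coords m \<alpha> s)) \<in> gluing X"
    unfolding gluing_def by blast
  then show "geo_pt X m (op_simplex X m n \<alpha> x) s = geo_pt X n x (push_coords m \<alpha> s)"
    unfolding geo_pt_eq_iff by blast
qed

lemma geo_pt_glue:
  assumes "mono_on {..m} \<alpha>" "\<alpha> ` {..m} \<subseteq> {..n}" "x \<in> simplices X n" "s \<in> standard_simplex m"
  shows "geo_pt X m (op_simplex X m n \<alpha> x) s = geo_pt X n x (push_coords m \<alpha> s)"
  using glue_invariant_geo_pt[of X] assms unfolding glue_invariant_def by blast

lemma None_simplices [simp]: "None \<in> simplices X n"
  and Some_simplices [simp]: "Some x \<in> simplices X n \<longleftrightarrow> x \<in> cells X n"
  by (auto simp: simplices_def)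

lemma op_simplex_None [simp]: "op_simplex X m n \<alpha> None = None"
  and op_simplex_Some [simp]: "op_simplex X m n \<alpha> (Some x) = act X m n \<alpha> x"
  by (auto simp: op_simplex_def)

lemma push_coords_simplex:
  assumes "\<alpha> ` {..m} \<subseteq> {..n}" "s \<in> standard_simplex m"
  shows "push_coords m \<alpha> s \<in> standard_simplex n"
proof -
  have s: "\<And>i. 0 \<le> s i" "(\<Sum>i\<le>m. s i) = 1"
    using assms by (auto simp: standard_simplex_def)
  have "(\<Sum>k\<le>n. push_coords m \<alpha> s k) = (\<Sum>k\<le>n. \<Sum>l | l \<in> {..m} \<and> \<alpha> l = k. s l)"
    by (simp add: push_coords_def)
  also have "\<dots> = (\<Sum>l\<le>m. s l)"
    by (rule sum.group) (use assms in auto)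
  finally have 1: "(\<Sum>k\<le>n. push_coords m \<alpha> s k) = 1"
    using s by simp
  have 2: "0 \<le> push_coords m \<alpha> s k" for k
    unfolding push_coords_def using s by (simp add: sum_nonneg)
  have 3: "push_coords m \<alpha> s k \<le> 1" for k
    unfolding push_coords_def s(2)[symmetric] by (rule sum_mono2) (use s in auto)
  have 4: "push_coords m \<alpha> s k = 0" if "k > n" for k
    unfolding push_coords_def using assms(1) that by (intro sum.neutral) auto
  show ?thesis
    using 1 2 3 4 by (auto simp: standard_simplex_def)
qed

lemma base_of_realization:
  "base_of (realization X) = geo_pt X 0 None (\<lambda>k. if k = 0 then 1 else 0)"
  by (simp add: realization_def)

text \<open>Every basepoint simplex is degenerate on the one in degree 0, whose standard simplex is
  a single point.\<close>

lemma geo_pt_None: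
  assumes "t \<in> standard_simplex n"
  shows "geo_pt X n None t = base_of (realization X)"
proof -
  have "geo_pt X n (op_simplex X n 0 (\<lambda>_. 0) None) t = geo_pt X 0 None (push_coords n (\<lambda>_. 0) t)"
    by (rule geo_pt_glue) (use assms in \<open>auto simp: mono_on_def\<close>)
  moreover have "push_coords n (\<lambda>_. 0) t \<in> standard_simplex 0"
    by (rule push_coords_simplex) (use assms in auto)
  ultimately show ?thesis
    by (simp add: base_of_realization standard_simplex_0)
qed

lemma topspace_realization:
  "topspace (space_of (realization X)) = {geo_pt X n x t | n x t. x \<in> simplices X n \<and> t \<in> standard_simplex n}"
  unfolding realization_def pspace.simps
  by (rule topspace_coinduced_topology) fastforce

lemma geo_pt_in_realization:
  "x \<in> simplices X n \<Longrightarrow> t \<in> standard_simplex n \<Longrightarrow> geo_pt X n x t \<in> topspace (space_of (realization X))"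
  by (auto simp: topspace_realization)

lemma base_in_realization: "base_of (realization X) \<in> topspace (space_of (realization X))"
  unfolding base_of_realization by (rule geo_pt_in_realization) auto

lemma realization_nonbase_cases:
  assumes "p \<in> topspace (space_of (realization X))" "p \<noteq> base_of (realization X)"
  obtains n x t where "x \<in> cells X n" "t \<in> standard_simplex n" "p = geo_pt X n (Some x) t"
proof -
  obtain n x t where p: "x \<in> simplices X n" "t \<in> standard_simplex n" "p = geo_pt X n x t"
    using assms by (auto simp: topspace_realization)
  then show thesis
    using that assms(2) geo_pt_None[of t n X] by (cases x) auto
qed

lemma continuous_map_geo_pt:
  assumes "x \<in> simplices X n"
  shows "continuous_map (subtopology (powertop_real UNIV) (standard_simplex n)) (space_of (realization X)) (geo_pt X n x)"
proof -
  let ?k = "(n, x)" and ?Z = "\<lambda>(n, x). subtopology (powertop_real UNIV) (standard_simplex n)"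
    and ?f = "\<lambda>(n, x) t. geo_pt X n x t"
  have "continuous_map (?Z ?k) (space_of (realization X)) (?f ?k)"
    unfolding realization_def pspace.simps
    by (rule continuous_map_into_coinduced) (use assms in fastforce)+
  then show ?thesis
    by simp
qed

lemma descend_geo_pt:
  assumes "glue_invariant X g" "x \<in> simplices X n" "t \<in> standard_simplex n"
  shows "descend X g (geo_pt X n x t) = g n x t"
  unfolding descend_def
proof (rule the_equality)
  show "\<exists>n' x' t'. x' \<in> simplices X n' \<and> t' \<in> standard_simplex n' \<and> geo_pt X n x t = geo_pt X n' x' t' \<and> g n x t = g n' x' t'"
    using assms by blast
next
  fix q assume "\<exists>n' x' t'. x' \<in> simplices X n' \<and> t' \<in> standard_simplex n' \<and> geo_pt X n x t = geo_pt X n' x' t' \<and> q = g n' x' t'"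
  then show "q = g n x t"
    using glue_invariant_cong[OF assms(1)] by metis
qed

lemma continuous_map_descend:
  assumes g: "glue_invariant X g"
    and cont: "\<And>n x. x \<in> simplices X n \<Longrightarrow>
      continuous_map (subtopology (powertop_real UNIV) (standard_simplex n)) Y (g n x)"
  shows "continuous_map (space_of (realization X)) Y (descend X g)"
  unfolding realization_def pspace.simps
proof (rule continuous_map_from_coinduced)
  show "(case k of (n, x) \<Rightarrow> \<lambda>t. geo_pt X n x t) t
      \<in> {geo_pt X n x t |n x t. x \<in> simplices X n \<and> t \<in> standard_simplex n}"
    if "k \<in> {(n, x). x \<in> simplices X n}"
      "t \<in> topspace (case k of (n, x) \<Rightarrow> subtopology (powertop_real UNIV) (standard_simplex n))" for k t
    using that by fastforce
next
  fix k assume "k \<in> {(n, x). x \<in> simplices X n}"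
  then obtain n x where k: "k = (n, x)" "x \<in> simplices X n"
    by auto
  show "continuous_map (case k of (n, x) \<Rightarrow> subtopology (powertop_real UNIV) (standard_simplex n)) Y
      (\<lambda>t. descend X g ((case k of (n, x) \<Rightarrow> \<lambda>t. geo_pt X n x t) t))"
    unfolding k prod.case
    by (rule continuous_map_eq[OF cont[OF k(2)]]) (simp add: descend_geo_pt g k)
next
  show "descend X g ` {geo_pt X n x t |n x t. x \<in> simplices X n \<and> t \<in> standard_simplex n} \<subseteq> topspace Y"
    using cont by (fastforce simp: descend_geo_pt g continuous_map_def)
qed

section \<open>Isomorphisms of pointed simplicial sets\<close>

text \<open>The record \<open>psset\<close> does not guarantee that operators end in
  \<open>simplices\<close>, so this closure is demanded of the source together with compatibility;
  for the target it follows through \<open>psset_iso_in\<close>. A single \<open>E\<close> serves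
  all degrees.\<close>

definition psset_iso :: "'s psset \<Rightarrow> 't psset \<Rightarrow> ('s \<Rightarrow> 't) \<Rightarrow> bool" where
  "psset_iso X Y E \<longleftrightarrow> (\<forall>n. bij_betw E (cells X n) (cells Y n)) \<and>
     (\<forall>m n \<alpha> x. mono_on {..m} \<alpha> \<longrightarrow> \<alpha> ` {..m} \<subseteq> {..n} \<longrightarrow> x \<in> cells X n \<longrightarrow>
        act X m n \<alpha> x \<in> simplices X m \<and> map_option E (act X m n \<alpha> x) = act Y m n \<alpha> (E x))"

lemma psset_isoD:
  assumes "psset_iso X Y E" "mono_on {..m} \<alpha>" "\<alpha> ` {..m} \<subseteq> {..n}" "x \<in> cells X n"
  shows "act X m n \<alpha> x \<in> simplices X m" "act Y m n \<alpha> (E x) = map_option E (act X m n \<alpha> x)"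
  using assms unfolding psset_iso_def by metis+

lemma psset_iso_in:
  assumes "psset_iso X Y E" "x \<in> simplices X n"
  shows "map_option E x \<in> simplices Y n"
proof -
  have "bij_betw E (cells X n) (cells Y n)"
    using assms(1) by (simp add: psset_iso_def)
  then show ?thesis
    using assms(2) by (cases x) (auto simp: bij_betw_def)
qed

lemma psset_iso_inj:
  assumes "psset_iso X Y E" "x \<in> simplices X n" "y \<in> simplices X n" "map_option E x = map_option E y"
  shows "x = y"
proof -
  have "bij_betw E (cells X n) (cells Y n)"
    using assms(1) by (simp add: psset_iso_def)
  then show ?thesis
    using assms(2-) by (cases x; cases y) (auto simp: bij_betw_def inj_on_def)
qed

lemma psset_iso_surj:
  assumes "psset_iso X Y E" "y \<in> simplices Y n"
  obtains x where "x \<in> simplices X n" "y = map_option E x"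
proof (cases y)
  case None
  then show ?thesis
    using that[of None] by simp
next
  case (Some b)
  moreover have "bij_betw E (cells X n) (cells Y n)"
    using assms(1) by (simp add: psset_iso_def)
  ultimately obtain a where "a \<in> cells X n" "b = E a"
    using assms(2) by (auto simp: bij_betw_def)
  then show ?thesis
    using that[of "Some a"] Some by simp
qed

lemma psset_iso_op:
  assumes "psset_iso X Y E" "mono_on {..m} \<alpha>" "\<alpha> ` {..m} \<subseteq> {..n}" "x \<in> simplices X n"
  shows "op_simplex X m n \<alpha> x \<in> simplices X m"
    "op_simplex Y m n \<alpha> (map_option E x) = map_option E (op_simplex X m n \<alpha> x)"
  using psset_isoD[OF assms(1-3)] assms(4) by (cases x; auto)+

lemma glue_invariant_iso:
  assumes iso: "psset_iso X Y E" and g: "glue_invariant Y g"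
  shows "glue_invariant X (\<lambda>n x. g n (map_option E x))"
  unfolding glue_invariant_def
proof (intro allI impI)
  fix m n and \<alpha> :: "nat \<Rightarrow> nat" and x s
  assume a: "mono_on {..m} \<alpha>" "\<alpha> ` {..m} \<subseteq> {..n}" "x \<in> simplices X n" "s \<in> standard_simplex m"
  show "g m (map_option E (op_simplex X m n \<alpha> x)) s = g n (map_option E x) (push_coords m \<alpha> s)"
    using g a(1,2,4) psset_iso_in[OF iso a(3)]
    unfolding psset_iso_op(2)[OF iso a(1-3), symmetric] glue_invariant_def by blast
qed

lemma homeomorphic_map_psset_iso:
  assumes iso: "psset_iso X Y E"
  shows "homeomorphic_map (space_of (realization X)) (space_of (realization Y))
    (descend X (\<lambda>n x. geo_pt Y n (map_option E x)))"
proof -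
  define f where "f = (\<lambda>n x. geo_pt Y n (map_option E x))"
  \<comment> \<open>\<open>E\<close> is only known to be injective on the cells of a fixed degree,
    so its inverse is formed degree by degree.\<close>
  define D where "D = (\<lambda>n y. THE x. x \<in> simplices X n \<and> y = map_option E x)"
  define g where "g = (\<lambda>n y. geo_pt X n (D n y))"
  have D: "D n (map_option E x) = x" if "x \<in> simplices X n" for n x
    unfolding D_def by (rule the_equality) (use that psset_iso_inj[OF iso] in blast)+
  have Din: "D n y \<in> simplices X n" "map_option E (D n y) = y" if "y \<in> simplices Y n" for n y
    using psset_iso_surj[OF iso that] D by metis+
  have f: "glue_invariant X f"
    unfolding f_def by (rule glue_invariant_iso[OF iso glue_invariant_geo_pt])
  have g: "glue_invariant Y g"
    unfolding glue_invariant_def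
  proof (intro allI impI)
    fix m n and \<alpha> :: "nat \<Rightarrow> nat" and y s
    assume a: "mono_on {..m} \<alpha>" "\<alpha> ` {..m} \<subseteq> {..n}" "y \<in> simplices Y n" "s \<in> standard_simplex m"
    obtain x where x: "x \<in> simplices X n" "y = map_option E x"
      using psset_iso_surj[OF iso a(3)] by blast
    show "g m (op_simplex Y m n \<alpha> y) s = g n y (push_coords m \<alpha> s)"
      using geo_pt_glue[OF a(1,2) x(1) a(4)]
      by (simp add: g_def x psset_iso_op[OF iso a(1,2) x(1)] D)
  qed
  have cf: "continuous_map (space_of (realization X)) (space_of (realization Y)) (descend X f)"
    by (rule continuous_map_descend[OF f]) (simp add: f_def continuous_map_geo_pt psset_iso_in[OF iso])
  have cg: "continuous_map (space_of (realization Y)) (space_of (realization X)) (descend Y g)"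
    by (rule continuous_map_descend[OF g]) (simp add: g_def continuous_map_geo_pt Din)
  have F: "descend X f (geo_pt X n x t) = geo_pt Y n (map_option E x) t"
    if "x \<in> simplices X n" "t \<in> standard_simplex n" for n x t
    using descend_geo_pt[OF f that] by (simp add: f_def)
  have G: "descend Y g (geo_pt Y n x t) = geo_pt X n (D n x) t"
    if "x \<in> simplices Y n" "t \<in> standard_simplex n" for n x t
    using descend_geo_pt[OF g that] by (simp add: g_def)
  have "homeomorphic_maps (space_of (realization X)) (space_of (realization Y)) (descend X f) (descend Y g)"
    unfolding homeomorphic_maps_def
  proof (intro conjI cf cg ballI)
    fix p assume "p \<in> topspace (space_of (realization X))"
    then obtain n x t where "p = geo_pt X n x t" "x \<in> simplices X n" "t \<in> standard_simplex n"
      by (auto simp: topspace_realization)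
    then show "descend Y g (descend X f p) = p"
      using D by (simp add: F G psset_iso_in[OF iso])
  next
    fix p assume "p \<in> topspace (space_of (realization Y))"
    then obtain n x t where "p = geo_pt Y n x t" "x \<in> simplices Y n" "t \<in> standard_simplex n"
      by (auto simp: topspace_realization)
    then show "descend X f (descend Y g p) = p"
      using Din by (simp add: F G)
  qed
  then show ?thesis
    unfolding f_def using homeomorphic_map_maps by blast
qed

text \<open>Only a left inverse of \<open>E\<close> on cells has to be supplied: surjectivity of
  \<open>E\<close> lets every operator identity be read backwards. This produces the direction in
  which \<open>ST_to_RT\<close> is defined.\<close>

lemma psset_iso_inverse:
  assumes iso: "psset_iso X Y E" and inv: "\<And>n x. x \<in> cells X n \<Longrightarrow> E' (E x) = x"
  shows "psset_iso Y X E'"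
  unfolding psset_iso_def
proof (intro conjI allI impI)
  fix n
  have "bij_betw E (cells X n) (cells Y n)"
    using iso by (simp add: psset_iso_def)
  then have im: "E ` cells X n = cells Y n"
    by (simp add: bij_betw_def)
  have "E' y \<in> cells X n \<and> E (E' y) = y" if y: "y \<in> cells Y n" for y
  proof -
    obtain x where "x \<in> cells X n" "y = E x"
      using y im by blast
    then show ?thesis
      using inv[of x n] by simp
  qed
  moreover have "E x \<in> cells Y n" if "x \<in> cells X n" for x
    using that im by blast
  ultimately show "bij_betw E' (cells Y n) (cells X n)"
    using inv by (intro bij_betwI[where g = E]) blast+
next
  fix m n and \<alpha> :: "nat \<Rightarrow> nat" and y
  assume a: "mono_on {..m} \<alpha>" "\<alpha> ` {..m} \<subseteq> {..n}" and y: "y \<in> cells Y n"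
  then have "Some y \<in> simplices Y n"
    by simp
  then obtain x' where x': "x' \<in> simplices X n" "Some y = map_option E x'"
    by (rule psset_iso_surj[OF iso])
  then obtain x where x: "x \<in> cells X n" "y = E x"
    by (cases x') auto
  note D = psset_isoD[OF iso a x(1)]
  show "act Y m n \<alpha> y \<in> simplices Y m"
    using psset_iso_in[OF iso D(1)] by (simp add: x D(2))
  show "map_option E' (act Y m n \<alpha> y) = act X m n \<alpha> (E' y)"
  proof (cases "act X m n \<alpha> x")
    case None
    then show ?thesis
      using inv[OF x(1)] by (simp add: x D(2))
  next
    case (Some x')
    then show ?thesis
      using D(1) inv[OF x(1)] inv[of x' m] by (simp add: x D(2))
  qed
qed

section \<open>Chains with prescribed members\<close>

text \<open>\<open>ST_sset V\<close> and \<open>RT V\<close> are of this form, and \<open>susp (RT_join V U)\<close> is isomorphic to one: it consists of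
  the chains in \<open>V\<close> through \<open>0\<close>, \<open>U\<close> and \<open>V\<close>.\<close>

definition chain_sset :: "'a set set \<Rightarrow> 'a set set \<Rightarrow> 'a set list psset" where
  "chain_sset P R = nerve_quot P ((\<lambda>r. P - {r}) ` R)"

definition reindex :: "nat \<Rightarrow> (nat \<Rightarrow> nat) \<Rightarrow> 'a list \<Rightarrow> 'a list" where
  "reindex m \<alpha> c = map (\<lambda>l. c ! \<alpha> l) [0..<Suc m]"

text \<open>The integral of \<open>f\<close> against the discrete measure with mass
  \<open>t l\<close> at \<open>c ! l\<close>; repeated members add up. \<open>weight\<close> is the
  mass of one member.\<close>

definition weighted_sum :: "'b list \<Rightarrow> (nat \<Rightarrow> real) \<Rightarrow> ('b \<Rightarrow> real) \<Rightarrow> real" where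
  "weighted_sum c t f = (\<Sum>l<length c. t l * f (c ! l))"

definition weight :: "'b list \<Rightarrow> (nat \<Rightarrow> real) \<Rightarrow> 'b \<Rightarrow> real" where
  "weight c t W = weighted_sum c t (\<lambda>X. of_bool (X = W))"

lemma length_reindex [simp]: "length (reindex m \<alpha> c) = Suc m"
  by (simp add: reindex_def)

lemma nth_reindex [simp]: "l \<le> m \<Longrightarrow> reindex m \<alpha> c ! l = c ! \<alpha> l"
  unfolding reindex_def by (subst nth_map) (auto simp del: upt_Suc)

lemma set_reindex: "set (reindex m \<alpha> c) = (\<lambda>l. c ! \<alpha> l) ` {..m}"
  by (auto simp: reindex_def simp del: upt_Suc)

lemma set_reindex_subset:
  assumes "\<alpha> ` {..m} \<subseteq> {..n}" "length c = Suc n"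
  shows "set (reindex m \<alpha> c) \<subseteq> set c"
proof -
  have "\<alpha> l < length c" if "l \<le> m" for l
    using assms that by (auto simp: image_subset_iff less_Suc_eq_le)
  then show ?thesis
    by (auto simp: set_reindex)
qed

lemma sorted_reindex:
  assumes "mono_on {..m} \<alpha>" "\<alpha> ` {..m} \<subseteq> {..n}" "length c = Suc n" "sorted_wrt (\<subseteq>) c"
  shows "sorted_wrt (\<subseteq>) (reindex m \<alpha> c)"
  unfolding sorted_wrt_iff_nth_less
proof (intro allI impI)
  fix i j assume "i < j" "j < length (reindex m \<alpha> c)"
  then have ij: "i \<le> m" "j \<le> m" "\<alpha> i \<le> \<alpha> j" "\<alpha> j < length c"
    using assms(1-3) by (auto simp: mono_on_def image_subset_iff less_Suc_eq_le)
  have "c ! \<alpha> i \<subseteq> c ! \<alpha> j"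
    using ij assms(4) by (cases "\<alpha> i = \<alpha> j") (auto simp: sorted_wrt_iff_nth_less)
  then show "reindex m \<alpha> c ! i \<subseteq> reindex m \<alpha> c ! j"
    using ij by simp
qed

lemma cells_chain_sset:
  "c \<in> cells (chain_sset P R) n \<longleftrightarrow> length c = Suc n \<and> set c \<subseteq> P \<and> sorted_wrt (\<subseteq>) c \<and> R \<subseteq> set c"
  by (auto simp: chain_sset_def nerve_quot_def nerve_def)

lemma act_chain_sset:
  assumes "mono_on {..m} \<alpha>" "\<alpha> ` {..m} \<subseteq> {..n}" "c \<in> cells (chain_sset P R) n"
  shows "act (chain_sset P R) m n \<alpha> c =
    (if R \<subseteq> set (reindex m \<alpha> c) then Some (reindex m \<alpha> c) else None)"
proof -
  let ?c = "reindex m \<alpha> c"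
  have "length ?c = Suc m" "sorted_wrt (\<subseteq>) ?c" "set ?c \<subseteq> P"
    using assms sorted_reindex set_reindex_subset[OF assms(2), of c] by (auto simp: cells_chain_sset)
  then have "?c \<in> (\<Union>Q\<in>(\<lambda>r. P - {r}) ` R. nerve Q m) \<longleftrightarrow> \<not> R \<subseteq> set ?c"
    by (auto simp: nerve_def)
  then show ?thesis
    by (simp add: chain_sset_def nerve_quot_def Let_def reindex_def del: upt_Suc)
qed

lemma reindex_in_cells:
  assumes "mono_on {..m} \<alpha>" "\<alpha> ` {..m} \<subseteq> {..n}" "c \<in> cells (chain_sset P R) n" "R \<subseteq> set (reindex m \<alpha> c)"
  shows "reindex m \<alpha> c \<in> cells (chain_sset P R) m"
  using assms sorted_reindex set_reindex_subset[OF assms(2), of c] by (auto simp: cells_chain_sset)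

section \<open>Weights and operators\<close>

text \<open>Change of variables for the push-forward of a discrete measure: all weighted sums, hence
  all weights, are constant along gluing.\<close>

lemma weighted_sum_reindex:
  assumes "\<alpha> ` {..m} \<subseteq> {..n}" "length c = Suc n"
  shows "weighted_sum (reindex m \<alpha> c) s f = weighted_sum c (push_coords m \<alpha> s) f"
proof -
  have "weighted_sum c (push_coords m \<alpha> s) f = (\<Sum>k\<le>n. \<Sum>l | l \<in> {..m} \<and> \<alpha> l = k. s l * f (c ! \<alpha> l))"
    unfolding weighted_sum_def push_coords_def assms(2) lessThan_Suc_atMost
    by (intro sum.cong) (auto simp: sum_distrib_right intro!: sum.cong)
  also have "\<dots> = (\<Sum>l\<le>m. s l * f (c ! \<alpha> l))"
    by (rule sum.group) (use assms in auto)
  also have "\<dots> = weighted_sum (reindex m \<alpha> c) s f"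
    unfolding weighted_sum_def length_reindex lessThan_Suc_atMost by (intro sum.cong) auto
  finally show ?thesis ..
qed

lemma weight_reindex:
  assumes "\<alpha> ` {..m} \<subseteq> {..n}" "length c = Suc n"
  shows "weight (reindex m \<alpha> c) s = weight c (push_coords m \<alpha> s)"
  using weighted_sum_reindex[OF assms] by (auto simp: weight_def fun_eq_iff)

text \<open>Grouping the vertices by the member they carry shows that a weighted sum is a function
  of the weights alone. Quantities written as weighted sums are therefore compatible with
  gluing.\<close>

lemma weighted_sum_weight:
  assumes "finite S" "set c \<subseteq> S"
  shows "weighted_sum c t f = (\<Sum>W\<in>S. weight c t W * f W)"
proof -
  have "(\<Sum>W\<in>S. weight c t W * f W) = (\<Sum>W\<in>S. \<Sum>l<length c. t l * of_bool (c ! l = W) * f W)"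
    unfolding weight_def weighted_sum_def sum_distrib_right ..
  also have "\<dots> = (\<Sum>l<length c. \<Sum>W\<in>S. t l * of_bool (c ! l = W) * f W)"
    by (rule sum.swap)
  also have "\<dots> = (\<Sum>l<length c. t l * f (c ! l))"
  proof (rule sum.cong)
    fix l assume "l \<in> {..<length c}"
    then have "c ! l \<in> S"
      using assms(2) by auto
    have "(\<Sum>W\<in>S. t l * of_bool (c ! l = W) * f W) = (\<Sum>W\<in>S. if c ! l = W then t l * f W else 0)"
      by (intro sum.cong) auto
    also have "\<dots> = t l * f (c ! l)"
      using \<open>c ! l \<in> S\<close> assms(1) by simp
    finally show "(\<Sum>W\<in>S. t l * of_bool (c ! l = W) * f W) = t l * f (c ! l)" .
  qed simp
  finally show ?thesis
    by (simp add: weighted_sum_def)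
qed

lemma weighted_sum_cong:
  assumes "weight c t = weight c' t'"
  shows "weighted_sum c t f = weighted_sum c' t' f"
  using weighted_sum_weight[of "set c \<union> set c'" c t f] weighted_sum_weight[of "set c \<union> set c'" c' t' f] assms
  by simp

lemma simplex_nonneg: "t \<in> standard_simplex n \<Longrightarrow> 0 \<le> t l"
  and simplex_zero: "t \<in> standard_simplex n \<Longrightarrow> n < l \<Longrightarrow> t l = 0"
  and simplex_sum: "t \<in> standard_simplex n \<Longrightarrow> (\<Sum>l\<le>n. t l) = 1"
  by (auto simp: standard_simplex_def)

lemma in_standard_simplexI:
  assumes "\<And>l. 0 \<le> t l" "\<And>l. n < l \<Longrightarrow> t l = 0" "(\<Sum>l\<le>n. t l) = 1"
  shows "t \<in> standard_simplex n"
proof -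
  have "t l \<le> 1" for l
  proof (cases "l \<le> n")
    case True
    then have "t l \<le> (\<Sum>l\<le>n. t l)"
      by (intro member_le_sum) (use assms in auto)
    then show ?thesis
      using assms by simp
  qed (use assms in auto)
  then show ?thesis
    using assms by (auto simp: standard_simplex_def)
qed

lemma weight_nonneg:
  assumes "\<And>l. 0 \<le> t l"
  shows "0 \<le> weight c t W"
  unfolding weight_def weighted_sum_def using assms by (intro sum_nonneg) auto

lemma weight_ge:
  assumes "\<And>l. 0 \<le> t l" "l < length c"
  shows "t l \<le> weight c t (c ! l)"
proof -
  have "t l * of_bool (c ! l = c ! l) \<le> weight c t (c ! l)"
    unfolding weight_def weighted_sum_def by (rule member_le_sum) (use assms in auto)
  then show ?thesis
    by simp
qed

lemma weight_distinct:
  assumes "distinct c" "l < length c"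
  shows "weight c t (c ! l) = t l"
proof -
  have "weight c t (c ! l) = (\<Sum>k<length c. if k = l then t k else 0)"
    unfolding weight_def weighted_sum_def
    by (intro sum.cong) (use assms in \<open>auto simp: nth_eq_iff_index_eq\<close>)
  then show ?thesis
    using assms by simp
qed

lemma weight_not_in: "W \<notin> set c \<Longrightarrow> weight c t W = 0"
  unfolding weight_def weighted_sum_def by (intro sum.neutral) auto

lemma strict_chain_unique:
  "sorted_wrt (\<subset>) xs \<Longrightarrow> sorted_wrt (\<subset>) ys \<Longrightarrow> set xs = set ys \<Longrightarrow> xs = ys"
proof (induction xs arbitrary: ys)
  case (Cons x xs)
  then obtain y ys' where ys: "ys = y # ys'"
    by (cases ys) auto
  have x: "\<forall>z\<in>set xs. x \<subset> z" and y: "\<forall>z\<in>set ys'. y \<subset> z"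
    using Cons.prems by (auto simp: ys)
  have "x = y"
    using Cons.prems(3) x y unfolding ys by (metis list.set_intros(1) psubset_eq set_ConsD subset_antisym)
  moreover have "set xs = set ys'"
    using Cons.prems(3) x y \<open>x = y\<close> unfolding ys by auto
  ultimately show ?case
    using Cons ys by simp
qed simp

lemma strict_chain_distinct: "sorted_wrt (\<subset>) xs \<Longrightarrow> distinct xs"
  by (induction xs) auto

section \<open>Normal forms of points\<close>

text \<open>The face is spanned by the vertices of positive coordinate, and the sorted list of their
  indices is itself the operator.\<close>

lemma support_face:
  assumes t: "t \<in> standard_simplex n"
  obtains m \<alpha> s where "mono_on {..m} \<alpha>" "\<alpha> ` {..m} \<subseteq> {..n}" "\<alpha> ` {..m} = {l. 0 < t l}" "s \<in> standard_simplex m"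
    "\<And>l. l \<le> m \<Longrightarrow> 0 < s l" "push_coords m \<alpha> s = t"
proof -
  define S where "S = {l. 0 < t l}"
  define xs where "xs = sorted_list_of_set S"
  define m where "m = card S - 1"
  define s where "s = (\<lambda>l. if l \<le> m then t (xs ! l) else 0)"
  have Sn: "S \<subseteq> {..n}"
    unfolding S_def using simplex_zero[OF t] by (metis atMost_iff less_irrefl mem_Collect_eq not_le_imp_less subsetI)
  then have fin: "finite S"
    using finite_subset by blast
  have "S \<noteq> {}"
  proof
    assume "S = {}"
    then have "\<And>l. t l = 0"
      using simplex_nonneg[OF t] unfolding S_def by (metis empty_Collect_eq order_le_less)
    then show False
      using simplex_sum[OF t] by simp
  qed
  then have m: "length xs = Suc m"
    using fin by (simp add: xs_def m_def card_gt_0_iff)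
  have xs: "set xs = S" "sorted xs" "distinct xs"
    using fin by (auto simp: xs_def)
  have bij: "bij_betw ((!) xs) {..m} S"
    using bij_betw_nth[OF xs(3), of "{..m}" S] xs(1) m by (simp add: lessThan_Suc_atMost)
  have push: "push_coords m ((!) xs) s = t"
  proof
    fix k
    show "push_coords m ((!) xs) s k = t k"
    proof (cases "k \<in> S")
      case True
      then obtain l where l: "l \<le> m" "xs ! l = k"
        using bij by (auto simp: bij_betw_def)
      have "{l'. l' \<le> m \<and> xs ! l' = k} = {l}"
        using l bij by (auto simp: bij_betw_def inj_on_def)
      then show ?thesis
        using l by (simp add: push_coords_def s_def)
    next
      case False
      then have "{l'. l' \<le> m \<and> xs ! l' = k} = {}"
        using bij by (auto simp: bij_betw_def)
      then have "push_coords m ((!) xs) s k = 0"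
        unfolding push_coords_def by (simp only: sum.empty)
      then show ?thesis
        using False simplex_nonneg[OF t, of k] by (simp add: S_def)
    qed
  qed
  have "(\<Sum>l\<le>m. s l) = (\<Sum>l\<le>m. t (xs ! l))"
    by (simp add: s_def)
  also have "\<dots> = (\<Sum>k\<in>S. t k)"
    by (rule sum.reindex_bij_betw[OF bij])
  also have "\<dots> = (\<Sum>k\<le>n. t k)"
    by (rule sum.mono_neutral_left) (use Sn simplex_nonneg[OF t] in \<open>auto simp: S_def order_le_less\<close>)
  finally have "s \<in> standard_simplex m"
    using simplex_sum[OF t] simplex_nonneg[OF t] by (intro in_standard_simplexI) (auto simp: s_def)
  moreover have "0 < s l" if "l \<le> m" for l
    using that bij by (auto simp: s_def bij_betw_def S_def)
  moreover have "mono_on {..m} ((!) xs)"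
    using xs(2) m by (auto simp: mono_on_def sorted_nth_mono)
  ultimately show thesis
    using that[of m "(!) xs" s] bij Sn push by (simp add: bij_betw_def S_def)
qed

text \<open>On the face spanned by the vertices of positive coordinate the member \<open>r\<close>
  no longer occurs, so the corresponding operator sends the simplex to the basepoint.\<close>

lemma chain_geo_pt_base:
  assumes c: "c \<in> cells (chain_sset P R) n" and t: "t \<in> standard_simplex n"
    and r: "r \<in> R" "weight c t r = 0"
  shows "geo_pt (chain_sset P R) n (Some c) t = base_of (realization (chain_sset P R))"
proof -
  obtain m \<alpha> s where a: "mono_on {..m} \<alpha>" "\<alpha> ` {..m} \<subseteq> {..n}" "\<alpha> ` {..m} = {l. 0 < t l}" "s \<in> standard_simplex m"
    "push_coords m \<alpha> s = t"
    using support_face[OF t] by metis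
  have "r \<notin> set (reindex m \<alpha> c)"
  proof
    assume "r \<in> set (reindex m \<alpha> c)"
    then obtain l where l: "l \<in> \<alpha> ` {..m}" "r = c ! l"
      by (auto simp: set_reindex)
    then have "l < length c" "0 < t l"
      using a c by (auto simp: cells_chain_sset)
    then show False
      using weight_ge[of t l c] simplex_nonneg[OF t] l r by fastforce
  qed
  then have "act (chain_sset P R) m n \<alpha> c = None"
    using act_chain_sset[OF a(1,2) c] r by auto
  then show ?thesis
    using geo_pt_glue[OF a(1,2), of "Some c" "chain_sset P R" s] a c geo_pt_None[OF a(4), of "chain_sset P R"] by simp
qed

text \<open>Criterion for maps out of a chain set: it is enough that the value depends only on the
  weights and is \<open>y\<close> when a required member has weight 0. An operator that keeps all of
  \<open>R\<close> preserves the weights, and one that loses some \<open>r\<close> leaves it with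
  weight 0.\<close>

lemma glue_invariant_chain:
  assumes None: "\<And>n t. t \<in> standard_simplex n \<Longrightarrow> g n None t = y"
    and zero: "\<And>n c t r. c \<in> cells (chain_sset P R) n \<Longrightarrow> t \<in> standard_simplex n \<Longrightarrow> r \<in> R \<Longrightarrow>
      weight c t r = 0 \<Longrightarrow> g n (Some c) t = y"
    and eq: "\<And>n c t m d s. c \<in> cells (chain_sset P R) n \<Longrightarrow> t \<in> standard_simplex n \<Longrightarrow>
      d \<in> cells (chain_sset P R) m \<Longrightarrow> s \<in> standard_simplex m \<Longrightarrow> weight c t = weight d s \<Longrightarrow>
      g n (Some c) t = g m (Some d) s"
  shows "glue_invariant (chain_sset P R) g"
  unfolding glue_invariant_def
proof (intro allI impI)
  fix m n and \<alpha> :: "nat \<Rightarrow> nat" and x s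
  assume a: "mono_on {..m} \<alpha>" "\<alpha> ` {..m} \<subseteq> {..n}" and x: "x \<in> simplices (chain_sset P R) n"
    and s: "s \<in> standard_simplex m"
  have p: "push_coords m \<alpha> s \<in> standard_simplex n"
    using push_coords_simplex[OF a(2) s] .
  show "g m (op_simplex (chain_sset P R) m n \<alpha> x) s = g n x (push_coords m \<alpha> s)"
  proof (cases x)
    case None
    then show ?thesis
      using assms(1)[OF s] assms(1)[OF p] by simp
  next
    case (Some c)
    then have c: "c \<in> cells (chain_sset P R) n"
      using x by simp
    then have w: "weight (reindex m \<alpha> c) s = weight c (push_coords m \<alpha> s)"
      by (intro weight_reindex[OF a(2)]) (simp add: cells_chain_sset)
    show ?thesis
    proof (cases "R \<subseteq> set (reindex m \<alpha> c)")
      case True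
      then show ?thesis
        using eq[OF reindex_in_cells[OF a c True] s c p w] act_chain_sset[OF a c] Some by simp
    next
      case False
      then obtain r where "r \<in> R" "weight c (push_coords m \<alpha> s) r = 0"
        using weight_not_in w by (metis subsetI)
      then show ?thesis
        using zero[OF c p] False act_chain_sset[OF a c] Some assms(1)[OF s] by simp
    qed
  qed
qed

text \<open>The universal instance of the criterion: the weights themselves, with the basepoint
  split off. It detects both equality with the basepoint and, away from it, a difference of
  weights.\<close>

lemma glue_invariant_weight:
  "glue_invariant (chain_sset P R)
     (\<lambda>n x t. case x of None \<Rightarrow> None | Some c \<Rightarrow> if \<exists>r\<in>R. weight c t r = 0 then None else Some (weight c t))"
  by (rule glue_invariant_chain[where y = None]) auto

lemma chain_geo_pt_base_iff:
  assumes c: "c \<in> cells (chain_sset P R) n" and t: "t \<in> standard_simplex n"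
  shows "geo_pt (chain_sset P R) n (Some c) t = base_of (realization (chain_sset P R)) \<longleftrightarrow>
    (\<exists>r\<in>R. weight c t r = 0)"
proof
  assume "geo_pt (chain_sset P R) n (Some c) t = base_of (realization (chain_sset P R))"
  from glue_invariant_cong[OF glue_invariant_weight this[unfolded base_of_realization]]
  show "\<exists>r\<in>R. weight c t r = 0"
    by (auto split: if_splits)
qed (use chain_geo_pt_base[OF c t] in blast)

lemma chain_geo_pt_weight:
  assumes eq: "geo_pt (chain_sset P R) n (Some c) t = geo_pt (chain_sset P R) m (Some d) s"
    and "\<And>r. r \<in> R \<Longrightarrow> weight c t r \<noteq> 0"
  shows "weight c t = weight d s"
  using glue_invariant_cong[OF glue_invariant_weight eq] assms(2) by (auto split: if_splits)

text \<open>Discarding the vertices of weight 0 makes all coordinates positive and keeps every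
  required member, whose weight is nonzero; merging equal neighbours makes the chain strict and adds
  up their positive coordinates.\<close>

lemma chain_normal_form:
  assumes c: "c \<in> cells (chain_sset P R) n" and t: "t \<in> standard_simplex n"
    and pos: "\<And>r. r \<in> R \<Longrightarrow> weight c t r \<noteq> 0"
  obtains m d s where "d \<in> cells (chain_sset P R) m" "sorted_wrt (\<subset>) d" "s \<in> standard_simplex m"
    "\<And>k. k \<le> m \<Longrightarrow> 0 < s k"
    "geo_pt (chain_sset P R) n (Some c) t = geo_pt (chain_sset P R) m (Some d) s"
proof -
  let ?X = "chain_sset P R"
  obtain m \<alpha> s where a: "mono_on {..m} \<alpha>" "\<alpha> ` {..m} \<subseteq> {..n}" "\<alpha> ` {..m} = {l. 0 < t l}" and s: "s \<in> standard_simplex m"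
    and spos: "\<And>l. l \<le> m \<Longrightarrow> 0 < s l" and push: "push_coords m \<alpha> s = t"
    using support_face[OF t] by metis
  define d where "d = reindex m \<alpha> c"
  have "weight d s = weight c t"
    unfolding d_def push[symmetric] using c by (intro weight_reindex[OF a(2)]) (simp add: cells_chain_sset)
  then have R: "R \<subseteq> set d"
    using pos weight_not_in by (metis subsetI)
  have d: "d \<in> cells ?X m"
    using reindex_in_cells[OF a(1,2) c] R by (simp add: d_def)
  have eq1: "geo_pt ?X n (Some c) t = geo_pt ?X m (Some d) s"
    using geo_pt_glue[OF a(1,2), of "Some c" ?X s] c s push R act_chain_sset[OF a(1,2) c] by (simp add: d_def)
  define e where "e = remdups_adj d"
  \<comment> \<open>\<open>f\<close> is the surjection that exhibits \<open>d\<close> as a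
    degeneracy of \<open>e\<close>.\<close>
  obtain f where f: "mono f" "f ` {0..<length d} = {0..<length e}" "\<And>i. i < length d \<Longrightarrow> d ! i = e ! f i"
    using remdups_adj_altdef[of d e] e_def by metis
  define k where "k = length e - 1"
  have "d \<noteq> []"
    using d by (auto simp: cells_chain_sset)
  then have e: "length e = Suc k" "set e = set d"
    by (auto simp: k_def e_def)
  have ld: "length d = Suc m"
    by (simp add: d_def)
  have fk: "f ` {..m} = {..k}"
    using f(2) unfolding ld e(1) by (simp add: atLeast0LessThan lessThan_Suc_atMost)
  have sorted_e: "sorted_wrt (\<subset>) e"
  proof -
    have "e ! i \<subset> e ! Suc i" if i: "Suc i < length e" for i
    proof -
      have "e ! i \<noteq> e ! Suc i"
        using i unfolding e_def by (rule remdups_adj_adjacent)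
      moreover obtain a b where ab: "a \<le> m" "b \<le> m" "i = f a" "Suc i = f b"
        using i fk e(1) by (metis Suc_lessD image_iff less_Suc_eq_le atMost_iff)
      then have "a < b"
        using f(1) by (metis Suc_n_not_le_n monoD not_le_imp_less)
      then have "d ! a \<subseteq> d ! b"
        using d ab ld by (auto simp: cells_chain_sset sorted_wrt_iff_nth_less)
      ultimately show ?thesis
        using f(3) ab ld by auto
    qed
    then show ?thesis
      by (subst sorted_wrt_iff_nth_Suc_transp) (auto simp: transp_def)
  qed
  have ecell: "e \<in> cells ?X k"
    using d e sorted_e by (auto simp: cells_chain_sset intro: sorted_wrt_mono_rel[of _ "(\<subset>)"])
  have re: "reindex m f e = d"
    by (rule nth_equalityI) (use ld f(3) in auto)
  have fm: "mono_on {..m} f" "f ` {..m} \<subseteq> {..k}"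
    using f(1) fk by (auto simp: mono_on_def mono_def)
  have "geo_pt ?X m (Some d) s = geo_pt ?X k (Some e) (push_coords m f s)"
    using geo_pt_glue[OF fm, of "Some e" ?X s] ecell s act_chain_sset[OF fm ecell] R by (simp add: re)
  moreover have "push_coords m f s \<in> standard_simplex k"
    by (rule push_coords_simplex[OF fm(2) s])
  moreover have "0 < push_coords m f s j" if "j \<le> k" for j
    unfolding push_coords_def
  proof (rule sum_pos)
    have "j \<in> f ` {..m}"
      using fk that by simp
    then show "{l. l \<le> m \<and> f l = j} \<noteq> {}"
      by auto
  qed (use spos in auto)
  ultimately show thesis
    using that[OF ecell sorted_e] eq1 by simp
qed

text \<open>The members of a strict chain with positive coordinates are exactly the support of its
  weight function, and inclusion orders them in only one way; as there are no repetitions, each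
  coordinate is a weight.\<close>

lemma strict_weight_unique:
  assumes "sorted_wrt (\<subset>) c" "sorted_wrt (\<subset>) d" "length c = Suc n" "length d = Suc m"
    and "t \<in> standard_simplex n" "s \<in> standard_simplex m" "\<And>k. k \<le> n \<Longrightarrow> 0 < t k" "\<And>k. k \<le> m \<Longrightarrow> 0 < s k"
    and w: "weight c t = weight d s"
  shows "n = m" "c = d" "t = s"
proof -
  have supp: "set c = {W. weight c t W \<noteq> 0}" if "sorted_wrt (\<subset>) c" "length c = Suc n" "\<And>k. k \<le> n \<Longrightarrow> 0 < t k"
    for c :: "'a set list" and t n
  proof -
    have "weight c t W \<noteq> 0" if "W \<in> set c" for W
      using that weight_distinct[OF strict_chain_distinct] \<open>sorted_wrt (\<subset>) c\<close> \<open>length c = Suc n\<close>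
        \<open>\<And>k. k \<le> n \<Longrightarrow> 0 < t k\<close> by (metis in_set_conv_nth less_Suc_eq_le less_irrefl)
    then show ?thesis
      using weight_not_in by fastforce
  qed
  have "set c = set d"
    using supp[of c n t] supp[of d m s] assms by simp
  then show cd: "c = d"
    using strict_chain_unique assms by blast
  then show nm: "n = m"
    using assms by simp
  show "t = s"
  proof
    fix l show "t l = s l"
    proof (cases "l \<le> n")
      case True
      then show ?thesis
        using weight_distinct[OF strict_chain_distinct[OF assms(1)], of l t]
          weight_distinct[OF strict_chain_distinct[OF assms(2)], of l s] w assms(3) cd by simp
    next
      case False
      then show ?thesis
        using simplex_zero[OF assms(5)] simplex_zero[OF assms(6)] nm by simp
    qed
  qed
qed

text \<open>Off the basepoint, a point of the realization is thus a weight function with chain support.\<close>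

lemma chain_geo_pt_cong:
  assumes c: "c \<in> cells (chain_sset P R) n" and t: "t \<in> standard_simplex n"
    and d: "d \<in> cells (chain_sset P R) m" and s: "s \<in> standard_simplex m"
    and w: "weight c t = weight d s"
  shows "geo_pt (chain_sset P R) n (Some c) t = geo_pt (chain_sset P R) m (Some d) s"
proof (cases "\<exists>r\<in>R. weight c t r = 0")
  case True
  then show ?thesis
    using chain_geo_pt_base_iff[OF c t] chain_geo_pt_base_iff[OF d s] w by simp
next
  case False
  then have rc: "\<And>r. r \<in> R \<Longrightarrow> weight c t r \<noteq> 0" and rd: "\<And>r. r \<in> R \<Longrightarrow> weight d s r \<noteq> 0"
    using w by auto
  obtain m1 c1 s1 where 1: "c1 \<in> cells (chain_sset P R) m1" "sorted_wrt (\<subset>) c1" "s1 \<in> standard_simplex m1"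
    "\<And>k. k \<le> m1 \<Longrightarrow> 0 < s1 k" "geo_pt (chain_sset P R) n (Some c) t = geo_pt (chain_sset P R) m1 (Some c1) s1"
    using chain_normal_form[OF c t rc] by metis
  obtain m2 c2 s2 where 2: "c2 \<in> cells (chain_sset P R) m2" "sorted_wrt (\<subset>) c2" "s2 \<in> standard_simplex m2"
    "\<And>k. k \<le> m2 \<Longrightarrow> 0 < s2 k" "geo_pt (chain_sset P R) m (Some d) s = geo_pt (chain_sset P R) m2 (Some c2) s2"
    using chain_normal_form[OF d s rd] by metis
  have "weight c1 s1 = weight c2 s2"
    using chain_geo_pt_weight[OF 1(5) rc] chain_geo_pt_weight[OF 2(5) rd] w by simp
  then show ?thesis
    using strict_weight_unique[of c1 c2 m1 m2 s1 s2] 1 2 by (simp add: cells_chain_sset)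
qed

section \<open>Suspensions and joins of chain sets\<close>

text \<open>\<open>susp\<close> and \<open>reduced_join\<close> count the vertices sent below
  \<open>q\<close>. Monotonicity turns that count into the position where the simplex is cut in
  two.\<close>

lemma initial_segment_card:
  fixes \<alpha> :: "nat \<Rightarrow> nat"
  assumes "mono_on {..m} \<alpha>" and k: "k = card {l. l \<le> m \<and> \<alpha> l < q}"
  shows "{l. l \<le> m \<and> \<alpha> l < q} = {..<k}" "k \<le> Suc m"
proof -
  let ?S = "{l. l \<le> m \<and> \<alpha> l < q}"
  have down: "x \<in> ?S" if "y \<in> ?S" "x \<le> y" for x y
  proof -
    have "y \<le> m" "\<alpha> y < q"
      using that(1) by auto
    moreover have "\<alpha> x \<le> \<alpha> y"
      by (rule mono_onD[OF assms(1)]) (use that(2) \<open>y \<le> m\<close> in auto)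
    ultimately show ?thesis
      using that(2) by simp
  qed
  have S: "?S \<subseteq> {..<Suc m}"
    by auto
  then show "k \<le> Suc m"
    using card_mono[OF _ S] k by simp
  have fin: "finite ?S"
    by simp
  have "?S = {..<card ?S}"
  proof (cases "?S = {}")
    case False
    have "?S = {..Max ?S}"
    proof
      show "?S \<subseteq> {..Max ?S}"
        using Max_ge[OF fin] by blast
      show "{..Max ?S} \<subseteq> ?S"
        using down[OF Max_in[OF fin False]] by blast
    qed
    then show ?thesis
      by (metis card_atMost lessThan_Suc_atMost)
  next
    case True
    then show ?thesis
      by (metis card.empty lessThan_0)
  qed
  then show "?S = {..<k}"
    using k by simp
qed

lemma shifted_operator:
  fixes \<alpha> :: "nat \<Rightarrow> nat"
  assumes "mono_on {..m} \<alpha>" "\<alpha> ` {..m} \<subseteq> {..n}" "k = card {l. l \<le> m \<and> \<alpha> l < q}" "k \<le> m"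
  shows "mono_on {..m - k} (\<lambda>l. \<alpha> (l + k) - q)" "(\<lambda>l. \<alpha> (l + k) - q) ` {..m - k} \<subseteq> {..n - q}"
proof -
  have "\<alpha> (r + k) \<le> \<alpha> (s + k)" if "s \<le> m - k" "r \<le> s" for r s
    by (rule mono_onD[OF assms(1)]) (use that assms(4) in auto)
  then show "mono_on {..m - k} (\<lambda>l. \<alpha> (l + k) - q)"
    by (auto simp: mono_on_def intro!: diff_le_mono)
  show "(\<lambda>l. \<alpha> (l + k) - q) ` {..m - k} \<subseteq> {..n - q}"
    using assms(2,4) by (auto simp: image_subset_iff intro!: diff_le_mono)
qed

lemma initial_operator:
  fixes \<alpha> :: "nat \<Rightarrow> nat"
  assumes "mono_on {..m} \<alpha>" "k = card {l. l \<le> m \<and> \<alpha> l < Suc j}" "0 < k"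
  shows "mono_on {..k - 1} \<alpha>" "\<alpha> ` {..k - 1} \<subseteq> {..j}"
proof -
  note S = initial_segment_card[OF assms(1,2)]
  show "mono_on {..k - 1} \<alpha>"
    by (rule mono_on_subset[OF assms(1)]) (use S(2) assms(3) in auto)
  have "l \<in> {l. l \<le> m \<and> \<alpha> l < Suc j}" if "l \<le> k - 1" for l
    unfolding S(1) using that assms(3) by auto
  then show "\<alpha> ` {..k - 1} \<subseteq> {..j}"
    by (auto simp: less_Suc_eq_le)
qed

text \<open>The operator respects the cut: the first \<open>k\<close> indices read from
  \<open>xs\<close>, the others from \<open>ys\<close> after subtracting \<open>length xs\<close>.
  Hence the degrees \<open>k - 1\<close> and \<open>m - k\<close> of the two blocks.\<close>

lemma reindex_append:
  assumes mono: "mono_on {..m} \<alpha>" and k: "k = card {l. l \<le> m \<and> \<alpha> l < length xs}" "0 < k" "k \<le> m"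
  shows "reindex m \<alpha> (xs @ ys) =
    reindex (k - 1) \<alpha> xs @ reindex (m - k) (\<lambda>l. \<alpha> (l + k) - length xs) ys"
proof (rule nth_equalityI)
  fix l assume "l < length (reindex m \<alpha> (xs @ ys))"
  then have l: "l \<le> m"
    by simp
  have iff: "\<alpha> l < length xs \<longleftrightarrow> l < k"
    using initial_segment_card(1)[OF mono k(1)] l by blast
  show "reindex m \<alpha> (xs @ ys) ! l =
      (reindex (k - 1) \<alpha> xs @ reindex (m - k) (\<lambda>l. \<alpha> (l + k) - length xs) ys) ! l"
    using l iff k by (auto simp: nth_append)
qed (use k in simp)

text \<open>This and the next lemma treat the operators that stay in one block. There
  \<open>susp\<close> and \<open>reduced_join\<close> collapse by definition, and the chain set
  collapses since the required members of the other block are lost.\<close>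

lemma set_reindex_append_left:
  assumes "mono_on {..m} \<alpha>" "card {l. l \<le> m \<and> \<alpha> l < length xs} = Suc m"
  shows "set (reindex m \<alpha> (xs @ ys)) \<subseteq> set xs"
proof -
  have "{l. l \<le> m \<and> \<alpha> l < length xs} = {..<Suc m}"
    using initial_segment_card(1)[OF assms(1) refl, of "length xs"] assms(2) by simp
  then have "l \<in> {l. l \<le> m \<and> \<alpha> l < length xs}" if "l \<le> m" for l
    using that by simp
  then show ?thesis
    by (auto simp: set_reindex nth_append)
qed

lemma set_reindex_append_right:
  assumes "card {l. l \<le> m \<and> \<alpha> l < length xs} = 0" "\<alpha> ` {..m} \<subseteq> {..n}" "length (xs @ ys) = Suc n"
  shows "set (reindex m \<alpha> (xs @ ys)) \<subseteq> set ys"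
proof -
  have "\<not> \<alpha> l < length xs" "\<alpha> l < length xs + length ys" if "l \<le> m" for l
    using assms that by (auto simp: image_subset_iff less_Suc_eq_le)
  then have "(xs @ ys) ! \<alpha> l \<in> set ys" if "l \<le> m" for l
    using that by (force simp: nth_append intro!: nth_mem)
  then show ?thesis
    by (auto simp: set_reindex)
qed

section \<open>Suspension as adjoining a least element\<close>

lemma cells_susp: "(k, x) \<in> cells (susp X) n \<longleftrightarrow> 1 \<le> k \<and> k \<le> n \<and> x \<in> cells X (n - k)"
  by (auto simp: susp_def)

lemma act_susp:
  "act (susp X) m n \<alpha> (k, x) = (let k' = card {l. l \<le> m \<and> \<alpha> l < k} in
     if k' = 0 \<or> k' = Suc m then None
     else map_option (Pair k') (act X (m - k') (n - k) (\<lambda>l. \<alpha> (l + k') - k) x))"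
  by (simp add: susp_def)

text \<open>Functoriality of the suspension, used to suspend the isomorphism for the join.\<close>

lemma psset_iso_susp:
  assumes iso: "psset_iso X Y E"
  shows "psset_iso (susp X) (susp Y) (\<lambda>(k, x). (k, E x))"
  unfolding psset_iso_def
proof (intro conjI allI impI)
  fix n
  have bij: "bij_betw E (cells X m) (cells Y m)" for m
    using iso by (simp add: psset_iso_def)
  show "bij_betw (\<lambda>(k, x). (k, E x)) (cells (susp X) n) (cells (susp Y) n)"
    unfolding bij_betw_def
  proof
    show "inj_on (\<lambda>(k, x). (k, E x)) (cells (susp X) n)"
      using bij by (auto simp: inj_on_def bij_betw_def cells_susp)
    show "(\<lambda>(k, x). (k, E x)) ` cells (susp X) n = cells (susp Y) n"
    proof -
      have im: "E ` cells X m = cells Y m" for m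
        using bij by (simp add: bij_betw_def)
      have "(k, y) \<in> (\<lambda>(k, x). (k, E x)) ` cells (susp X) n" if "(k, y) \<in> cells (susp Y) n" for k y
      proof -
        have "y \<in> E ` cells X (n - k)" "1 \<le> k" "k \<le> n"
          using that im by (auto simp: cells_susp)
        then obtain x where "y = E x" "(k, x) \<in> cells (susp X) n"
          by (auto simp: cells_susp)
        then show ?thesis
          by (force intro: image_eqI[where x = "(k, x)"])
      qed
      moreover have "(k, E x) \<in> cells (susp Y) n" if "(k, x) \<in> cells (susp X) n" for k x
        using that im[of "n - k"] by (auto simp: cells_susp)
      ultimately show ?thesis
        by auto
    qed
  qed
next
  fix m n and \<alpha> :: "nat \<Rightarrow> nat" and z
  assume a: "mono_on {..m} \<alpha>" "\<alpha> ` {..m} \<subseteq> {..n}" and "z \<in> cells (susp X) n"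
  then obtain k x where z: "z = (k, x)" "1 \<le> k" "k \<le> n" "x \<in> cells X (n - k)"
    by (cases z) (auto simp: cells_susp)
  define k' where "k' = card {l. l \<le> m \<and> \<alpha> l < k}"
  have k': "k' \<le> Suc m"
    using initial_segment_card(2)[OF a(1) k'_def] .
  have "act (susp X) m n \<alpha> z \<in> simplices (susp X) m \<and>
    map_option (\<lambda>(k, x). (k, E x)) (act (susp X) m n \<alpha> z) = act (susp Y) m n \<alpha> (k, E x)"
  proof (cases "k' = 0 \<or> k' = Suc m")
    case True
    then show ?thesis
      by (simp add: z act_susp k'_def[symmetric] Let_def)
  next
    case False
    then have "k' \<le> m"
      using k' by simp
    note shift = shifted_operator[OF a k'_def this]
    note D = psset_isoD[OF iso shift z(4)]
    show ?thesis
      using False D k'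
      by (cases "act X (m - k') (n - k) (\<lambda>l. \<alpha> (l + k') - k) x")
        (auto simp: z act_susp k'_def[symmetric] Let_def cells_susp)
  qed
  then show "act (susp X) m n \<alpha> z \<in> simplices (susp X) m"
    "map_option (\<lambda>(k, x). (k, E x)) (act (susp X) m n \<alpha> z) = act (susp Y) m n \<alpha> (case z of (k, x) \<Rightarrow> (k, E x))"
    by (auto simp: z)
qed

lemma psset_iso_comp:
  assumes "psset_iso X Y E" "psset_iso Y Z F"
  shows "psset_iso X Z (F \<circ> E)"
  unfolding psset_iso_def
proof (intro conjI allI impI)
  fix n
  have "bij_betw E (cells X n) (cells Y n)" "bij_betw F (cells Y n) (cells Z n)"
    using assms by (simp_all add: psset_iso_def)
  then show "bij_betw (F \<circ> E) (cells X n) (cells Z n)"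
    by (rule bij_betw_trans)
next
  fix m n and \<alpha> :: "nat \<Rightarrow> nat" and x
  assume a: "mono_on {..m} \<alpha>" "\<alpha> ` {..m} \<subseteq> {..n}" "x \<in> cells X n"
  have y: "E x \<in> cells Y n"
    using assms(1) a(3) by (auto simp: psset_iso_def bij_betw_def)
  show "act X m n \<alpha> x \<in> simplices X m" "map_option (F \<circ> E) (act X m n \<alpha> x) = act Z m n \<alpha> ((F \<circ> E) x)"
    using psset_isoD[OF assms(1) a] psset_isoD[OF assms(2) a(1,2) y] by (auto simp: option.map_comp)
qed

lemma sorted_chain_comparable:
  assumes "sorted_wrt (\<subseteq>) c" "X \<in> set c" "Y \<in> set c"
  shows "X \<subseteq> Y \<or> Y \<subseteq> X"
  using assms by (induction c) auto

text \<open>\<open>Q\<close> is downward closed, so once a member of the increasing chain fails it,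
  all later members fail too.\<close>

lemma sorted_dropWhile_downset:
  assumes "sorted_wrt (\<subseteq>) c" "X \<in> set (dropWhile Q c)" "\<And>X Y. Q Y \<Longrightarrow> X \<subseteq> Y \<Longrightarrow> Q X"
  shows "\<not> Q X"
  using assms by (induction c) (auto split: if_splits)

lemma replicate_append_in_cells:
  assumes z: "z \<in> P" "\<And>X. X \<in> P \<Longrightarrow> z \<subseteq> X"
    and c: "(k, c) \<in> cells (susp (chain_sset (P - {z}) R)) n"
  shows "replicate k z @ c \<in> cells (chain_sset P (insert z R)) n"
proof -
  have "1 \<le> k" "k \<le> n" "length c = Suc (n - k)" "set c \<subseteq> P - {z}" "sorted_wrt (\<subseteq>) c" "R \<subseteq> set c"
    using c by (auto simp: cells_susp cells_chain_sset)
  moreover have "sorted_wrt (\<subseteq>) (replicate k z)"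
    by (simp add: sorted_wrt_iff_nth_less)
  moreover have "z \<subseteq> X" if "X \<in> set c" for X
    using that z(2) \<open>set c \<subseteq> P - {z}\<close> by blast
  ultimately show ?thesis
    unfolding cells_chain_sset sorted_wrt_append using z(1) by auto
qed

text \<open>The cone vertex becomes the least element \<open>z\<close>, repeated \<open>k\<close>
  times. An operator that misses \<open>z\<close> collapses on both sides; one that keeps nothing
  but \<open>z\<close> does so as well because \<open>R\<close> contains a member different from
  \<open>z\<close>.\<close>

lemma psset_iso_susp_chain:
  assumes z: "z \<in> P" "\<And>X. X \<in> P \<Longrightarrow> z \<subseteq> X" and R: "R \<noteq> {}" "z \<notin> R"
  shows "psset_iso (susp (chain_sset (P - {z}) R)) (chain_sset P (insert z R)) (\<lambda>(k, c). replicate k z @ c)"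
  unfolding psset_iso_def
proof (intro conjI allI impI)
  let ?E = "\<lambda>(k, c). replicate k z @ c" and ?X = "chain_sset (P - {z}) R" and ?Y = "chain_sset P (insert z R)"
  fix n
  show "bij_betw ?E (cells (susp ?X) n) (cells ?Y n)"
  proof (rule bij_betwI[where g = "\<lambda>d. (length (takeWhile (\<lambda>W. W = z) d), dropWhile (\<lambda>W. W = z) d)"])
    show "?E \<in> cells (susp ?X) n \<rightarrow> cells ?Y n"
      using replicate_append_in_cells[OF z] by auto
  next
    show "(\<lambda>d. (length (takeWhile (\<lambda>W. W = z) d), dropWhile (\<lambda>W. W = z) d)) \<in> cells ?Y n \<rightarrow> cells (susp ?X) n"
    proof
      fix d assume d: "d \<in> cells ?Y n"
      define A where "A = takeWhile (\<lambda>W. W = z) d"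
      define B where "B = dropWhile (\<lambda>W. W = z) d"
      have AB: "d = A @ B"
        by (simp add: A_def B_def)
      have Az: "set A \<subseteq> {z}"
        using set_takeWhileD A_def by fastforce
      have sd: "sorted_wrt (\<subseteq>) d" "set d \<subseteq> P" "insert z R \<subseteq> set d" "length d = Suc n"
        using d by (auto simp: cells_chain_sset)
      have "\<not> W = z" if "W \<in> set B" for W
      proof -
        \<comment> \<open>For members of \<open>P\<close>, equality with \<open>z\<close> is the
          same as inclusion in \<open>z\<close>, and the latter is downward closed.\<close>
        have eq: "dropWhile (\<lambda>W. W = z) d = dropWhile (\<lambda>W. W \<subseteq> z) d"
          by (rule dropWhile_cong) (use sd(2) z(2) in blast)+
        show ?thesis
          using sorted_dropWhile_downset[OF sd(1), of W "\<lambda>W. W \<subseteq> z"] that by (auto simp: B_def eq)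
      qed
      then have zB: "z \<notin> set B"
        by blast
      then have "A \<noteq> []" "R \<subseteq> set B"
        using sd(3) Az R by (auto simp: AB)
      moreover have "B \<noteq> []"
        using \<open>R \<subseteq> set B\<close> R(1) by auto
      then have "length A \<le> n" "length B = Suc (n - length A)"
        using sd(4) unfolding AB by (cases B; simp)+
      ultimately have "(length A, B) \<in> cells (susp ?X) n"
        using sd(1,2) zB by (auto simp: cells_susp cells_chain_sset AB sorted_wrt_append Suc_le_eq)
      then show "(length (takeWhile (\<lambda>W. W = z) d), dropWhile (\<lambda>W. W = z) d) \<in> cells (susp ?X) n"
        by (simp add: A_def B_def)
    qed
  next
    fix x assume "x \<in> cells (susp ?X) n"
    then obtain k c where x: "x = (k, c)" "z \<notin> set c"
      by (cases x) (auto simp: cells_susp cells_chain_sset)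
    have *: "takeWhile (\<lambda>W. W = z) c = []" "dropWhile (\<lambda>W. W = z) c = c"
      using x(2) by (cases c; auto)+
    show "(length (takeWhile (\<lambda>W. W = z) (?E x)), dropWhile (\<lambda>W. W = z) (?E x)) = x"
      by (simp add: x takeWhile_append dropWhile_append * split: if_splits)
  next
    fix d
    have "takeWhile (\<lambda>W. W = z) d = replicate (length (takeWhile (\<lambda>W. W = z) d)) z"
      by (rule replicate_eqI) (auto dest: set_takeWhileD)
    then show "?E (length (takeWhile (\<lambda>W. W = z) d), dropWhile (\<lambda>W. W = z) d) = d"
      unfolding prod.case using takeWhile_dropWhile_id[of "\<lambda>W. W = z" d] by (rule subst)
  qed
next
  let ?E = "\<lambda>(k, c). replicate k z @ c" and ?X = "chain_sset (P - {z}) R" and ?Y = "chain_sset P (insert z R)"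
  fix m n and \<alpha> :: "nat \<Rightarrow> nat" and x
  assume a: "mono_on {..m} \<alpha>" "\<alpha> ` {..m} \<subseteq> {..n}" and x0: "x \<in> cells (susp ?X) n"
  then obtain k c where x: "x = (k, c)" "1 \<le> k" "k \<le> n" "c \<in> cells ?X (n - k)"
    by (cases x) (auto simp: cells_susp)
  have y: "?E x \<in> cells ?Y n"
    using replicate_append_in_cells[OF z] x0 x(1) by auto
  have zc: "z \<notin> set c" and len: "length (replicate k z @ c) = Suc n"
    using x y by (auto simp: cells_chain_sset)
  define k' where "k' = card {l. l \<le> m \<and> \<alpha> l < k}"
  have k': "k' \<le> Suc m"
    using initial_segment_card(2)[OF a(1) k'_def] .
  have "act (susp ?X) m n \<alpha> x \<in> simplices (susp ?X) m \<and> map_option ?E (act (susp ?X) m n \<alpha> x) = act ?Y m n \<alpha> (?E x)"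
  proof (cases "k' = 0 \<or> k' = Suc m")
    case True
    have "\<not> insert z R \<subseteq> set (reindex m \<alpha> (replicate k z @ c))"
    proof (cases "k' = 0")
      case True
      then show ?thesis
        using set_reindex_append_right[OF _ a(2) len] zc by (auto simp: k'_def)
    next
      case False
      then show ?thesis
      proof -
        have "set (reindex m \<alpha> (replicate k z @ c)) \<subseteq> {z}"
          using set_reindex_append_left[OF a(1), of "replicate k z" c] True False by (auto simp: k'_def)
        moreover obtain r where "r \<in> R" "r \<noteq> z"
          using R by blast
        ultimately show ?thesis
          by blast
      qed
    qed
    then show ?thesis
      using True act_chain_sset[OF a y] by (simp add: x act_susp k'_def[symmetric] Let_def)
  next
    case False
    then have k'm: "0 < k'" "k' \<le> m"
      using k' by auto
    note shift = shifted_operator[OF a k'_def k'm(2)]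
    have k'_eq: "k' = card {l. l \<le> m \<and> \<alpha> l < length (replicate k z)}"
      by (simp add: k'_def)
    let ?\<beta> = "\<lambda>l. \<alpha> (l + k') - k"
    have "set (reindex (k' - 1) \<alpha> (replicate k z)) \<subseteq> {z}"
    proof -
      have "\<alpha> ` {..k' - 1} \<subseteq> {..k - 1}"
        by (rule initial_operator(2)[OF a(1)]) (use k'_def k'm x in auto)
      then show ?thesis
        using set_reindex_subset[of \<alpha> "k' - 1" "k - 1" "replicate k z"] x by auto
    qed
    then have "reindex (k' - 1) \<alpha> (replicate k z) = replicate k' z"
      using k'm by (intro replicate_eqI) auto
    then have re: "reindex m \<alpha> (replicate k z @ c) = replicate k' z @ reindex (m - k') ?\<beta> c"
      using reindex_append[OF a(1) k'_eq k'm, of c] by simp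
    have "insert z R \<subseteq> set (reindex m \<alpha> (replicate k z @ c)) \<longleftrightarrow> R \<subseteq> set (reindex (m - k') ?\<beta> c)"
      unfolding re using R(2) k'm by auto
    then have actY: "act ?Y m n \<alpha> (?E x) =
        (if R \<subseteq> set (reindex (m - k') ?\<beta> c) then Some (replicate k' z @ reindex (m - k') ?\<beta> c) else None)"
      using act_chain_sset[OF a y] by (simp add: x re)
    have actX: "act (susp ?X) m n \<alpha> x =
        (if R \<subseteq> set (reindex (m - k') ?\<beta> c) then Some (k', reindex (m - k') ?\<beta> c) else None)"
      using k'm act_chain_sset[OF shift x(4)] by (simp add: x act_susp k'_def[symmetric] Let_def)
    show ?thesis
      unfolding actX actY using k'm reindex_in_cells[OF shift x(4)] by (auto simp: cells_susp)
  qed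
  then show "act (susp ?X) m n \<alpha> x \<in> simplices (susp ?X) m"
    "map_option ?E (act (susp ?X) m n \<alpha> x) = act ?Y m n \<alpha> (?E x)"
    by auto
qed


section \<open>Buildings as chain sets\<close>

lemma ST_sset_chain: "ST_sset V = chain_sset (subs V) {{0}, V}"
  by (simp add: ST_sset_def chain_sset_def insert_commute)

lemma RT_chain: "RT V = chain_sset (subs V - {{0}}) {V}"
proof -
  have "subs V - {{0}} - {V} = subs V - {{0}, V}"
    by blast
  then show ?thesis
    by (simp add: RT_def chain_sset_def)
qed

lemma act_RT:
  assumes "mono_on {..m} \<alpha>" "\<alpha> ` {..m} \<subseteq> {..n}" "c \<in> cells (RT V) n"
  shows "act (RT V) m n \<alpha> c = (if V \<in> set (reindex m \<alpha> c) then Some (reindex m \<alpha> c) else None)"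
    and "V \<in> set (reindex m \<alpha> c) \<Longrightarrow> reindex m \<alpha> c \<in> cells (RT V) m"
  using act_chain_sset[OF assms[unfolded RT_chain]] reindex_in_cells[OF assms[unfolded RT_chain]]
  by (auto simp: RT_chain)

section \<open>Subspaces above \<open>U\<close> and their orthogonal complements\<close>

lemma zero_subs: "subspace V \<Longrightarrow> {0} \<in> subs V"
  and subs_zero_least: "X \<in> subs V \<Longrightarrow> {0} \<subseteq> X"
  by (auto simp: subs_def subspace_0)

lemma subs_trans: "U \<in> subs V \<Longrightarrow> subs U \<subseteq> subs V"
  by (auto simp: subs_def)

definition subspace_sum :: "'a::euclidean_space set \<Rightarrow> 'a set \<Rightarrow> 'a set" where
  "subspace_sum U W = {u + w | u w. u \<in> U \<and> w \<in> W}"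

lemma ominus_subs: "X \<in> subs V \<Longrightarrow> X \<ominus>\<^sub>\<bottom> U \<in> subs (V \<ominus>\<^sub>\<bottom> U)"
  by (auto simp: subs_def ominus_def subspace_inter subspace_orthogonal_comp)

lemma subspace_ominus: "subspace V \<Longrightarrow> subspace (V \<ominus>\<^sub>\<bottom> U)"
  by (simp add: ominus_def subspace_inter subspace_orthogonal_comp)

lemma ominus_mono: "X \<subseteq> Y \<Longrightarrow> X \<ominus>\<^sub>\<bottom> U \<subseteq> Y \<ominus>\<^sub>\<bottom> U"
  by (auto simp: ominus_def)

lemma subspace_sum_mono: "X \<subseteq> Y \<Longrightarrow> subspace_sum U X \<subseteq> subspace_sum U Y"
  by (auto simp: subspace_sum_def)

text \<open>In the orthogonal decomposition of \<open>x\<close> along \<open>U\<close>, the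
  component in \<open>U\<close> lies in \<open>X\<close>, so the other component lies in
  \<open>X\<close> too.\<close>

lemma subspace_sum_ominus:
  assumes "subspace U" "subspace X" "U \<subseteq> X"
  shows "subspace_sum U (X \<ominus>\<^sub>\<bottom> U) = X"
proof
  show "subspace_sum U (X \<ominus>\<^sub>\<bottom> U) \<subseteq> X"
    using assms by (auto simp: subspace_sum_def ominus_def subspace_add)
  show "X \<subseteq> subspace_sum U (X \<ominus>\<^sub>\<bottom> U)"
  proof
    fix x assume x: "x \<in> X"
    obtain y z where yz: "y \<in> span U" "\<And>w. w \<in> span U \<Longrightarrow> orthogonal z w" "x = y + z"
      using orthogonal_subspace_decomp_exists[of U x] by blast
    have y: "y \<in> U"
      using yz(1) assms(1) by (simp add: span_eq_iff[THEN iffD2])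
    moreover have "z \<in> X"
      using subspace_diff[OF assms(2) x, of y] y assms(3) yz(3) by auto
    moreover have "z \<in> U\<^sup>\<bottom>"
      using yz(2) span_base by (auto simp: orthogonal_comp_def orthogonal_commute)
    ultimately show "x \<in> subspace_sum U (X \<ominus>\<^sub>\<bottom> U)"
      using yz(3) by (auto simp: subspace_sum_def ominus_def)
  qed
qed

text \<open>Together with \<open>subspace_sum_ominus\<close>, this gives mutually inverse bijections
  between the subspaces of \<open>V\<close> containing \<open>U\<close> and the subspaces of
  \<open>V \<ominus>\<^sub>\<bottom> U\<close>. In the last claim the summand in \<open>U\<close> is
  also orthogonal to \<open>U\<close>, hence 0.\<close>

lemma subspace_sum_subs:
  assumes U: "U \<in> subs V" and V: "subspace V" and W: "W \<in> subs (V \<ominus>\<^sub>\<bottom> U)"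
  shows "subspace_sum U W \<in> subs V" "U \<subseteq> subspace_sum U W" "subspace_sum U W \<ominus>\<^sub>\<bottom> U = W"
proof -
  have sub: "subspace U" "subspace W" "U \<subseteq> V" "W \<subseteq> V" "W \<subseteq> U\<^sup>\<bottom>"
    using U W by (auto simp: subs_def ominus_def)
  have "subspace (subspace_sum U W)"
    unfolding subspace_sum_def using subspace_sums[OF sub(1,2)] by simp
  then show "subspace_sum U W \<in> subs V"
    using sub(3,4) subspace_add[OF V] by (fastforce simp: subs_def subspace_sum_def)
  show "U \<subseteq> subspace_sum U W"
  proof
    fix u assume "u \<in> U"
    then have "u + 0 \<in> subspace_sum U W"
      unfolding subspace_sum_def using subspace_0[OF sub(2)] by blast
    then show "u \<in> subspace_sum U W"
      by simp
  qed
  show "subspace_sum U W \<ominus>\<^sub>\<bottom> U = W"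
  proof
    show "W \<subseteq> subspace_sum U W \<ominus>\<^sub>\<bottom> U"
    proof
      fix w assume w: "w \<in> W"
      then have "0 + w \<in> subspace_sum U W"
        unfolding subspace_sum_def using subspace_0[OF sub(1)] by blast
      then show "w \<in> subspace_sum U W \<ominus>\<^sub>\<bottom> U"
        using w sub(5) by (auto simp: ominus_def)
    qed
    show "subspace_sum U W \<ominus>\<^sub>\<bottom> U \<subseteq> W"
    proof
      fix x assume "x \<in> subspace_sum U W \<ominus>\<^sub>\<bottom> U"
      then obtain u w where x: "x = u + w" "u \<in> U" "w \<in> W" "u + w \<in> U\<^sup>\<bottom>"
        by (auto simp: ominus_def subspace_sum_def)
      have "w \<in> U\<^sup>\<bottom>"
        using x sub by auto
      then have "u \<in> U\<^sup>\<bottom>"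
        using subspace_diff[OF subspace_orthogonal_comp x(4), of w] by simp
      then have "u = 0"
        using x(2) orthogonal_self[of u] by (auto simp: orthogonal_comp_def)
      then show "x \<in> W"
        using x by simp
    qed
  qed
qed

lemma ominus_eq_zero:
  assumes "subspace U" "subspace X" "U \<subseteq> X" "X \<ominus>\<^sub>\<bottom> U = {0}"
  shows "X = U"
  using subspace_sum_ominus[OF assms(1-3)] assms(4) by (simp add: subspace_sum_def)

lemma ominus_self: "subspace U \<Longrightarrow> U \<ominus>\<^sub>\<bottom> U = {0}"
  by (auto simp: ominus_def orthogonal_comp_def subspace_0 orthogonal_self orthogonal_clauses)

section \<open>The reduced join as chains through \<open>U\<close>\<close>

definition join_chain :: "'a::euclidean_space set \<Rightarrow> nat \<times> 'a set list \<times> 'a set list \<Rightarrow> 'a set list" where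
  "join_chain U z = (case z of (j, A, B) \<Rightarrow> A @ map (subspace_sum U) B)"

lemma cells_RT_join:
  "(j, A, B) \<in> cells (RT_join V U) n \<longleftrightarrow> j < n \<and> A \<in> cells (RT U) j \<and> B \<in> cells (RT (V \<ominus>\<^sub>\<bottom> U)) (n - j - 1)"
  by (auto simp: RT_join_def reduced_join_def)

lemma act_RT_join:
  "act (RT_join V U) m n \<alpha> (j, A, B) =
     (let k = card {l. l \<le> m \<and> \<alpha> l < Suc j} in
        if k = 0 \<or> k = Suc m then None
        else (case (act (RT U) (k - 1) j \<alpha> A,
                    act (RT (V \<ominus>\<^sub>\<bottom> U)) (m - k) (n - j - 1) (\<lambda>l. \<alpha> (l + k) - (j + 1)) B) of
                (Some x', Some y') \<Rightarrow> Some (k - 1, x', y')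
              | _ \<Rightarrow> None))"
  by (simp add: RT_join_def reduced_join_def less_Suc_eq_le)

text \<open>A nonzero \<open>W\<close> orthogonal to \<open>U\<close> enlarges it. Hence the place
  where the two chains of a join meet can be recovered: it lies behind the last member inside
  \<open>U\<close>, however often \<open>U\<close> is repeated.\<close>

lemma join_chain_nonzero_summand:
  assumes "U \<in> subs V" "subspace V" "W \<in> subs (V \<ominus>\<^sub>\<bottom> U) - {{0}}"
  shows "\<not> subspace_sum U W \<subseteq> U"
proof
  assume "subspace_sum U W \<subseteq> U"
  then have "subspace_sum U W = U"
    using subspace_sum_subs(2)[OF assms(1,2)] assms(3) by blast
  then have "W = {0}"
    using subspace_sum_subs(3)[OF assms(1,2), of W] assms(1,3) ominus_self by (auto simp: subs_def)
  then show False
    using assms(3) by simp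
qed

lemma join_chain_in_cells:
  assumes U: "U \<in> subs V" and V: "subspace V" and z: "(j, A, B) \<in> cells (RT_join V U) n"
  shows "join_chain U (j, A, B) \<in> cells (chain_sset (subs V - {{0}}) {U, V}) n"
proof -
  have A: "length A = Suc j" "set A \<subseteq> subs U - {{0}}" "sorted_wrt (\<subseteq>) A" "U \<in> set A" and j: "j < n"
    and B: "length B = n - j" "set B \<subseteq> subs (V \<ominus>\<^sub>\<bottom> U) - {{0}}" "sorted_wrt (\<subseteq>) B" "V \<ominus>\<^sub>\<bottom> U \<in> set B"
    using z by (auto simp: cells_RT_join RT_chain cells_chain_sset)
  have sum: "subspace_sum U W \<in> subs V - {{0}}" "U \<subseteq> subspace_sum U W" if "W \<in> set B" for W
  proof -
    have "W \<in> subs (V \<ominus>\<^sub>\<bottom> U) - {{0}}"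
      using that B by blast
    then show "U \<subseteq> subspace_sum U W" "subspace_sum U W \<in> subs V - {{0}}"
      using subspace_sum_subs[OF U V, of W] join_chain_nonzero_summand[OF U V, of W] U
      by (auto simp: subs_def dest: subspace_0)
  qed
  have "V = subspace_sum U (V \<ominus>\<^sub>\<bottom> U)"
    using subspace_sum_ominus[of U V] U V by (auto simp: subs_def)
  then have "V \<in> subspace_sum U ` set B"
    using B(4) by (rule image_eqI)
  moreover have "sorted_wrt (\<subseteq>) (map (subspace_sum U) B)"
    unfolding sorted_wrt_map by (rule sorted_wrt_mono_rel[OF _ B(3)]) (rule subspace_sum_mono)
  moreover have "\<forall>X\<in>set A. \<forall>W\<in>set B. X \<subseteq> subspace_sum U W"
    using A(2) sum by (fastforce simp: subs_def)
  ultimately show ?thesis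
    using A B j sum subs_trans[OF U] by (auto simp: join_chain_def cells_chain_sset sorted_wrt_append)
qed

text \<open>All members are comparable with \<open>U\<close>, which is one of them, so those that do
  not lie in \<open>U\<close> contain it strictly. This makes their complements nonzero and lets the
  members be recovered from them.\<close>

lemma chain_split_at:
  fixes c :: "'a::euclidean_space set list"
  assumes U: "U \<in> subs V" "U \<noteq> V"
    and c: "sorted_wrt (\<subseteq>) c" "set c \<subseteq> subs V" "U \<in> set c" "V \<in> set c"
  defines "A \<equiv> takeWhile (\<lambda>X. X \<subseteq> U) c" and "B \<equiv> dropWhile (\<lambda>X. X \<subseteq> U) c"
  shows "c = A @ B" "\<And>X. X \<in> set A \<Longrightarrow> X \<subseteq> U" "\<And>X. X \<in> set B \<Longrightarrow> U \<subset> X" "U \<in> set A" "V \<in> set B"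
    "sorted_wrt (\<subseteq>) (map (\<lambda>W. W \<ominus>\<^sub>\<bottom> U) B)" "set (map (\<lambda>W. W \<ominus>\<^sub>\<bottom> U) B) \<subseteq> subs (V \<ominus>\<^sub>\<bottom> U) - {{0}}"
    "map (subspace_sum U) (map (\<lambda>W. W \<ominus>\<^sub>\<bottom> U) B) = B"
proof -
  show AB: "c = A @ B"
    by (simp add: A_def B_def)
  show Asub: "X \<subseteq> U" if "X \<in> set A" for X
    using set_takeWhileD[of X _ c] that A_def by fastforce
  have Bsub: "\<not> X \<subseteq> U" if "X \<in> set B" for X
    by (rule sorted_dropWhile_downset[OF c(1), of X "\<lambda>X. X \<subseteq> U"]) (use that B_def in auto)
  show BU: "U \<subset> X" if "X \<in> set B" for X
    using sorted_chain_comparable[OF c(1), of X U] c(3) Bsub[OF that] that by (auto simp: AB)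
  show "U \<in> set A" "V \<in> set B"
    using c(3,4) Bsub Asub U by (auto simp: AB subs_def)
  show "sorted_wrt (\<subseteq>) (map (\<lambda>W. W \<ominus>\<^sub>\<bottom> U) B)"
    unfolding sorted_wrt_map
    by (rule sorted_wrt_mono_rel[of _ "(\<subseteq>)"], erule ominus_mono)
      (use c(1) in \<open>simp add: AB sorted_wrt_append\<close>)
  have sub: "subspace U" "\<And>X. X \<in> set B \<Longrightarrow> subspace X"
    using U c(2) by (auto simp: AB subs_def)
  have "W \<ominus>\<^sub>\<bottom> U \<in> subs (V \<ominus>\<^sub>\<bottom> U) - {{0}}" if "W \<in> set B" for W
    using ominus_subs[of W V U] ominus_eq_zero[of U W] that sub BU[OF that] c(2) AB by auto
  then show "set (map (\<lambda>W. W \<ominus>\<^sub>\<bottom> U) B) \<subseteq> subs (V \<ominus>\<^sub>\<bottom> U) - {{0}}"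
    by auto
  show "map (subspace_sum U) (map (\<lambda>W. W \<ominus>\<^sub>\<bottom> U) B) = B"
    unfolding map_map by (rule map_idI) (use BU in \<open>simp add: subspace_sum_ominus sub psubset_imp_subset\<close>)
qed

lemma join_chain_split:
  assumes U: "U \<in> subs V" "U \<noteq> V" and d: "d \<in> cells (chain_sset (subs V - {{0}}) {U, V}) n"
  defines "A \<equiv> takeWhile (\<lambda>X. X \<subseteq> U) d" and "B \<equiv> dropWhile (\<lambda>X. X \<subseteq> U) d"
  shows "(length A - 1, A, map (\<lambda>W. W \<ominus>\<^sub>\<bottom> U) B) \<in> cells (RT_join V U) n"
    "join_chain U (length A - 1, A, map (\<lambda>W. W \<ominus>\<^sub>\<bottom> U) B) = d"
proof -
  have sd: "sorted_wrt (\<subseteq>) d" "set d \<subseteq> subs V" "{0} \<notin> set d" "U \<in> set d" "V \<in> set d" "length d = Suc n"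
    using d by (auto simp: cells_chain_sset)
  note S = chain_split_at[OF U sd(1,2,4,5), folded A_def B_def]
  have "length A + length B = Suc n" "A \<noteq> []" "B \<noteq> []"
    using S(1,4,5) sd(6) by auto
  then have len: "length A = Suc (length A - 1)" "length B = Suc (n - (length A - 1) - 1)" "length A - 1 < n"
    by (cases A; cases B; auto)+
  have "sorted_wrt (\<subseteq>) A" "set A \<subseteq> subs V" "{0} \<notin> set A"
    using sd(1-3) by (auto simp: S(1) sorted_wrt_append)
  then have "A \<in> cells (RT U) (length A - 1)"
    using len(1) S(2,4) by (auto simp: RT_chain cells_chain_sset subs_def)
  moreover have "map (\<lambda>W. W \<ominus>\<^sub>\<bottom> U) B \<in> cells (RT (V \<ominus>\<^sub>\<bottom> U)) (n - (length A - 1) - 1)"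
    using len(2) S(5-7) by (simp add: RT_chain cells_chain_sset)
  ultimately show "(length A - 1, A, map (\<lambda>W. W \<ominus>\<^sub>\<bottom> U) B) \<in> cells (RT_join V U) n"
    using len(3) by (simp add: cells_RT_join)
  show "join_chain U (length A - 1, A, map (\<lambda>W. W \<ominus>\<^sub>\<bottom> U) B) = d"
    unfolding join_chain_def prod.case S(8) using S(1) by (rule sym)
qed

text \<open>The inverse assigns all repetitions of \<open>U\<close> to the first chain; this is the
  convention of the maximal index in \<open>dehn_invariant\<close>.\<close>

lemma psset_iso_RT_join:
  assumes U: "U \<in> subs V" and V: "subspace V" and ne: "U \<noteq> V"
  shows "psset_iso (RT_join V U) (chain_sset (subs V - {{0}}) {U, V}) (join_chain U)"
  unfolding psset_iso_def
proof (intro conjI allI impI)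
  let ?X = "RT_join V U" and ?Y = "chain_sset (subs V - {{0}}) {U, V}"
  fix n
  define g where "g = (\<lambda>d. let A = takeWhile (\<lambda>X. X \<subseteq> U) d in
    (length A - 1, A, map (\<lambda>W. W \<ominus>\<^sub>\<bottom> U) (dropWhile (\<lambda>X. X \<subseteq> U) d)))"
  show "bij_betw (join_chain U) (cells ?X n) (cells ?Y n)"
  proof (rule bij_betwI[where g = g])
    show "join_chain U \<in> cells ?X n \<rightarrow> cells ?Y n"
      using join_chain_in_cells[OF U V] by auto
    have split: "g d \<in> cells ?X n \<and> join_chain U (g d) = d" if "d \<in> cells ?Y n" for d
      using join_chain_split[OF U ne that] by (simp add: g_def Let_def)
    show "g \<in> cells ?Y n \<rightarrow> cells ?X n"
      using split by blast
    show "join_chain U (g d) = d" if "d \<in> cells ?Y n" for d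
      using split[OF that] by blast
    show "g (join_chain U z) = z" if z: "z \<in> cells ?X n" for z
    proof -
      obtain j A B where z': "z = (j, A, B)"
        by (cases z)
      have A: "length A = Suc j" "set A \<subseteq> subs U"
        and B: "set B \<subseteq> subs (V \<ominus>\<^sub>\<bottom> U) - {{0}}"
        using z by (auto simp: z' cells_RT_join RT_chain cells_chain_sset)
      have Ain: "\<forall>X\<in>set A. X \<subseteq> U"
        using A by (auto simp: subs_def)
      have Bout: "\<forall>X\<in>set (map (subspace_sum U) B). \<not> X \<subseteq> U"
        using join_chain_nonzero_summand[OF U V] B by auto
      then have *: "takeWhile (\<lambda>X. X \<subseteq> U) (map (subspace_sum U) B) = []"
        "dropWhile (\<lambda>X. X \<subseteq> U) (map (subspace_sum U) B) = map (subspace_sum U) B"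
        by (cases "map (subspace_sum U) B"; auto)+
      have "map ((\<lambda>W. W \<ominus>\<^sub>\<bottom> U) \<circ> subspace_sum U) B = B"
        by (rule map_idI) (use subspace_sum_subs(3)[OF U V] B in auto)
      then show ?thesis
        using Ain A(1) * by (simp add: g_def z' join_chain_def Let_def)
    qed
  qed
next
  let ?X = "RT_join V U" and ?Y = "chain_sset (subs V - {{0}}) {U, V}"
  fix m n and \<alpha> :: "nat \<Rightarrow> nat" and z
  assume a: "mono_on {..m} \<alpha>" "\<alpha> ` {..m} \<subseteq> {..n}" and z0: "z \<in> cells ?X n"
  obtain j A B where z: "z = (j, A, B)"
    by (cases z)
  have A: "A \<in> cells (RT U) j" and B: "B \<in> cells (RT (V \<ominus>\<^sub>\<bottom> U)) (n - j - 1)" and j: "j < n"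
    using z0 by (auto simp: z cells_RT_join)
  have y: "join_chain U z \<in> cells ?Y n"
    using join_chain_in_cells[OF U V] z0 by (simp add: z)
  define C where "C = map (subspace_sum U) B"
  have jc: "join_chain U z = A @ C"
    by (simp add: join_chain_def z C_def)
  have lA: "length A = Suc j" and lAC: "length (A @ C) = Suc n"
    using A y by (auto simp: RT_chain cells_chain_sset jc)
  have UC: "U \<notin> set C"
    using B join_chain_nonzero_summand[OF U V] by (auto simp: C_def RT_chain cells_chain_sset)
  have VA: "V \<notin> set A"
    using A U ne by (auto simp: RT_chain cells_chain_sset subs_def)
  define k where "k = card {l. l \<le> m \<and> \<alpha> l < Suc j}"
  have k: "k \<le> Suc m"
    using initial_segment_card(2)[OF a(1) k_def] .
  have "act ?X m n \<alpha> z \<in> simplices ?X m \<and> map_option (join_chain U) (act ?X m n \<alpha> z) = act ?Y m n \<alpha> (join_chain U z)"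
  proof (cases "k = 0 \<or> k = Suc m")
    case True
    have "\<not> {U, V} \<subseteq> set (reindex m \<alpha> (A @ C))"
    proof (cases "k = 0")
      case True
      then show ?thesis
        using set_reindex_append_right[OF _ a(2) lAC] UC lA by (auto simp: k_def)
    next
      case False
      then show ?thesis
        using set_reindex_append_left[OF a(1), of A C] True VA lA by (auto simp: k_def)
    qed
    then show ?thesis
      using True act_chain_sset[OF a y] by (simp add: z act_RT_join k_def[symmetric] Let_def) (simp add: z[symmetric] jc)
  next
    case False
    then have km: "0 < k" "k \<le> m"
      using k by auto
    define \<beta> where "\<beta> = (\<lambda>l. \<alpha> (l + k) - Suc j)"
    have init: "mono_on {..k - 1} \<alpha>" "\<alpha> ` {..k - 1} \<subseteq> {..j}"
      using initial_operator[OF a(1) k_def km(1)] .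
    have shift: "mono_on {..m - k} \<beta>" "\<beta> ` {..m - k} \<subseteq> {..n - j - 1}"
      using shifted_operator[OF a k_def km(2)] by (simp_all add: \<beta>_def)
    have "reindex m \<alpha> (A @ C) = reindex (k - 1) \<alpha> A @ reindex (m - k) \<beta> C"
      using reindex_append[OF a(1), of k A C] km lA by (simp add: k_def \<beta>_def)
    moreover have lB: "length B = Suc (n - j - 1)"
      using B by (simp add: RT_chain cells_chain_sset)
    have mapre: "reindex (m - k) \<beta> C = map (subspace_sum U) (reindex (m - k) \<beta> B)"
    proof (rule nth_equalityI)
      fix l assume "l < length (reindex (m - k) \<beta> C)"
      then have "l \<le> m - k" "\<beta> l < length B"
        using shift(2) lB by (auto simp: image_subset_iff less_Suc_eq_le)
      then show "reindex (m - k) \<beta> C ! l = map (subspace_sum U) (reindex (m - k) \<beta> B) ! l"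
        by (simp add: C_def)
    qed simp
    ultimately have re: "reindex m \<alpha> (A @ C) = reindex (k - 1) \<alpha> A @ map (subspace_sum U) (reindex (m - k) \<beta> B)"
      by simp
    have setB: "set (reindex (m - k) \<beta> B) \<subseteq> set B"
      by (rule set_reindex_subset[OF shift(2) lB])
    have Vsum: "V = subspace_sum U (V \<ominus>\<^sub>\<bottom> U)"
      using subspace_sum_ominus[of U V] U V by (auto simp: subs_def)
    have 1: "V \<in> subspace_sum U ` set (reindex (m - k) \<beta> B) \<longleftrightarrow> V \<ominus>\<^sub>\<bottom> U \<in> set (reindex (m - k) \<beta> B)"
    proof
      assume "V \<in> subspace_sum U ` set (reindex (m - k) \<beta> B)"
      then obtain W where W: "W \<in> set (reindex (m - k) \<beta> B)" "V = subspace_sum U W"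
        by blast
      then have "W \<in> subs (V \<ominus>\<^sub>\<bottom> U)"
        using setB B by (auto simp: RT_chain cells_chain_sset)
      then show "V \<ominus>\<^sub>\<bottom> U \<in> set (reindex (m - k) \<beta> B)"
        using subspace_sum_subs(3)[OF U V] W by metis
    next
      assume "V \<ominus>\<^sub>\<bottom> U \<in> set (reindex (m - k) \<beta> B)"
      with Vsum show "V \<in> subspace_sum U ` set (reindex (m - k) \<beta> B)"
        by (rule image_eqI)
    qed
    have 2: "U \<notin> subspace_sum U ` set (reindex (m - k) \<beta> B)"
      using UC setB by (auto simp: C_def)
    have 3: "V \<notin> set (reindex (k - 1) \<alpha> A)"
      using VA set_reindex_subset[OF init(2), of A] lA by auto
    \<comment> \<open>\<open>U\<close> can survive only in the first block and \<open>V\<close> only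
      in the second, so the chain set collapses exactly when one of the two factors of the join
      does.\<close>
    have iff: "{U, V} \<subseteq> set (reindex m \<alpha> (A @ C)) \<longleftrightarrow>
        U \<in> set (reindex (k - 1) \<alpha> A) \<and> V \<ominus>\<^sub>\<bottom> U \<in> set (reindex (m - k) \<beta> B)"
      unfolding re using 1 2 3 by auto
    have actA: "act (RT U) (k - 1) j \<alpha> A =
        (if U \<in> set (reindex (k - 1) \<alpha> A) then Some (reindex (k - 1) \<alpha> A) else None)"
      and cellA: "U \<in> set (reindex (k - 1) \<alpha> A) \<Longrightarrow> reindex (k - 1) \<alpha> A \<in> cells (RT U) (k - 1)"
      by (rule act_RT[OF init A])+
    have actB: "act (RT (V \<ominus>\<^sub>\<bottom> U)) (m - k) (n - j - 1) \<beta> B =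
        (if V \<ominus>\<^sub>\<bottom> U \<in> set (reindex (m - k) \<beta> B) then Some (reindex (m - k) \<beta> B) else None)"
      and cellB: "V \<ominus>\<^sub>\<bottom> U \<in> set (reindex (m - k) \<beta> B) \<Longrightarrow> reindex (m - k) \<beta> B \<in> cells (RT (V \<ominus>\<^sub>\<bottom> U)) (m - k)"
      by (rule act_RT[OF shift B])+
    have actX: "act ?X m n \<alpha> z = (if {U, V} \<subseteq> set (reindex m \<alpha> (A @ C))
        then Some (k - 1, reindex (k - 1) \<alpha> A, reindex (m - k) \<beta> B) else None)"
      unfolding iff using km actA actB
      by (simp add: z act_RT_join k_def[symmetric] Let_def \<beta>_def)
    have actY: "act ?Y m n \<alpha> (join_chain U z) = (if {U, V} \<subseteq> set (reindex m \<alpha> (A @ C))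
        then Some (reindex m \<alpha> (A @ C)) else None)"
      using act_chain_sset[OF a y] by (simp add: jc)
    have "(k - 1, reindex (k - 1) \<alpha> A, reindex (m - k) \<beta> B) \<in> cells ?X m" if "{U, V} \<subseteq> set (reindex m \<alpha> (A @ C))"
      using that cellA cellB km unfolding iff by (simp add: cells_RT_join)
    then show ?thesis
      unfolding actX actY by (simp add: join_chain_def re)
  qed
  then show "act ?X m n \<alpha> z \<in> simplices ?X m"
    "map_option (join_chain U) (act ?X m n \<alpha> z) = act ?Y m n \<alpha> (join_chain U z)"
    by auto
qed

lemma psset_iso_susp_RT:
  assumes "subspace V" "V \<noteq> {0}"
  shows "psset_iso (susp (RT V)) (ST_sset V) (\<lambda>(k, c). replicate k {0} @ c)"
  unfolding RT_chain ST_sset_chain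
  by (rule psset_iso_susp_chain) (use assms zero_subs subs_zero_least in auto)

definition split_sset :: "'a::euclidean_space set \<Rightarrow> 'a set \<Rightarrow> 'a set list psset" where
  "split_sset V U = chain_sset (subs V) {{0}, U, V}"

definition susp_join_chain :: "'a::euclidean_space set \<Rightarrow> nat \<times> nat \<times> 'a set list \<times> 'a set list \<Rightarrow> 'a set list" where
  "susp_join_chain U z = (case z of (k, x) \<Rightarrow> replicate k {0} @ join_chain U x)"

text \<open>The vertex \<open>{0}\<close> absorbs the cone vertices; \<open>U \<noteq> {0}\<close>
  keeps it apart from the members already required.\<close>

lemma psset_iso_susp_join:
  assumes "U \<in> subs V" "subspace V" "U \<noteq> V" "U \<noteq> {0}"
  shows "psset_iso (susp (RT_join V U)) (split_sset V U) (susp_join_chain U)"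
proof -
  have V: "V \<noteq> {0}"
  proof
    assume "V = {0}"
    then have "U = {0}"
      using assms(1) subspace_0[of U] by (auto simp: subs_def)
    then show False
      using assms(4) by simp
  qed
  have "psset_iso (susp (RT_join V U)) (chain_sset (subs V) {{0}, U, V})
    ((\<lambda>(k, c). replicate k {0} @ c) \<circ> (\<lambda>(k, x). (k, join_chain U x)))"
    by (rule psset_iso_comp[OF psset_iso_susp[OF psset_iso_RT_join] psset_iso_susp_chain])
      (use assms V zero_subs subs_zero_least in auto)
  moreover have "(\<lambda>(k, c). replicate k {0} @ c) \<circ> (\<lambda>(k, x). (k, join_chain U x)) = susp_join_chain U"
    by (auto simp: susp_join_chain_def fun_eq_iff)
  ultimately show ?thesis
    by (simp add: split_sset_def)
qed

lemma subspace_eq_of_dim_eq: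
  fixes X Y :: "'a::euclidean_space set"
  assumes "X \<subseteq> Y" "subspace X" "subspace Y" "dim X = dim Y"
  shows "X = Y"
  using assms by (intro subspace_dim_equal) simp_all

text \<open>Members of a chain with the same dimension coincide, so the maximal index found by
  \<open>dehn_invariant\<close> is the last occurrence of \<open>U\<close>, and cutting there agrees
  with cutting behind the last member inside \<open>U\<close>.\<close>

lemma dehn_invariant_Some:
  assumes c: "c \<in> cells (RT V) n" and U: "U \<in> set c" "dim U = i" and i: "i < dim V"
  obtains z where "dehn_invariant i c = Some (U, z)" "z \<in> cells (RT_join V U) n" "join_chain U z = c"
proof -
  have sc: "length c = Suc n" "set c \<subseteq> subs V - {{0}}" "sorted_wrt (\<subseteq>) c" "V \<in> set c"
    using c by (auto simp: RT_chain cells_chain_sset)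
  define J where "J = {j. j < length c \<and> dim (c ! j) = i}"
  define j where "j = Max J"
  obtain j0 where "j0 < length c" "c ! j0 = U"
    using U(1) by (metis in_set_conv_nth)
  then have ex: "\<exists>j<length c. dim (c ! j) = i" and J: "finite J" "J \<noteq> {}"
    using U(2) by (auto simp: J_def)
  have j: "j < length c" "dim (c ! j) = i"
    using Max_in[OF J] by (auto simp: J_def j_def)
  have maxj: "dim (c ! l) \<noteq> i" if "j < l" "l < length c" for l
  proof
    assume "dim (c ! l) = i"
    then have "l \<in> J"
      using that by (simp add: J_def)
    then show False
      using Max_ge[OF J(1), of l] that(1) by (simp add: j_def)
  qed
  have sub: "subspace X" "X \<subseteq> V" if "X \<in> set c" for X
    using sc(2) that by (auto simp: subs_def)
  have "c ! j = U"
    using sorted_chain_comparable[OF sc(3), of "c ! j" U] subspace_eq_of_dim_eq[of "c ! j" U] subspace_eq_of_dim_eq[of U "c ! j"]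
      j U sub by auto
  have "U \<subseteq> V" "U \<noteq> V" "U \<in> subs V"
    using sub[OF U(1)] U(2) i by (auto simp: subs_def)
  have take: "takeWhile (\<lambda>X. X \<subseteq> U) c = take (Suc j) c"
  proof (rule takeWhile_eq_take_P_nth)
    fix l assume "l < Suc j" "l < length c"
    then show "c ! l \<subseteq> U"
      using sorted_wrt_nth_less[OF sc(3), of l j] \<open>c ! j = U\<close> j(1) by (cases "l = j") simp_all
  next
    assume l: "Suc j < length c"
    then have "U \<subseteq> c ! Suc j"
      using sorted_wrt_nth_less[OF sc(3), of j "Suc j"] \<open>c ! j = U\<close> by simp
    then show "\<not> c ! Suc j \<subseteq> U"
      using maxj[of "Suc j"] l U(2) by auto
  qed
  then have drop: "dropWhile (\<lambda>X. X \<subseteq> U) c = drop (Suc j) c" and len: "length (take (Suc j) c) - 1 = j"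
    using j(1) by (simp_all add: dropWhile_eq_drop)
  have "c \<in> cells (chain_sset (subs V - {{0}}) {U, V}) n"
    using c U(1) by (auto simp: RT_chain cells_chain_sset)
  note S = join_chain_split[OF \<open>U \<in> subs V\<close> \<open>U \<noteq> V\<close> this, unfolded take drop len]
  have "dehn_invariant i c = Some (U, (j, take (Suc j) c, map (\<lambda>W. W \<ominus>\<^sub>\<bottom> U) (drop (Suc j) c)))"
    using ex \<open>c ! j = U\<close> by (simp add: dehn_invariant_def Let_def J_def[symmetric] j_def[symmetric])
  then show thesis
    using S by (rule that)
qed

lemma dehn_invariant_None:
  assumes "\<And>X. X \<in> set c \<Longrightarrow> dim X \<noteq> i"
  shows "dehn_invariant i c = None"
proof -
  have "\<not> (\<exists>j<length c. dim (c ! j) = i)"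
    using assms nth_mem by blast
  then show ?thesis
    unfolding dehn_invariant_def by (rule if_not_P)
qed

section \<open>The left and bottom maps\<close>

lemma subs_dimD:
  fixes V :: "'a::euclidean_space set"
  assumes "U \<in> subs_dim V i" "0 < i" "i < dim V"
  shows "U \<in> subs V" "U \<noteq> V" "U \<noteq> {0}" "dim U = i"
  using assms by (auto simp: subs_dim_def)

lemma dim_pos_nonzero:
  fixes V :: "'a::euclidean_space set"
  shows "i < dim V \<Longrightarrow> V \<noteq> {0}"
  by auto

lemma psset_iso_ST_RT:
  assumes "subspace V" "V \<noteq> {0}"
  shows "psset_iso (ST_sset V) (susp (RT V))
    (\<lambda>c. (length (takeWhile (\<lambda>W. W = {0}) c), dropWhile (\<lambda>W. W = {0}) c))"
proof (rule psset_iso_inverse[OF psset_iso_susp_RT[OF assms]])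
  fix n x assume "x \<in> cells (susp (RT V)) n"
  then obtain k c where x: "x = (k, c)" "{0} \<notin> set c"
    by (cases x) (auto simp: cells_susp RT_chain cells_chain_sset)
  have *: "takeWhile (\<lambda>W. W = {0}) c = []" "dropWhile (\<lambda>W. W = {0}) c = c"
    using x(2) by (cases c; auto)+
  show "(length (takeWhile (\<lambda>W. W = {0}) (case x of (k, c) \<Rightarrow> replicate k {0} @ c)),
      dropWhile (\<lambda>W. W = {0}) (case x of (k, c) \<Rightarrow> replicate k {0} @ c)) = x"
    by (simp add: x(1) takeWhile_append dropWhile_append *)
qed

lemma homeomorphic_map_ST_to_RT:
  assumes "subspace V" "V \<noteq> {0}"
  shows "homeomorphic_map (space_of (SigmaST V)) (space_of (realization (susp (RT V)))) (ST_to_RT V)"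
  unfolding SigmaST_def ST_to_RT_def by (rule homeomorphic_map_psset_iso[OF psset_iso_ST_RT[OF assms]])

lemma ST_to_RT_geo_pt:
  assumes "subspace V" "V \<noteq> {0}" "x \<in> simplices (ST_sset V) n" "t \<in> standard_simplex n"
  shows "ST_to_RT V (geo_pt (ST_sset V) n x t) = geo_pt (susp (RT V)) n
    (map_option (\<lambda>c. (length (takeWhile (\<lambda>W. W = {0}) c), dropWhile (\<lambda>W. W = {0}) c)) x) t"
  unfolding ST_to_RT_def
  by (rule descend_geo_pt[OF glue_invariant_iso[OF psset_iso_ST_RT[OF assms(1,2)] glue_invariant_geo_pt] assms(3,4)])

lemma ST_to_RT_base:
  assumes "subspace V" "V \<noteq> {0}"
  shows "ST_to_RT V (base_of (SigmaST V)) = base_of (realization (susp (RT V)))"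
  unfolding SigmaST_def base_of_realization by (subst ST_to_RT_geo_pt[OF assms]) auto

section \<open>The forgetful map\<close>

lemma base_of_smash: "base_of (smash X Y) = None"
  by (simp add: smash_def)

lemma smash_in_base [simp]: "smash_in X Y (base_of X) y = None" "smash_in X Y x (base_of Y) = None"
  by (auto simp: smash_in_def)

text \<open>The disjoint basepoint \<open>None\<close> is open and so is its complement, so the
  constant branch and the projection can be treated on separate open pieces.\<close>

lemma continuous_map_fst_plus_space:
  assumes b: "b \<in> topspace X"
  shows "continuous_map (prod_topology X (space_of (plus_space Y))) X
    (\<lambda>(x, e). case e of None \<Rightarrow> b | Some _ \<Rightarrow> x)"
  unfolding continuous_map_def
proof (intro conjI allI impI)
  show "(\<lambda>(x, e). case e of None \<Rightarrow> b | Some _ \<Rightarrow> x) \<in> topspace (prod_topology X (space_of (plus_space Y))) \<rightarrow> topspace X"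
    using b by (auto split: option.splits)
next
  fix O' assume O: "openin X O'"
  let ?Y = "space_of (plus_space Y)"
  have some: "openin ?Y (Some ` topspace Y)" and none: "openin ?Y {None}"
  proof -
    have "{x \<in> topspace Y. Some x \<in> Some ` topspace Y} = topspace Y"
      by auto
    then show "openin ?Y (Some ` topspace Y)" "openin ?Y {None}"
      by (auto simp: plus_space_def openin_coinduced_topology)
  qed
  have "{z \<in> topspace (prod_topology X ?Y). (case z of (x, e) \<Rightarrow> case e of None \<Rightarrow> b | Some _ \<Rightarrow> x) \<in> O'} =
      O' \<times> Some ` topspace Y \<union> (if b \<in> O' then topspace X \<times> {None} else {})"
    using openin_subset[OF O] by (auto simp: topspace_plus_space split: option.splits if_splits)
  moreover have "openin (prod_topology X ?Y) (O' \<times> Some ` topspace Y)"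
    using O some by (simp add: openin_prod_Times_iff)
  moreover have "openin (prod_topology X ?Y) (topspace X \<times> {None})"
    using none by (simp add: openin_prod_Times_iff)
  ultimately show "openin (prod_topology X ?Y)
      {z \<in> topspace (prod_topology X ?Y). (case z of (x, e) \<Rightarrow> case e of None \<Rightarrow> b | Some _ \<Rightarrow> x) \<in> O'}"
    by auto
qed

lemma base_in_SigmaST: "base_of (SigmaST V) \<in> topspace (space_of (SigmaST V))"
  unfolding SigmaST_def by (rule base_in_realization)

lemma topspace_D12_plus: "topspace (space_of D12_plus) = insert None (Some ` little_intervals)"
  by (simp add: D12_plus_def topspace_plus_space)

lemma base_of_D12_plus: "base_of D12_plus = None"
  by (simp add: D12_plus_def plus_space_def)

lemma continuous_map_forget_smash:
  "continuous_map (space_of (smash (SigmaST V) D12_plus)) (space_of (SigmaST V)) (forget V)"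
  unfolding smash_def pspace.simps
proof (rule continuous_map_from_coinduced)
  let ?P = "prod_topology (space_of (SigmaST V)) (space_of D12_plus)"
  have eq: "forget V (case z of (x, y) \<Rightarrow> smash_in (SigmaST V) D12_plus x y) =
      (case z of (x, e) \<Rightarrow> case e of None \<Rightarrow> base_of (SigmaST V) | Some _ \<Rightarrow> x)" for z
    by (cases z) (auto simp: forget_def smash_in_def base_of_D12_plus split: option.splits)
  have "continuous_map ?P (space_of (SigmaST V))
      (\<lambda>(x, e). case e of None \<Rightarrow> base_of (SigmaST V) | Some _ \<Rightarrow> x)"
    unfolding D12_plus_def by (rule continuous_map_fst_plus_space[OF base_in_SigmaST])
  then show cont: "continuous_map ?P (space_of (SigmaST V))
      (\<lambda>z. forget V (case z of (x, y) \<Rightarrow> smash_in (SigmaST V) D12_plus x y))" for k :: unit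
    by (simp add: eq)
  show "forget V ` insert None ((\<lambda>(x, y). smash_in (SigmaST V) D12_plus x y) `
      (topspace (space_of (SigmaST V)) \<times> topspace (space_of D12_plus))) \<subseteq> topspace (space_of (SigmaST V))"
  proof
    fix y assume "y \<in> forget V ` insert None ((\<lambda>(x, y). smash_in (SigmaST V) D12_plus x y) `
      (topspace (space_of (SigmaST V)) \<times> topspace (space_of D12_plus)))"
    then consider "y = base_of (SigmaST V)"
      | z where "z \<in> topspace ?P" "y = forget V (case z of (x, y) \<Rightarrow> smash_in (SigmaST V) D12_plus x y)"
      by (auto simp: forget_def)
    then show "y \<in> topspace (space_of (SigmaST V))"
    proof cases
      case 1
      then show ?thesis
        using base_in_SigmaST by simp
    next
      case 2
      show ?thesis
        unfolding 2(2) using cont[unfolded continuous_map_def, THEN conjunct1] 2(1) by (rule funcset_mem)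
    qed
  qed
qed auto

lemma continuous_map_forget:
  "continuous_map (space_of (SigmaST_i V i)) (space_of (SigmaST V)) (forget V)"
  unfolding SigmaST_i_def pspace.simps
  by (rule continuous_map_from_subtopology[OF continuous_map_forget_smash])

lemma pointed_map_left_map:
  assumes "subspace V" "V \<noteq> {0}"
  shows "pointed_map (SigmaST_i V i) (realization (susp (RT V))) (left_map V)"
  unfolding pointed_map_def left_map_def
proof
  show "continuous_map (space_of (SigmaST_i V i)) (space_of (realization (susp (RT V)))) (ST_to_RT V \<circ> forget V)"
    by (rule continuous_map_compose[OF continuous_map_forget homeomorphic_imp_continuous_map[OF homeomorphic_map_ST_to_RT[OF assms]]])
  show "(ST_to_RT V \<circ> forget V) (base_of (SigmaST_i V i)) = base_of (realization (susp (RT V)))"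
    using ST_to_RT_base[OF assms] by (simp add: SigmaST_i_def forget_def)
qed

section \<open>The suspended Dehn invariant\<close>

definition dehn_simplex ::
    "'a::euclidean_space set \<Rightarrow> nat \<Rightarrow> nat \<Rightarrow> (nat \<times> 'a set list) option \<Rightarrow> (nat \<Rightarrow> real)
       \<Rightarrow> ('a set \<times> (nat \<times> nat \<times> 'a set list \<times> 'a set list) gpoint) option" where
  "dehn_simplex V i n x t = (case x of
            None \<Rightarrow> None
          | Some (k, c) \<Rightarrow>
              (case dehn_invariant i c of
                 None \<Rightarrow> None
               | Some (U, z) \<Rightarrow>
                   wedge_in (Sigma_join V) U (geo_pt (susp (RT_join V U)) n (Some (k, z)) t)))"

lemma Sigma_dehn_descend: "Sigma_dehn V i = descend (susp (RT V)) (dehn_simplex V i)"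
  by (simp add: Sigma_dehn_def dehn_simplex_def[abs_def])

lemma dehn_simplex_None [simp]: "dehn_simplex V i n None t = None"
  by (simp add: dehn_simplex_def)

lemma dehn_simplex_no_dim:
  assumes "\<And>X. X \<in> set c \<Longrightarrow> dim X \<noteq> i"
  shows "dehn_simplex V i n (Some (k, c)) t = None"
  using dehn_invariant_None[OF assms] by (simp add: dehn_simplex_def)

lemma dehn_simplex_dim:
  assumes c: "(k, c) \<in> cells (susp (RT V)) n" and U: "U \<in> set c" "dim U = i" "i < dim V"
  obtains z where "(k, z) \<in> cells (susp (RT_join V U)) n" "susp_join_chain U (k, z) = replicate k {0} @ c"
    "\<And>t. dehn_simplex V i n (Some (k, c)) t =
      wedge_in (Sigma_join V) U (geo_pt (susp (RT_join V U)) n (Some (k, z)) t)"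
proof -
  have k: "1 \<le> k" "k \<le> n" "c \<in> cells (RT V) (n - k)"
    using c by (auto simp: cells_susp)
  obtain z where z: "dehn_invariant i c = Some (U, z)" "z \<in> cells (RT_join V U) (n - k)" "join_chain U z = c"
    using dehn_invariant_Some[OF k(3) U] .
  show thesis
    by (rule that[of z]) (use z k in \<open>auto simp: cells_susp susp_join_chain_def dehn_simplex_def\<close>)
qed

lemma RT_dim_unique:
  assumes "c \<in> cells (RT V) n" "X \<in> set c" "Y \<in> set c" "dim X = dim Y"
  shows "X = Y"
proof -
  have "sorted_wrt (\<subseteq>) c" "subspace X" "subspace Y"
    using assms by (auto simp: RT_chain cells_chain_sset subs_def)
  then show ?thesis
    using sorted_chain_comparable[of c X Y] subspace_eq_of_dim_eq[of X Y] subspace_eq_of_dim_eq[of Y X] assms by auto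
qed

text \<open>Both operators are compared on the single chain \<open>d\<close>, which an operator
  merely reindexes. If \<open>{0}\<close> or \<open>V\<close> is lost, both sides are the basepoint;
  if these and \<open>U\<close> survive, both give the same simplex of the join. If all copies of
  \<open>U\<close> are dropped, one side has no member of dimension \<open>i\<close> left, and on
  the other the join operator gives the basepoint.\<close>

lemma glue_invariant_dehn:
  fixes V :: "'a::euclidean_space set"
  assumes V: "subspace V" and i: "0 < i" "i < dim V"
  shows "glue_invariant (susp (RT V)) (dehn_simplex V i)"
  unfolding glue_invariant_def
proof (intro allI impI)
  fix m n and \<alpha> :: "nat \<Rightarrow> nat" and x s
  let ?t = "push_coords m \<alpha> s"
  assume a: "mono_on {..m} \<alpha>" "\<alpha> ` {..m} \<subseteq> {..n}" and x: "x \<in> simplices (susp (RT V)) n"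
    and s: "s \<in> standard_simplex m"
  have V0: "V \<noteq> {0}"
    by (rule dim_pos_nonzero[OF i(2)])
  note isoR = psset_iso_susp_RT[OF V V0]
  show "dehn_simplex V i m (op_simplex (susp (RT V)) m n \<alpha> x) s = dehn_simplex V i n x ?t"
  proof (cases x)
    case (Some y)
    then obtain k c where y: "x = Some (k, c)" "(k, c) \<in> cells (susp (RT V)) n"
      using x by (cases y) auto
    define d where "d = replicate k {0} @ c"
    have ck: "c \<in> cells (RT V) (n - k)"
      using y by (simp add: cells_susp)
    have d: "d \<in> cells (ST_sset V) n"
      using psset_iso_in[OF isoR x] by (simp add: y d_def)
    then have ld: "length d = Suc n"
      by (simp add: ST_sset_chain cells_chain_sset)
    note DR = psset_isoD[OF isoR a y(2), unfolded prod.case, folded d_def]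
    have actR: "map_option (\<lambda>(k, c). replicate k {0} @ c) (act (susp (RT V)) m n \<alpha> (k, c)) =
        (if {{0}, V} \<subseteq> set (reindex m \<alpha> d) then Some (reindex m \<alpha> d) else None)"
      unfolding DR(2)[symmetric] unfolding ST_sset_chain
      by (rule act_chain_sset[OF a d[unfolded ST_sset_chain]])
    \<comment> \<open>Operators create no new members, so no further subspace of dimension
      \<open>i\<close> can appear.\<close>
    have sub: "X \<in> set c" if "X \<in> set c'" "act (susp (RT V)) m n \<alpha> (k, c) = Some (k', c')" for X k' c'
    proof -
      have "(k', c') \<in> cells (susp (RT V)) m"
        using DR(1) that by simp
      then have "X \<noteq> {0}"
        using that by (auto simp: cells_susp RT_chain cells_chain_sset)
      moreover have "replicate k' {0} @ c' = reindex m \<alpha> d"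
        using actR that(2) by (auto split: if_splits)
      then have "X \<in> set d"
        using set_reindex_subset[OF a(2) ld] that(1) by (metis Un_iff set_append subsetD)
      ultimately show ?thesis
        by (auto simp: d_def)
    qed
    show ?thesis
    proof (cases "\<exists>U\<in>set c. dim U = i")
      case False
      then have "dehn_simplex V i m (act (susp (RT V)) m n \<alpha> (k, c)) s = None"
        using sub by (cases "act (susp (RT V)) m n \<alpha> (k, c)") (auto intro!: dehn_simplex_no_dim)
      moreover have "dehn_simplex V i n (Some (k, c)) ?t = None"
        using False by (intro dehn_simplex_no_dim) auto
      ultimately show ?thesis
        by (simp add: y)
    next
      case True
      then obtain U where U: "U \<in> set c" "dim U = i"
        by blast
      let ?J = "susp (RT_join V U)"
      obtain z where z: "(k, z) \<in> cells ?J n" "susp_join_chain U (k, z) = d"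
        "\<And>t. dehn_simplex V i n (Some (k, c)) t = wedge_in (Sigma_join V) U (geo_pt ?J n (Some (k, z)) t)"
        using dehn_simplex_dim[OF y(2) U i(2)] unfolding d_def by metis
      have Us: "U \<in> subs V" "U \<noteq> {0}" "U \<noteq> V"
        using ck U i by (auto simp: RT_chain cells_chain_sset)
      note psset_iso_join = psset_iso_susp_join[OF Us(1) V Us(3,2)]
      have dS: "d \<in> cells (split_sset V U) n"
        using psset_iso_in[OF psset_iso_join, of "Some (k, z)" n] z by simp
      note DJ = psset_isoD[OF psset_iso_join a z(1), unfolded z(2)]
      have actJ: "map_option (susp_join_chain U) (act ?J m n \<alpha> (k, z)) =
          (if {{0}, U, V} \<subseteq> set (reindex m \<alpha> d) then Some (reindex m \<alpha> d) else None)"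
        unfolding DJ(2)[symmetric] unfolding split_sset_def
        by (rule act_chain_sset[OF a dS[unfolded split_sset_def]])
      have rhs: "dehn_simplex V i n x ?t = wedge_in (Sigma_join V) U (geo_pt ?J m (act ?J m n \<alpha> (k, z)) s)"
        using geo_pt_glue[OF a, of "Some (k, z)" ?J s] z s by (simp add: y)
      have None_rhs: "dehn_simplex V i n x ?t = None" if "act ?J m n \<alpha> (k, z) = None"
        unfolding rhs that using geo_pt_None[OF s] wedge_in_base[of "Sigma_join V"] by metis
      show ?thesis
      proof (cases "act (susp (RT V)) m n \<alpha> (k, c)")
        case None
        then have "\<not> {{0}, U, V} \<subseteq> set (reindex m \<alpha> d)"
          using actR by (auto split: if_splits)
        then have "act ?J m n \<alpha> (k, z) = None"
          using actJ by (auto split: if_splits)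
        then show ?thesis
          using None None_rhs by (simp add: y)
      next
        case (Some y')
        then obtain k' c' where y': "act (susp (RT V)) m n \<alpha> (k, c) = Some (k', c')"
          by (cases y') auto
        have kc': "(k', c') \<in> cells (susp (RT V)) m"
          using DR(1) y' by simp
        have re: "reindex m \<alpha> d = replicate k' {0} @ c'" and V': "{{0}, V} \<subseteq> set (reindex m \<alpha> d)"
          using actR y' by (auto split: if_splits)
        show ?thesis
        proof (cases "U \<in> set c'")
          case True
          obtain z1 where z1: "(k', z1) \<in> cells ?J m" "susp_join_chain U (k', z1) = reindex m \<alpha> d"
            "\<And>t. dehn_simplex V i m (Some (k', c')) t = wedge_in (Sigma_join V) U (geo_pt ?J m (Some (k', z1)) t)"
            using dehn_simplex_dim[OF kc' True U(2) i(2)] unfolding re by metis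
          \<comment> \<open>The two simplices of the join have the same underlying chain, and the
            chain determines the simplex.\<close>
          have "map_option (susp_join_chain U) (act ?J m n \<alpha> (k, z)) = map_option (susp_join_chain U) (Some (k', z1))"
            unfolding actJ using True V' z1(2) by (simp add: re)
          then have "act ?J m n \<alpha> (k, z) = Some (k', z1)"
            using psset_iso_inj[OF psset_iso_join DJ(1)] z1(1) by simp
          then show ?thesis
            using rhs z1(3) y y' by simp
        next
          case False
          have "dim X \<noteq> i" if "X \<in> set c'" for X
            using RT_dim_unique[OF ck sub[OF that y'] U(1)] U(2) that False by auto
          then have "dehn_simplex V i m (Some (k', c')) s = None"
            by (rule dehn_simplex_no_dim)
          moreover have "U \<notin> set (reindex m \<alpha> d)"
            using False Us(2) by (auto simp: re)
          then have "act ?J m n \<alpha> (k, z) = None"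
            using actJ by (auto split: if_splits)
          ultimately show ?thesis
            using None_rhs y y' by simp
        qed
      qed
    qed
  qed simp
qed

text \<open>A chain has at most one subspace of dimension \<open>i\<close> among its members, so on
  each simplex the map is either constant or a characteristic map followed by the inclusion of one
  wedge summand.\<close>

lemma pointed_map_Sigma_dehn:
  fixes V :: "'a::euclidean_space set"
  assumes V: "subspace V" and i: "0 < i" "i < dim V"
  shows "pointed_map (realization (susp (RT V))) (wedge (subs_dim V i) (Sigma_join V)) (Sigma_dehn V i)"
  unfolding pointed_map_def Sigma_dehn_descend
proof
  note g = glue_invariant_dehn[OF assms]
  show "descend (susp (RT V)) (dehn_simplex V i) (base_of (realization (susp (RT V)))) =
      base_of (wedge (subs_dim V i) (Sigma_join V))"
    unfolding base_of_realization by (subst descend_geo_pt[OF g]) (auto simp: wedge_def)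
  show "continuous_map (space_of (realization (susp (RT V)))) (space_of (wedge (subs_dim V i) (Sigma_join V)))
      (descend (susp (RT V)) (dehn_simplex V i))"
  proof (rule continuous_map_descend[OF g])
    fix n x assume x: "x \<in> simplices (susp (RT V)) n"
    let ?D = "subtopology (powertop_real UNIV) (standard_simplex n)"
    let ?W = "wedge (subs_dim V i) (Sigma_join V)"
    have const: "continuous_map ?D (space_of ?W) (dehn_simplex V i n x)" if "\<And>t. dehn_simplex V i n x t = None"
    proof -
      have "dehn_simplex V i n x = (\<lambda>t. None)"
        using that by auto
      then show ?thesis
        by (simp add: topspace_wedge)
    qed
    show "continuous_map ?D (space_of ?W) (dehn_simplex V i n x)"
    proof (cases x)
      case None
      then show ?thesis
        using const by simp
    next
      case (Some y)
      then obtain k c where y: "x = Some (k, c)" "(k, c) \<in> cells (susp (RT V)) n"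
        using x by (cases y) auto
      show ?thesis
      proof (cases "\<exists>U\<in>set c. dim U = i")
        case False
        then show ?thesis
          by (intro const, unfold y(1)) (rule dehn_simplex_no_dim, blast)
      next
        case True
        then obtain U where U: "U \<in> set c" "dim U = i"
          by blast
        let ?J = "susp (RT_join V U)"
        obtain z where z: "(k, z) \<in> cells ?J n"
          "\<And>t. dehn_simplex V i n (Some (k, c)) t = wedge_in (Sigma_join V) U (geo_pt ?J n (Some (k, z)) t)"
          using dehn_simplex_dim[OF y(2) U i(2)] by metis
        have "U \<in> subs_dim V i"
          using y U by (auto simp: cells_susp RT_chain cells_chain_sset subs_dim_def)
        then have "continuous_map ?D (space_of ?W) (wedge_in (Sigma_join V) U \<circ> geo_pt ?J n (Some (k, z)))"
          using continuous_map_compose[OF continuous_map_geo_pt continuous_map_wedge_in[where X = "Sigma_join V"]] z(1) by auto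
        moreover have "dehn_simplex V i n x = wedge_in (Sigma_join V) U \<circ> geo_pt ?J n (Some (k, z))"
          using z(2) y by auto
        ultimately show ?thesis
          by simp
      qed
    qed
  qed
qed

section \<open>The right map\<close>

definition low_part :: "'a set \<Rightarrow> 'a set list \<Rightarrow> 'a set list" where
  "low_part U c = takeWhile (\<lambda>X. X \<subseteq> U) c"

text \<open>The leading \<open>{0}\<close> is \<open>U \<ominus>\<^sub>\<bottom> U\<close>, a single
  vertex in place of all copies of \<open>U\<close>; it receives the half of their weight that is
  passed to the upper factor.\<close>

definition high_part :: "'a::euclidean_space set \<Rightarrow> 'a set list \<Rightarrow> 'a set list" where
  "high_part U c = {0} # map (\<lambda>W. W \<ominus>\<^sub>\<bottom> U) (dropWhile (\<lambda>X. X \<subseteq> U) c)"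

text \<open>A map out of the realization is given on all simplices, so \<open>h\<close> is extended to degenerate ones.
  A vertex \<open>U\<close>, however often it is repeated, gives half of its weight to either factor. The two
  masses add up to 1; where one of them vanishes, the point is the basepoint.\<close>

definition low_share :: "'a set \<Rightarrow> 'a set \<Rightarrow> real" where
  "low_share U X = (if X = U then 1 / 2 else if X \<subseteq> U then 1 else 0)"

text \<open>For a strict chain this is the denominator \<open>sa\<close> in the formula for
  \<open>h\<close> and also the time at which the step function is cut; \<open>high_mass\<close> is
  \<open>sb\<close>.\<close>

definition low_mass :: "'a set \<Rightarrow> 'a set list \<Rightarrow> (nat \<Rightarrow> real) \<Rightarrow> real" where
  "low_mass U c t = weighted_sum c t (low_share U)"

definition high_mass :: "'a set \<Rightarrow> 'a set list \<Rightarrow> (nat \<Rightarrow> real) \<Rightarrow> real" where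
  "high_mass U c t = weighted_sum c t (\<lambda>X. 1 - low_share U X)"

definition low_coords :: "'a set \<Rightarrow> 'a set list \<Rightarrow> (nat \<Rightarrow> real) \<Rightarrow> nat \<Rightarrow> real" where
  "low_coords U c t l = (if l < length (low_part U c) then t l * low_share U (c ! l) else 0)"

text \<open>Vertex 0 is the new \<open>{0}\<close>. Vertex \<open>l > 0\<close> is the member at
  position \<open>length (low_part U c) + l - 1\<close> of \<open>c\<close>, as the old copies of
  \<open>U\<close> belong to the lower part.\<close>

definition high_coords :: "'a set \<Rightarrow> 'a set list \<Rightarrow> (nat \<Rightarrow> real) \<Rightarrow> nat \<Rightarrow> real" where
  "high_coords U c t l = (if l = 0 then weight c t U / 2 else t (length (low_part U c) + l - 1))"

text \<open>The upper chain has the extra vertex \<open>{0}\<close>, so its degree is the number of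
  members outside \<open>low_part\<close>.\<close>

definition h_simplex ::
    "'a::euclidean_space set \<Rightarrow> 'a set \<Rightarrow> nat \<Rightarrow> 'a set list option \<Rightarrow> (nat \<Rightarrow> real)
       \<Rightarrow> ('a set list gpoint \<times> 'a set list gpoint) option" where
  "h_simplex V U n x t = (case x of None \<Rightarrow> None | Some c \<Rightarrow>
     if low_mass U c t = 0 \<or> high_mass U c t = 0 then None
     else smash_in (SigmaST U) (SigmaST (V \<ominus>\<^sub>\<bottom> U))
       (geo_pt (ST_sset U) (length (low_part U c) - 1) (Some (low_part U c)) (\<lambda>l. low_coords U c t l / low_mass U c t))
       (geo_pt (ST_sset (V \<ominus>\<^sub>\<bottom> U)) (Suc n - length (low_part U c)) (Some (high_part U c))
         (\<lambda>l. high_coords U c t l / high_mass U c t)))"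

section \<open>Weighted sums and the two masses\<close>

lemma weighted_sum_add:
  "weighted_sum c t f + weighted_sum c t g = weighted_sum c t (\<lambda>X. f X + g X)"
  by (simp add: weighted_sum_def sum.distrib ring_distribs)

lemma weighted_sum_divide: "weighted_sum c t f / r = weighted_sum c (\<lambda>l. t l / r) f"
  by (simp add: weighted_sum_def sum_divide_distrib)

lemma weighted_sum_append:
  "weighted_sum (A @ B) t f = weighted_sum A t f + weighted_sum B (\<lambda>l. t (length A + l)) f"
proof -
  have "(\<Sum>l<a + b. g l) = (\<Sum>l<a. g l) + (\<Sum>l<b. g (a + l))" for a b and g :: "nat \<Rightarrow> real"
    by (induction b) (simp_all add: add.assoc)
  from this[of _ "length A" "length B"] show ?thesis
    by (simp add: weighted_sum_def nth_append)
qed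

lemma weighted_sum_Cons:
  "weighted_sum (X # B) t f = t 0 * f X + weighted_sum B (\<lambda>l. t (Suc l)) f"
  unfolding weighted_sum_def by (simp add: sum.lessThan_Suc_shift del: sum.lessThan_Suc)

lemma weighted_sum_cong_on:
  assumes "\<And>l. l < length c \<Longrightarrow> t l * f (c ! l) = s l * g (c ! l)"
  shows "weighted_sum c t f = weighted_sum c s g"
  unfolding weighted_sum_def using assms by (intro sum.cong) auto

lemma weighted_sum_map: "weighted_sum (map h c) t f = weighted_sum c t (\<lambda>X. f (h X))"
  unfolding weighted_sum_def by (intro sum.cong) auto

lemma weighted_sum_nonneg:
  assumes "\<And>l. 0 \<le> t l" "\<And>X. X \<in> set c \<Longrightarrow> 0 \<le> f X"
  shows "0 \<le> weighted_sum c t f"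
  unfolding weighted_sum_def using assms by (intro sum_nonneg) auto

lemma weighted_sum_ge_weight:
  assumes "\<And>l. 0 \<le> t l" "\<And>X. X \<in> set c \<Longrightarrow> 0 \<le> f X" "0 \<le> f W"
  shows "weight c t W * f W \<le> weighted_sum c t f"
  unfolding weight_def weighted_sum_def sum_distrib_right
  by (rule sum_mono) (use assms in auto)

lemma weighted_sum_one:
  assumes "t \<in> standard_simplex n" "length c = Suc n"
  shows "weighted_sum c t (\<lambda>X. 1) = 1"
  using simplex_sum[OF assms(1)] assms(2) by (simp add: weighted_sum_def lessThan_Suc_atMost)

lemma low_share_bounds: "0 \<le> low_share U X" "low_share U X \<le> 1"
  by (auto simp: low_share_def)

lemma low_high_mass:
  assumes "t \<in> standard_simplex n" "length c = Suc n"
  shows "low_mass U c t + high_mass U c t = 1"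
  using weighted_sum_one[OF assms] by (simp add: low_mass_def high_mass_def weighted_sum_add)

lemma low_mass_nonneg: "(\<And>l. 0 \<le> t l) \<Longrightarrow> 0 \<le> low_mass U c t"
  unfolding low_mass_def by (rule weighted_sum_nonneg) (auto simp: low_share_bounds)

lemma high_mass_nonneg: "(\<And>l. 0 \<le> t l) \<Longrightarrow> 0 \<le> high_mass U c t"
  unfolding high_mass_def by (rule weighted_sum_nonneg) (auto simp: low_share_bounds)

text \<open>One member already bounds the mass. Applied to \<open>U\<close>, to \<open>{0}\<close>
  and, for the upper mass, to \<open>V\<close>, such bounds relate the vanishing of a mass to the
  basepoint.\<close>

lemma low_mass_ge:
  assumes "\<And>l. 0 \<le> t l"
  shows "weight c t W * low_share U W \<le> low_mass U c t"
  unfolding low_mass_def by (rule weighted_sum_ge_weight) (use assms in \<open>auto simp: low_share_bounds\<close>)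

lemma high_mass_ge:
  assumes "\<And>l. 0 \<le> t l"
  shows "weight c t W * (1 - low_share U W) \<le> high_mass U c t"
  unfolding high_mass_def by (rule weighted_sum_ge_weight) (use assms in \<open>auto simp: low_share_bounds\<close>)

lemma split_chain:
  assumes U: "U \<in> subs V" "U \<noteq> V" and c: "c \<in> cells (split_sset V U) n"
  obtains B where "c = low_part U c @ B" "high_part U c = {0} # map (\<lambda>W. W \<ominus>\<^sub>\<bottom> U) B"
    "\<And>X. X \<in> set (low_part U c) \<Longrightarrow> X \<subseteq> U" "\<And>X. X \<in> set B \<Longrightarrow> U \<subset> X"
    "U \<in> set (low_part U c)" "V \<in> set B" "length (low_part U c) + length B = Suc n"
    "low_part U c \<in> cells (ST_sset U) (length (low_part U c) - 1)"
    "high_part U c \<in> cells (ST_sset (V \<ominus>\<^sub>\<bottom> U)) (Suc n - length (low_part U c))"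
proof -
  define B where "B = dropWhile (\<lambda>X. X \<subseteq> U) c"
  have sc: "sorted_wrt (\<subseteq>) c" "set c \<subseteq> subs V" "{0} \<in> set c" "U \<in> set c" "V \<in> set c" "length c = Suc n"
    using c by (auto simp: split_sset_def cells_chain_sset)
  note S = chain_split_at[OF U sc(1,2,4,5), folded B_def low_part_def]
  let ?A = "low_part U c"
  have high: "high_part U c = {0} # map (\<lambda>W. W \<ominus>\<^sub>\<bottom> U) B"
    by (simp add: high_part_def B_def)
  have len: "length ?A + length B = Suc n"
    using sc(6) by (metis S(1) length_append)
  have "set c = set ?A \<union> set B"
    by (metis S(1) set_append)
  moreover have "{0} \<notin> set B"
    using S(3)[of "{0}"] subs_zero_least[OF U(1)] by blast
  moreover have "sorted_wrt (\<subseteq>) ?A"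
    using sc(1) S(1) by (metis sorted_wrt_append)
  moreover have "length ?A = Suc (length ?A - 1)"
    using S(4) by (cases ?A) auto
  ultimately have "?A \<in> cells (ST_sset U) (length ?A - 1)"
    using sc(2,3) S(2,4) by (auto simp: ST_sset_chain cells_chain_sset subs_def)
  moreover have "subspace (V \<ominus>\<^sub>\<bottom> U)"
    using sc(2,5) by (auto simp: subs_def intro!: subspace_ominus)
  then have "{0} # map (\<lambda>W. W \<ominus>\<^sub>\<bottom> U) B \<in> cells (ST_sset (V \<ominus>\<^sub>\<bottom> U)) (length B)"
  proof -
    assume "subspace (V \<ominus>\<^sub>\<bottom> U)"
    then have "{0} \<in> subs (V \<ominus>\<^sub>\<bottom> U)"
      by (rule zero_subs)
    moreover have "\<forall>W\<in>set (map (\<lambda>W. W \<ominus>\<^sub>\<bottom> U) B). {0} \<subseteq> W"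
      using S(7) subs_zero_least by blast
    moreover have "V \<ominus>\<^sub>\<bottom> U \<in> set (map (\<lambda>W. W \<ominus>\<^sub>\<bottom> U) B)"
      using S(5) by simp
    ultimately show ?thesis
      using S(6,7) unfolding ST_sset_chain cells_chain_sset by auto
  qed
  then have "high_part U c \<in> cells (ST_sset (V \<ominus>\<^sub>\<bottom> U)) (Suc n - length ?A)"
  proof -
    have "Suc n - length ?A = length B"
      using len by simp
    then show ?thesis
      using \<open>{0} # _ \<in> _\<close> by (simp only: high)
  qed
  ultimately show thesis
    using that[OF S(1) high S(2-5) len] by blast
qed

lemma split_chain_cells:
  assumes U: "U \<in> subs V" "U \<noteq> V" and c: "c \<in> cells (split_sset V U) n"
  shows "low_part U c \<in> cells (ST_sset U) (length (low_part U c) - 1)"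
    "high_part U c \<in> cells (ST_sset (V \<ominus>\<^sub>\<bottom> U)) (Suc n - length (low_part U c))"
  using split_chain[OF assms] by metis+

section \<open>Pairs of intervals that meet at a time s\<close>

text \<open>An increasing affine map is determined by the endpoints of the image of the unit
  interval, so off the basepoint an element of \<open>SigmaST_i\<close> is determined by its point
  of \<open>SigmaST\<close> and the time s.\<close>

lemma affine_emb_image:
  assumes "e \<in> affine_emb" "e ` {0..1} = {x..y}"
  shows "e = (\<lambda>u. (y - x) * u + x)"
proof -
  obtain a b where e: "0 < a" "e = (\<lambda>t. a * t + b)"
    using assms(1) by (auto simp: affine_emb_def)
  have "e ` {0..1} = {b..a + b}"
    unfolding e(2) using e(1) by (subst image_affinity_atLeastAtMost) simp
  then have "b = x" "a + b = y"
    using assms(2) e(1) by (auto simp: Icc_eq_Icc)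
  then show ?thesis
    using e(2) by auto
qed

lemma split_pair_little_intervals:
  assumes "0 < s" "s < 1"
  shows "(\<lambda>y. s * y, \<lambda>y. (1 - s) * y + s) \<in> little_intervals"
    and "(\<lambda>y. s * y) ` {0..1} = {0..s}" "(\<lambda>y. (1 - s) * y + s) ` {0..1} = {s..1}"
proof -
  show 1: "(\<lambda>y. s * y) ` {0..1} = {0..s}"
    using assms image_affinity_atLeastAtMost[of s 0 0 1] by simp
  show 2: "(\<lambda>y. (1 - s) * y + s) ` {0..1} = {s..1}"
    using assms by (subst image_affinity_atLeastAtMost) simp
  have "\<exists>a b. 0 < a \<and> (\<lambda>y. s * y) = (\<lambda>t. a * t + b)"
    by (rule exI[of _ s], rule exI[of _ 0]) (simp add: assms)
  then have "(\<lambda>y. s * y) \<in> affine_emb"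
    using assms 1 unfolding affine_emb_def by simp
  moreover have "\<exists>a b. 0 < a \<and> (\<lambda>y. (1 - s) * y + s) = (\<lambda>t. a * t + b)"
    by (rule exI[of _ "1 - s"], rule exI[of _ s]) (simp add: assms)
  then have "(\<lambda>y. (1 - s) * y + s) \<in> affine_emb"
    using assms 2 unfolding affine_emb_def by simp
  moreover have "{0<..<s} \<inter> {s<..<1} = {}"
    by auto
  ultimately show "(\<lambda>y. s * y, \<lambda>y. (1 - s) * y + s) \<in> little_intervals"
    by (simp add: little_intervals_def 1 2)
qed

lemma SigmaST_i_cases:
  assumes "z \<in> topspace (space_of (SigmaST_i V i))"
  obtains "z = None"
  | p s where "z = Some (p, Some (\<lambda>y. s * y, \<lambda>y. (1 - s) * y + s))" "split_time V i p s"
proof -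
  consider "z = None" | p e1 e2 s where "z = Some (p, Some (e1, e2))" "(e1, e2) \<in> little_intervals"
    "split_time V i p s" "e1 ` {0..1} = {0..s}" "e2 ` {0..1} = {s..1}"
    using assms unfolding SigmaST_i_def by auto
  then show thesis
  proof cases
    case 2
    then have "e1 \<in> affine_emb" "e2 \<in> affine_emb"
      by (auto simp: little_intervals_def)
    then have "e1 = (\<lambda>y. s * y)" "e2 = (\<lambda>y. (1 - s) * y + s)"
      using affine_emb_image[of e1 0 s] affine_emb_image[of e2 s 1] 2 by simp_all
    then show ?thesis
      using that(2) 2 by blast
  qed (use that in blast)
qed

lemma None_SigmaST_i: "None \<in> topspace (space_of (SigmaST_i V i))"
  by (simp add: SigmaST_i_def topspace_smash)

lemma right_map_wedge_in: "right_map V (wedge_in (Sigma_join V) U x) = wedge_in (ST_smash V) U (h_map V U x)"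
  by (auto simp: right_map_def wedge_map_def wedge_in_def h_map_def ST_smash_def base_of_smash)

section \<open>The two halves of a split chain\<close>

text \<open>The weights of the lower half are expressed through those of \<open>c\<close>, as gluing
  invariance requires. The parameter \<open>r\<close> will be the mass, or 1 on the faces where the
  other mass vanishes.\<close>

lemma weight_low_part:
  assumes U: "U \<in> subs V" "U \<noteq> V" and c: "c \<in> cells (split_sset V U) n"
  shows "weight (low_part U c) (\<lambda>l. low_coords U c t l / r) W = weight c t W * low_share U W / r"
proof -
  obtain B where B: "c = low_part U c @ B" "\<And>X. X \<in> set (low_part U c) \<Longrightarrow> X \<subseteq> U" "\<And>X. X \<in> set B \<Longrightarrow> U \<subset> X"
    using split_chain[OF assms] by metis
  let ?A = "low_part U c"
  have nth: "c ! l = ?A ! l" if "l < length ?A" for l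
    using B(1) that by (metis nth_append)
  have "weight ?A (\<lambda>l. low_coords U c t l / r) W = weighted_sum ?A t (\<lambda>X. of_bool (X = W) * low_share U W / r)"
    unfolding weight_def by (rule weighted_sum_cong_on) (auto simp: low_coords_def nth)
  moreover have "weighted_sum B s (\<lambda>X. of_bool (X = W) * low_share U W / r) = 0" for s
    unfolding weighted_sum_def
  proof (rule sum.neutral, safe)
    fix l assume "l < length B"
    then have "U \<subset> B ! l"
      using B(3) by simp
    then have "low_share U (B ! l) = 0"
      by (auto simp: low_share_def)
    then show "s l * (of_bool (B ! l = W) * low_share U W / r) = 0"
      by auto
  qed
  ultimately have "weight ?A (\<lambda>l. low_coords U c t l / r) W = weighted_sum (?A @ B) t (\<lambda>X. of_bool (X = W) * low_share U W / r)"
    by (simp add: weighted_sum_append)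
  also have "\<dots> = weight c t W * low_share U W / r"
    unfolding B(1)[symmetric] weight_def weighted_sum_def sum_distrib_right sum_divide_distrib
    by (simp add: mult.assoc)
  finally show ?thesis .
qed

text \<open>Members inside \<open>U\<close> have to be excluded from the weighted sum: their
  complement is \<open>{0}\<close> too, but apart from half of the weight of \<open>U\<close> they
  give nothing to the upper half.\<close>

lemma weight_high_part:
  assumes U: "U \<in> subs V" "U \<noteq> V" and c: "c \<in> cells (split_sset V U) n"
  shows "weight (high_part U c) (\<lambda>l. high_coords U c t l / r) W =
    (of_bool (W = {0}) * (weight c t U / 2) + weighted_sum c t (\<lambda>X. if X \<subseteq> U then 0 else of_bool (X \<ominus>\<^sub>\<bottom> U = W))) / r"
proof -
  obtain B where B: "c = low_part U c @ B" "high_part U c = {0} # map (\<lambda>W. W \<ominus>\<^sub>\<bottom> U) B"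
    "\<And>X. X \<in> set (low_part U c) \<Longrightarrow> X \<subseteq> U" "\<And>X. X \<in> set B \<Longrightarrow> U \<subset> X"
    using split_chain[OF assms] by metis
  let ?A = "low_part U c" and ?f = "\<lambda>X. if X \<subseteq> U then 0 else of_bool (X \<ominus>\<^sub>\<bottom> U = W) :: real"
  have "weighted_sum ?A t ?f = 0"
    unfolding weighted_sum_def using B(3) by (intro sum.neutral) auto
  then have "weighted_sum c t ?f = weighted_sum B (\<lambda>l. t (length ?A + l)) ?f"
    by (subst B(1)) (simp add: weighted_sum_append)
  also have "\<dots> = weighted_sum B (\<lambda>l. high_coords U c t (Suc l)) (\<lambda>X. of_bool (X \<ominus>\<^sub>\<bottom> U = W))"
  proof (rule weighted_sum_cong_on)
    fix l assume "l < length B"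
    then have "U \<subset> B ! l"
      using B(4) by simp
    then show "t (length ?A + l) * ?f (B ! l) = high_coords U c t (Suc l) * of_bool (B ! l \<ominus>\<^sub>\<bottom> U = W)"
      by (auto simp: high_coords_def)
  qed
  finally have 1: "weighted_sum c t ?f = weighted_sum B (\<lambda>l. high_coords U c t (Suc l)) (\<lambda>X. of_bool (X \<ominus>\<^sub>\<bottom> U = W))" .
  have "weight (high_part U c) (\<lambda>l. high_coords U c t l / r) W = weight (high_part U c) (high_coords U c t) W / r"
    by (simp add: weight_def weighted_sum_divide)
  also have "weight (high_part U c) (high_coords U c t) W =
      of_bool (W = {0}) * (weight c t U / 2) + weighted_sum c t ?f"
    unfolding 1 unfolding weight_def B(2) weighted_sum_Cons weighted_sum_map
    by (auto simp: high_coords_def weight_def)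
  finally show ?thesis .
qed

lemma low_coords_simplex:
  assumes U: "U \<in> subs V" "U \<noteq> V" and c: "c \<in> cells (split_sset V U) n"
    and t: "t \<in> standard_simplex n" and nz: "low_mass U c t \<noteq> 0"
  shows "(\<lambda>l. low_coords U c t l / low_mass U c t) \<in> standard_simplex (length (low_part U c) - 1)"
proof (rule in_standard_simplexI)
  obtain B where B: "c = low_part U c @ B" "\<And>X. X \<in> set (low_part U c) \<Longrightarrow> X \<subseteq> U" "\<And>X. X \<in> set B \<Longrightarrow> U \<subset> X"
    "U \<in> set (low_part U c)"
    using split_chain[OF U c] by metis
  let ?A = "low_part U c"
  have A: "{..length ?A - 1} = {..<length ?A}"
    using B(4) by (cases ?A) auto
  have nn: "\<And>l. 0 \<le> t l"
    using simplex_nonneg[OF t] .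
  show "0 \<le> low_coords U c t l / low_mass U c t" for l
    using nn low_share_bounds(1) low_mass_nonneg[of t, OF nn] by (auto simp: low_coords_def intro!: divide_nonneg_nonneg mult_nonneg_nonneg)
  show "low_coords U c t l / low_mass U c t = 0" if "length ?A - 1 < l" for l
    using that by (simp add: low_coords_def)
  have "weighted_sum B s (low_share U) = 0" for s
    unfolding weighted_sum_def
  proof (rule sum.neutral, safe)
    fix l assume "l < length B"
    then have "U \<subset> B ! l"
      using B(3) by simp
    then show "s l * low_share U (B ! l) = 0"
      by (auto simp: low_share_def)
  qed
  then have "low_mass U c t = weighted_sum ?A t (low_share U)"
    unfolding low_mass_def by (subst B(1)) (simp add: weighted_sum_append)
  also have "\<dots> = (\<Sum>l<length ?A. low_coords U c t l)"
    unfolding weighted_sum_def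
  proof (rule sum.cong)
    fix l assume "l \<in> {..<length ?A}"
    then show "t l * low_share U (?A ! l) = low_coords U c t l"
      using B(1) nth_append[of ?A B l] by (simp add: low_coords_def)
  qed simp
  finally show "(\<Sum>l\<le>length ?A - 1. low_coords U c t l / low_mass U c t) = 1"
    unfolding A sum_divide_distrib[symmetric] using nz by simp
qed

lemma high_coords_simplex:
  assumes U: "U \<in> subs V" "U \<noteq> V" and c: "c \<in> cells (split_sset V U) n"
    and t: "t \<in> standard_simplex n" and nz: "high_mass U c t \<noteq> 0"
  shows "(\<lambda>l. high_coords U c t l / high_mass U c t) \<in> standard_simplex (Suc n - length (low_part U c))"
proof (rule in_standard_simplexI)
  obtain B where B: "c = low_part U c @ B" "\<And>X. X \<in> set (low_part U c) \<Longrightarrow> X \<subseteq> U" "\<And>X. X \<in> set B \<Longrightarrow> U \<subset> X"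
    "length (low_part U c) + length B = Suc n"
    using split_chain[OF U c] by metis
  let ?A = "low_part U c"
  have nn: "\<And>l. 0 \<le> t l"
    using simplex_nonneg[OF t] .
  show "0 \<le> high_coords U c t l / high_mass U c t" for l
    using nn weight_nonneg[of t, OF nn] high_mass_nonneg[of t, OF nn] by (auto simp: high_coords_def intro!: divide_nonneg_nonneg)
  show "high_coords U c t l / high_mass U c t = 0" if "Suc n - length ?A < l" for l
    using that simplex_zero[OF t] by (simp add: high_coords_def)
  have len: "Suc n - length ?A = length B"
    using B(4) by simp
  have B1: "weighted_sum B s (\<lambda>X. 1 - low_share U X) = (\<Sum>l<length B. s l)" for s
    unfolding weighted_sum_def
  proof (rule sum.cong)
    fix l assume "l \<in> {..<length B}"
    then have "U \<subset> B ! l"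
      using B(3) by simp
    then show "s l * (1 - low_share U (B ! l)) = s l"
      by (auto simp: low_share_def)
  qed simp
  have A1: "weighted_sum ?A t (\<lambda>X. 1 - low_share U X) = weighted_sum ?A t (\<lambda>X. of_bool (X = U) / 2)"
  proof (rule weighted_sum_cong_on)
    fix l assume "l < length ?A"
    then have "?A ! l \<subseteq> U"
      using B(2) by simp
    then show "t l * (1 - low_share U (?A ! l)) = t l * (of_bool (?A ! l = U) / 2)"
      by (auto simp: low_share_def)
  qed
  have "weighted_sum B s (\<lambda>X. of_bool (X = U) / 2) = 0" for s
    unfolding weighted_sum_def using B(3) by (intro sum.neutral) (auto dest: nth_mem)
  then have A2: "weighted_sum ?A t (\<lambda>X. of_bool (X = U) / 2) = weighted_sum (?A @ B) t (\<lambda>X. of_bool (X = U) / 2)"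
    by (simp add: weighted_sum_append)
  have A3: "weighted_sum (?A @ B) t (\<lambda>X. of_bool (X = U) / 2) = weight c t U / 2"
    unfolding B(1)[symmetric] weight_def weighted_sum_def sum_divide_distrib by (intro sum.cong) auto
  have "high_mass U c t = weighted_sum (?A @ B) t (\<lambda>X. 1 - low_share U X)"
    unfolding high_mass_def B(1)[symmetric] ..
  also have "\<dots> = weight c t U / 2 + (\<Sum>l<length B. t (length ?A + l))"
    by (simp only: weighted_sum_append B1 A1 trans[OF A2 A3])
  also have "\<dots> = (\<Sum>l\<le>length B. high_coords U c t l)"
    unfolding lessThan_Suc_atMost[symmetric] sum.lessThan_Suc_shift by (simp add: high_coords_def)
  finally show "(\<Sum>l\<le>Suc n - length ?A. high_coords U c t l / high_mass U c t) = 1"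
    unfolding len sum_divide_distrib[symmetric] using nz by simp
qed

lemma smash_in_ST_base:
  "x = base_of (realization (ST_sset U)) \<or> y = base_of (realization (ST_sset W)) \<Longrightarrow>
    smash_in (SigmaST U) (SigmaST W) x y = None"
  by (auto simp: SigmaST_def smash_in_def)

lemma ST_geo_pt_base:
  assumes "c \<in> cells (ST_sset V) n" "t \<in> standard_simplex n" "weight c t {0} = 0 \<or> weight c t V = 0"
  shows "geo_pt (ST_sset V) n (Some c) t = base_of (realization (ST_sset V))"
proof -
  obtain r where "r \<in> {{0}, V}" "weight c t r = 0"
    using assms(3) by blast
  then show ?thesis
    using assms(1,2) unfolding ST_sset_chain by (intro chain_geo_pt_base)
qed

text \<open>Losing \<open>V\<close> leaves the upper chain without its top, and losing
  \<open>{0}\<close> or \<open>U\<close> leaves the lower chain without one of its ends.\<close>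

lemma h_simplex_zero:
  assumes U: "U \<in> subs V" "U \<noteq> V" "U \<noteq> {0}" and c: "c \<in> cells (split_sset V U) n"
    and t: "t \<in> standard_simplex n" and w: "weight c t {0} = 0 \<or> weight c t U = 0 \<or> weight c t V = 0"
  shows "h_simplex V U n (Some c) t = None"
proof (cases "low_mass U c t = 0 \<or> high_mass U c t = 0")
  case False
  obtain B where B: "low_part U c \<in> cells (ST_sset U) (length (low_part U c) - 1)"
    "high_part U c \<in> cells (ST_sset (V \<ominus>\<^sub>\<bottom> U)) (Suc n - length (low_part U c))"
    using split_chain[OF U(1,2) c] by metis
  note l = low_coords_simplex[OF U(1,2) c t] and h = high_coords_simplex[OF U(1,2) c t]
  have sc: "set c \<subseteq> subs V" "sorted_wrt (\<subseteq>) c" "U \<in> set c"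
    using c by (auto simp: split_sset_def cells_chain_sset)
  show ?thesis
  proof (cases "weight c t V = 0")
    case True
    have sub: "subspace U" "subspace V" "U \<subseteq> V"
      using U c by (auto simp: subs_def split_sset_def cells_chain_sset)
    then have ne: "V \<ominus>\<^sub>\<bottom> U \<noteq> {0}"
      using ominus_eq_zero[of U V] U(2) by auto
    \<comment> \<open>Taking complements is injective on the members above \<open>U\<close>, so only
      \<open>V\<close> contributes. Since \<open>V \<ominus>\<^sub>\<bottom> U\<close> is not
      \<open>{0}\<close>, the half weight of \<open>U\<close> does not enter either.\<close>
    have "weighted_sum c t (\<lambda>X. if X \<subseteq> U then 0 else of_bool (X \<ominus>\<^sub>\<bottom> U = V \<ominus>\<^sub>\<bottom> U)) = weight c t V"
      unfolding weight_def
    proof (rule weighted_sum_cong_on)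
      fix l assume "l < length c"
      then have X: "c ! l \<in> set c"
        by simp
      have "c ! l = V" if "\<not> c ! l \<subseteq> U" "c ! l \<ominus>\<^sub>\<bottom> U = V \<ominus>\<^sub>\<bottom> U"
      proof -
        have "U \<subseteq> c ! l" "subspace (c ! l)"
          using sorted_chain_comparable[OF sc(2) X sc(3)] that sc(1) X by (auto simp: subs_def)
        then have "subspace_sum U (c ! l \<ominus>\<^sub>\<bottom> U) = c ! l"
          by (intro subspace_sum_ominus[OF sub(1)])
        then show ?thesis
          unfolding that(2) using subspace_sum_ominus[OF sub] by (rule trans[OF sym])
      qed
      then show "t l * (if c ! l \<subseteq> U then 0 else of_bool (c ! l \<ominus>\<^sub>\<bottom> U = V \<ominus>\<^sub>\<bottom> U)) = t l * of_bool (c ! l = V)"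
        using sub U(2) by auto
    qed
    then have "weight (high_part U c) (\<lambda>l. high_coords U c t l / high_mass U c t) (V \<ominus>\<^sub>\<bottom> U) = 0"
      unfolding weight_high_part[OF U(1,2) c] using True ne by simp
    then show ?thesis
      using ST_geo_pt_base[OF B(2) h] False by (simp add: h_simplex_def smash_in_ST_base)
  next
    case nV: False
    have "weight (low_part U c) (\<lambda>l. low_coords U c t l / low_mass U c t) {0} = 0 \<or>
        weight (low_part U c) (\<lambda>l. low_coords U c t l / low_mass U c t) U = 0"
      unfolding weight_low_part[OF U(1,2) c] using w nV by auto
    then show ?thesis
      using ST_geo_pt_base[OF B(1) l] False by (simp add: h_simplex_def smash_in_ST_base)
  qed
qed (simp add: h_simplex_def)

lemma ST_geo_pt_cong:
  assumes "c \<in> cells (ST_sset V) n" "t \<in> standard_simplex n" "d \<in> cells (ST_sset V) m" "s \<in> standard_simplex m"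
    "weight c t = weight d s"
  shows "geo_pt (ST_sset V) n (Some c) t = geo_pt (ST_sset V) m (Some d) s"
  using assms unfolding ST_sset_chain by (rule chain_geo_pt_cong)

text \<open>The masses and the weights of both halves are given by weighted sums over
  \<open>c\<close>, so chains with equal weights yield equal points in each factor.\<close>

lemma glue_invariant_h_simplex:
  assumes U: "U \<in> subs V" "U \<noteq> V" "U \<noteq> {0}"
  shows "glue_invariant (split_sset V U) (h_simplex V U)"
  unfolding split_sset_def
proof (rule glue_invariant_chain[where y = None])
  show "h_simplex V U n None t = None" for n t
    by (simp add: h_simplex_def)
next
  fix n c t r
  assume "c \<in> cells (chain_sset (subs V) {{0}, U, V}) n" "t \<in> standard_simplex n" "r \<in> {{0}, U, V}" "weight c t r = 0"
  then show "h_simplex V U n (Some c) t = None"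
    by (intro h_simplex_zero[OF U]) (auto simp: split_sset_def)
next
  fix n c t m d s
  assume c0: "c \<in> cells (chain_sset (subs V) {{0}, U, V}) n" and t: "t \<in> standard_simplex n"
    and d0: "d \<in> cells (chain_sset (subs V) {{0}, U, V}) m" and s: "s \<in> standard_simplex m" and w: "weight c t = weight d s"
  note c = c0[folded split_sset_def] and d = d0[folded split_sset_def]
  have mass: "low_mass U c t = low_mass U d s" "high_mass U c t = high_mass U d s"
    unfolding low_mass_def high_mass_def using weighted_sum_cong[OF w] by auto
  obtain B where c': "low_part U c \<in> cells (ST_sset U) (length (low_part U c) - 1)"
    "high_part U c \<in> cells (ST_sset (V \<ominus>\<^sub>\<bottom> U)) (Suc n - length (low_part U c))"
    using split_chain[OF U(1,2) c] by metis
  obtain B where d': "low_part U d \<in> cells (ST_sset U) (length (low_part U d) - 1)"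
    "high_part U d \<in> cells (ST_sset (V \<ominus>\<^sub>\<bottom> U)) (Suc m - length (low_part U d))"
    using split_chain[OF U(1,2) d] by metis
  note lc = low_coords_simplex[OF U(1,2) c t] and hc = high_coords_simplex[OF U(1,2) c t]
  note ld = low_coords_simplex[OF U(1,2) d s] and hd = high_coords_simplex[OF U(1,2) d s]
  show "h_simplex V U n (Some c) t = h_simplex V U m (Some d) s"
  proof (cases "low_mass U c t = 0 \<or> high_mass U c t = 0")
    case True
    then show ?thesis
      by (simp add: h_simplex_def mass)
  next
    case False
    have 1: "geo_pt (ST_sset U) (length (low_part U c) - 1) (Some (low_part U c)) (\<lambda>l. low_coords U c t l / low_mass U c t)
      = geo_pt (ST_sset U) (length (low_part U d) - 1) (Some (low_part U d)) (\<lambda>l. low_coords U d s l / low_mass U d s)"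
      by (rule ST_geo_pt_cong[OF c'(1) lc d'(1) ld])
        (use False in \<open>auto simp: mass weight_low_part[OF U(1,2) c] weight_low_part[OF U(1,2) d] w fun_eq_iff\<close>)
    have 2: "geo_pt (ST_sset (V \<ominus>\<^sub>\<bottom> U)) (Suc n - length (low_part U c)) (Some (high_part U c)) (\<lambda>l. high_coords U c t l / high_mass U c t)
      = geo_pt (ST_sset (V \<ominus>\<^sub>\<bottom> U)) (Suc m - length (low_part U d)) (Some (high_part U d)) (\<lambda>l. high_coords U d s l / high_mass U d s)"
      by (rule ST_geo_pt_cong[OF c'(2) hc d'(2) hd])
        (use False in \<open>auto simp: mass weight_high_part[OF U(1,2) c] weight_high_part[OF U(1,2) d] w
            weighted_sum_cong[OF w] fun_eq_iff\<close>)
    show ?thesis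
      using False 1 2 by (simp add: h_simplex_def mass)
  qed
qed

section \<open>Continuity of \<open>h\<close> on a simplex\<close>

lemma compact_standard_simplex: "compact (standard_simplex n)"
  using compactin_standard_simplex[of n] by (simp add: euclidean_product_topology)

lemma closed_Collect_coords:
  fixes f g :: "(nat \<Rightarrow> real) \<times> (nat \<Rightarrow> real) \<times> (nat \<Rightarrow> real) \<Rightarrow> nat \<Rightarrow> real"
  assumes "\<And>l. continuous_on UNIV (\<lambda>z. f z l)" "\<And>l. continuous_on UNIV (\<lambda>z. g z l)"
  shows "closed {z. \<forall>l. f z l = g z l}"
  by (intro closed_Collect_all closed_Collect_eq assms)

lemma continuous_map_h_simplex:
  assumes V: "subspace V" and U: "U \<in> subs V" "U \<noteq> V" "U \<noteq> {0}" and x: "x \<in> simplices (split_sset V U) n"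
  shows "continuous_map (subtopology (powertop_real UNIV) (standard_simplex n)) (space_of (ST_smash V U)) (h_simplex V U n x)"
proof (cases x)
  case None
  then have "h_simplex V U n x = (\<lambda>t. None)"
    by (simp add: h_simplex_def fun_eq_iff)
  then show ?thesis
    by (simp add: ST_smash_def topspace_smash)
next
  case (Some c)
  then have c: "c \<in> cells (split_sset V U) n"
    using x by simp
  define p where "p = length (low_part U c) - 1"
  define q where "q = Suc n - length (low_part U c)"
  let ?X = "ST_sset U" and ?Y = "ST_sset (V \<ominus>\<^sub>\<bottom> U)"
  obtain B where B: "c = low_part U c @ B" "high_part U c = {0} # map (\<lambda>W. W \<ominus>\<^sub>\<bottom> U) B"
    "\<And>X. X \<in> set (low_part U c) \<Longrightarrow> X \<subseteq> U" "\<And>X. X \<in> set B \<Longrightarrow> U \<subset> X"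
    "U \<in> set (low_part U c)" "length (low_part U c) + length B = Suc n"
    and low: "low_part U c \<in> cells ?X p" and high: "high_part U c \<in> cells ?Y q"
    using split_chain[OF U(1,2) c] unfolding p_def q_def by metis
  have sc: "length c = Suc n" "set c \<subseteq> subs V"
    using c by (auto simp: split_sset_def cells_chain_sset)
  \<comment> \<open>The normalized coordinates do not extend continuously to the faces where a mass vanishes. On the
    compact set \<open>K\<close> of all triples satisfying the cleared equations they become projections, and
    \<open>K\<close> maps onto the simplex by a quotient map.\<close>
  define K where "K = {(t, a, b). t \<in> standard_simplex n \<and> a \<in> standard_simplex p \<and> b \<in> standard_simplex q \<and>
    (\<forall>l. low_mass U c t * a l = low_coords U c t l) \<and> (\<forall>l. high_mass U c t * b l = high_coords U c t l)}"
  have K_eq: "K = (standard_simplex n \<times> standard_simplex p \<times> standard_simplex q) \<inter>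
      {z. \<forall>l. low_mass U c (fst z) * fst (snd z) l = low_coords U c (fst z) l} \<inter>
      {z. \<forall>l. high_mass U c (fst z) * snd (snd z) l = high_coords U c (fst z) l}"
    unfolding K_def by auto
  have ct: "continuous_on UNIV (\<lambda>z :: (nat \<Rightarrow> real) \<times> (nat \<Rightarrow> real) \<times> (nat \<Rightarrow> real). fst z l)"
    and ca: "continuous_on UNIV (\<lambda>z :: (nat \<Rightarrow> real) \<times> (nat \<Rightarrow> real) \<times> (nat \<Rightarrow> real). fst (snd z) l)"
    and cb: "continuous_on UNIV (\<lambda>z :: (nat \<Rightarrow> real) \<times> (nat \<Rightarrow> real) \<times> (nat \<Rightarrow> real). snd (snd z) l)" for l
    by (rule continuous_on_product_then_coordinatewise, intro continuous_intros)+
  have ws: "continuous_on UNIV (\<lambda>z :: (nat \<Rightarrow> real) \<times> (nat \<Rightarrow> real) \<times> (nat \<Rightarrow> real). weighted_sum c (fst z) f)" for f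
    unfolding weighted_sum_def by (intro continuous_intros ct)
  have clow: "continuous_on UNIV (\<lambda>z :: (nat \<Rightarrow> real) \<times> (nat \<Rightarrow> real) \<times> (nat \<Rightarrow> real). low_coords U c (fst z) l)" for l
    by (cases "l < length (low_part U c)") (simp_all add: low_coords_def continuous_on_mult ct)
  have chigh: "continuous_on UNIV (\<lambda>z :: (nat \<Rightarrow> real) \<times> (nat \<Rightarrow> real) \<times> (nat \<Rightarrow> real). high_coords U c (fst z) l)" for l
    by (cases "l = 0") (auto simp: high_coords_def weight_def intro!: continuous_intros ct ws)
  have "compact K"
    unfolding K_eq
    by (intro compact_Int_closed compact_Times compact_standard_simplex closed_Collect_coords
        continuous_on_mult ca cb clow chigh) (simp_all add: low_mass_def high_mass_def ws)
  then have cK: "compact_space (top_of_set K)"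
    by (simp add: compact_space_subtopology)
  have cont: "continuous_on K (\<lambda>z. fst z)" "continuous_on K (\<lambda>z. fst (snd z))" "continuous_on K (\<lambda>z. snd (snd z))"
    by (intro continuous_on_fst continuous_on_snd continuous_on_id)+
  let ?D = "\<lambda>n. top_of_set (standard_simplex n) :: (nat \<Rightarrow> real) topology"
  have fst: "continuous_map (top_of_set K) (?D n) fst"
    using cont(1) by (auto simp: K_def)
  have image: "fst ` K = standard_simplex n"
  proof
    show "standard_simplex n \<subseteq> fst ` K"
    proof
      fix t assume t: "t \<in> standard_simplex n"
      have nn: "\<And>l. 0 \<le> t l"
        using simplex_nonneg[OF t] .
      \<comment> \<open>The cleared equation forces the normalized coordinates when the mass is
        nonzero. Otherwise all coordinates of that half vanish and any point of the simplex is a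
        solution.\<close>
      have "\<exists>a\<in>standard_simplex p. \<forall>l. low_mass U c t * a l = low_coords U c t l"
      proof (cases "low_mass U c t = 0")
        case True
        have "low_coords U c t l = 0" for l
        proof (cases "l < length c")
          case l: True
          have "t l * low_share U (c ! l) \<le> weight c t (c ! l) * low_share U (c ! l)"
            using weight_ge[of t l c] nn l low_share_bounds by (intro mult_right_mono) auto
          also have "\<dots> \<le> 0"
            using low_mass_ge[of t c "c ! l" U, OF nn] True by simp
          finally have "t l * low_share U (c ! l) = 0"
            using mult_nonneg_nonneg[OF nn low_share_bounds(1), of l U "c ! l"] by linarith
          then show ?thesis
            by (simp add: low_coords_def)
        next
          case False
          then show ?thesis
            using B(6) sc(1) by (simp add: low_coords_def)
        qed
        moreover obtain a where "a \<in> standard_simplex p"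
          using nonempty_standard_simplex by blast
        ultimately show ?thesis
          using True by auto
      next
        case False
        then show ?thesis
          using low_coords_simplex[OF U(1,2) c t False]
          by (intro bexI[of _ "\<lambda>l. low_coords U c t l / low_mass U c t"]) (auto simp: p_def)
      qed
      moreover have "\<exists>b\<in>standard_simplex q. \<forall>l. high_mass U c t * b l = high_coords U c t l"
      proof (cases "high_mass U c t = 0")
        case True
        have "high_coords U c t l = 0" for l
        proof (cases "l = 0")
          case True
          then show ?thesis
            using high_mass_ge[of t c U U, OF nn] weight_nonneg[of t c U, OF nn] \<open>high_mass U c t = 0\<close>
            by (simp add: high_coords_def low_share_def)
        next
          case False
          define k where "k = length (low_part U c) + l - 1"
          have "t k = 0"
          proof (cases "k < length c")
            case k: True
            have "c ! k = B ! (l - 1)" "l - 1 < length B"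
              using k False nth_append[of "low_part U c" B k] B(1) B(6) sc(1) by (auto simp: k_def)
            then have "low_share U (c ! k) = 0"
              using B(4)[of "c ! k"] by (auto simp: low_share_def)
            then have "weight c t (c ! k) \<le> 0"
              using high_mass_ge[of t c "c ! k" U, OF nn] \<open>high_mass U c t = 0\<close> by simp
            then show ?thesis
              using weight_ge[of t k c, OF nn k] nn[of k] by linarith
          next
            case False
            then show ?thesis
              using simplex_zero[OF t] sc(1) by simp
          qed
          then show ?thesis
            using False by (simp add: high_coords_def k_def)
        qed
        moreover obtain b where "b \<in> standard_simplex q"
          using nonempty_standard_simplex by blast
        ultimately show ?thesis
          using True by auto
      next
        case False
        then show ?thesis
          using high_coords_simplex[OF U(1,2) c t False]
          by (intro bexI[of _ "\<lambda>l. high_coords U c t l / high_mass U c t"]) (auto simp: q_def)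
      qed
      ultimately obtain a b where "(t, a, b) \<in> K"
        using t unfolding K_def by blast
      then show "t \<in> fst ` K"
        by force
    qed
  qed (auto simp: K_def)
  \<comment> \<open>A continuous surjection from a compact space to a Hausdorff space is a quotient
    map.\<close>
  have quot: "quotient_map (top_of_set K) (?D n) fst"
    by (rule continuous_imp_quotient_map[OF fst cK])
      (use image in \<open>auto intro!: Hausdorff_space_subtopology\<close>)
  let ?g = "\<lambda>z. (geo_pt ?X p (Some (low_part U c)) (fst (snd z)), geo_pt ?Y q (Some (high_part U c)) (snd (snd z)))"
  have c1: "continuous_map (top_of_set K) (space_of (SigmaST U)) (\<lambda>z. geo_pt ?X p (Some (low_part U c)) (fst (snd z)))"
  proof -
    have "continuous_map (top_of_set K) (?D p) (\<lambda>z. fst (snd z))"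
      using cont(2) by (auto simp: K_def)
    moreover have "continuous_map (?D p) (space_of (SigmaST U)) (geo_pt ?X p (Some (low_part U c)))"
      using continuous_map_geo_pt[of "Some (low_part U c)" ?X p] low by (simp add: SigmaST_def euclidean_product_topology)
    ultimately show ?thesis
      by (rule continuous_map_compose[unfolded o_def])
  qed
  have c2: "continuous_map (top_of_set K) (space_of (SigmaST (V \<ominus>\<^sub>\<bottom> U))) (\<lambda>z. geo_pt ?Y q (Some (high_part U c)) (snd (snd z)))"
  proof -
    have "continuous_map (top_of_set K) (?D q) (\<lambda>z. snd (snd z))"
      using cont(3) by (auto simp: K_def)
    moreover have "continuous_map (?D q) (space_of (SigmaST (V \<ominus>\<^sub>\<bottom> U))) (geo_pt ?Y q (Some (high_part U c)))"
      using continuous_map_geo_pt[of "Some (high_part U c)" ?Y q] high by (simp add: SigmaST_def euclidean_product_topology)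
    ultimately show ?thesis
      by (rule continuous_map_compose[unfolded o_def])
  qed
  have "continuous_map (top_of_set K) (prod_topology (space_of (SigmaST U)) (space_of (SigmaST (V \<ominus>\<^sub>\<bottom> U)))) ?g"
    using c1 c2 by (simp add: continuous_map_paired)
  from continuous_map_compose[OF this continuous_map_smash_in]
  have cg: "continuous_map (top_of_set K) (space_of (ST_smash V U))
      (case_prod (smash_in (SigmaST U) (SigmaST (V \<ominus>\<^sub>\<bottom> U))) \<circ> ?g)"
    by (simp add: ST_smash_def)
  have "case_prod (smash_in (SigmaST U) (SigmaST (V \<ominus>\<^sub>\<bottom> U))) (?g z) = h_simplex V U n x (fst z)" if z: "z \<in> K" for z
  proof -
    obtain t a b where tab: "z = (t, a, b)" "t \<in> standard_simplex n" "a \<in> standard_simplex p" "b \<in> standard_simplex q"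
      "\<And>l. low_mass U c t * a l = low_coords U c t l" "\<And>l. high_mass U c t * b l = high_coords U c t l"
      using z unfolding K_def by blast
    have nn: "\<And>l. 0 \<le> t l"
      using simplex_nonneg[OF tab(2)] .
    have sum1: "low_mass U c t + high_mass U c t = 1"
      by (rule low_high_mass[OF tab(2) sc(1)])
    consider "low_mass U c t \<noteq> 0" "high_mass U c t \<noteq> 0" | "low_mass U c t = 0" | "high_mass U c t = 0"
      by blast
    then show ?thesis
    proof cases
      case 1
      have "a l = low_coords U c t l / low_mass U c t" "b l = high_coords U c t l / high_mass U c t" for l
        using tab(5,6)[of l] 1 by (auto simp: field_simps)
      then have "a = (\<lambda>l. low_coords U c t l / low_mass U c t)" "b = (\<lambda>l. high_coords U c t l / high_mass U c t)"
        by auto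
      then show ?thesis
        using 1 by (simp add: tab(1) Some h_simplex_def p_def q_def)
    next
      case 2
      \<comment> \<open>The lower coordinates are arbitrary on this face, but the upper factor is at
        its basepoint: its vertex \<open>{0}\<close> gets weight from \<open>U\<close> only, and
        that weight is 0.\<close>
      have "weight c t U = 0"
        using low_mass_ge[of t c U U, OF nn] weight_nonneg[of t c U, OF nn] 2 by (simp add: low_share_def)
      moreover have b: "b = (\<lambda>l. high_coords U c t l / 1)"
        using tab(6) 2 sum1 by auto
      moreover have "weighted_sum c t (\<lambda>X. if X \<subseteq> U then 0 else of_bool (X \<ominus>\<^sub>\<bottom> U = {0})) = 0"
        unfolding weighted_sum_def
      proof (rule sum.neutral, safe)
        fix l assume "l < length c"
        then have l: "c ! l \<in> set c"
          by simp
        show "t l * (if c ! l \<subseteq> U then 0 else of_bool (c ! l \<ominus>\<^sub>\<bottom> U = {0})) = 0"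
        proof (cases "c ! l \<subseteq> U")
          case False
          moreover have "set c = set (low_part U c) \<union> set B"
            by (metis B(1) set_append)
          ultimately have "c ! l \<in> set B"
            using l B(3) by blast
          then have "U \<subset> c ! l" "subspace U" "subspace (c ! l)"
            using B(4) U(1) sc(2) l by (auto simp: subs_def)
          then have "c ! l \<ominus>\<^sub>\<bottom> U \<noteq> {0}"
            using ominus_eq_zero[of U "c ! l"] by auto
          then show ?thesis
            by simp
        qed simp
      qed
      ultimately have "weight (high_part U c) b {0} = 0"
        unfolding b weight_high_part[OF U(1,2) c] by simp
      then have "geo_pt ?Y q (Some (high_part U c)) b = base_of (realization ?Y)"
        using ST_geo_pt_base[OF high tab(4)] by simp
      then show ?thesis
        using 2 by (simp add: tab(1) Some h_simplex_def smash_in_ST_base)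
    next
      case 3
      \<comment> \<open>Now the upper coordinates are arbitrary, and the lower factor is at its
        basepoint because its top vertex \<open>U\<close> has weight 0.\<close>
      have "weight c t U = 0"
        using high_mass_ge[of t c U U, OF nn] weight_nonneg[of t c U, OF nn] 3 by (simp add: low_share_def)
      moreover have a: "a = (\<lambda>l. low_coords U c t l / 1)"
        using tab(5) 3 sum1 by auto
      ultimately have "weight (low_part U c) a U = 0"
        unfolding a weight_low_part[OF U(1,2) c] by simp
      then have "geo_pt ?X p (Some (low_part U c)) a = base_of (realization ?X)"
        using ST_geo_pt_base[OF low tab(3)] by simp
      then show ?thesis
        using 3 by (simp add: tab(1) Some h_simplex_def smash_in_ST_base)
    qed
  qed
  then have "continuous_map (top_of_set K) (space_of (ST_smash V U)) (h_simplex V U n x \<circ> fst)"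
    by (intro continuous_map_eq[OF cg]) auto
  then have "continuous_map (?D n) (space_of (ST_smash V U)) (h_simplex V U n x)"
    by (rule continuous_compose_quotient_map[OF quot])
  then show ?thesis
    by (simp add: euclidean_product_topology)
qed

section \<open>Agreement with the formula on strict chains\<close>

lemma strict_last:
  assumes "sorted_wrt (\<subset>) A" "U \<in> set A" "\<And>X. X \<in> set A \<Longrightarrow> X \<subseteq> U"
  shows "A ! (length A - 1) = U"
proof -
  obtain i where i: "i < length A" "A ! i = U"
    using assms(2) by (metis in_set_conv_nth)
  have "\<not> i < length A - 1"
  proof
    assume "i < length A - 1"
    then have "U \<subset> A ! (length A - 1)"
      using sorted_wrt_nth_less[OF assms(1), of i "length A - 1"] i by simp
    moreover have "A ! (length A - 1) \<in> set A"
      using i by (intro nth_mem) simp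
    ultimately show False
      using assms(3) by blast
  qed
  then show ?thesis
    using i by (metis One_nat_def Suc_pred length_greater_0_conv less_Suc_eq list.size(3) not_less_zero)
qed

text \<open>The hypotheses say that \<open>U\<close> occurs once, at index \<open>j\<close>; halves
  and masses then take the form in which they appear in the formula for \<open>h\<close>. The
  splitting of step functions uses the same computation.\<close>

lemma split_formulas:
  assumes c: "length c = Suc n" "j \<le> n" "c ! j = U"
    and b: "\<forall>l<j. c ! l \<subset> U" and a: "\<forall>l\<in>{j<..n}. \<not> c ! l \<subseteq> U"
  shows "low_part U c = take (Suc j) c" "dropWhile (\<lambda>X. X \<subseteq> U) c = drop (Suc j) c"
    "low_mass U c t = (\<Sum>l<j. t l) + t j / 2" "high_mass U c t = t j / 2 + (\<Sum>l\<in>{j<..n}. t l)"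
    "weight c t U = t j"
    "low_coords U c t l = (if l < j then t l else if l = j then t j / 2 else 0)"
    "high_coords U c t l = (if l = 0 then t j / 2 else t (j + l))"
proof -
  have below: "\<And>l. l < j \<Longrightarrow> c ! l \<subset> U" and above: "\<And>l. j < l \<Longrightarrow> l \<le> n \<Longrightarrow> \<not> c ! l \<subseteq> U"
    using a b by auto
  have "takeWhile (\<lambda>X. X \<subseteq> U) c = take (Suc j) c"
  proof (rule takeWhile_eq_take_P_nth)
    fix l assume "l < Suc j" "l < length c"
    then show "c ! l \<subseteq> U"
      using below[of l] c(3) by (cases "l = j") auto
  next
    assume "Suc j < length c"
    then show "\<not> c ! Suc j \<subseteq> U"
      using above[of "Suc j"] c(1) by simp
  qed
  then show low: "low_part U c = take (Suc j) c" and "dropWhile (\<lambda>X. X \<subseteq> U) c = drop (Suc j) c"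
    using c(1,2) by (simp_all add: low_part_def dropWhile_eq_drop)
  have share: "low_share U (c ! l) = (if l < j then 1 else if l = j then 1 / 2 else 0)" if "l \<le> n" for l
    using below[of l] above[of l] c(3) that by (cases l j rule: linorder_cases) (auto simp: low_share_def)
  have split: "(\<Sum>l\<le>n. f l) = (\<Sum>l<j. f l) + f j + (\<Sum>l\<in>{j<..n}. f l)" for f :: "nat \<Rightarrow> real"
  proof -
    have "{..n} = insert j ({..<j} \<union> {j<..n})"
      using c(2) by auto
    moreover have "(\<Sum>l\<in>{..<j} \<union> {j<..n}. f l) = (\<Sum>l<j. f l) + (\<Sum>l\<in>{j<..n}. f l)"
      by (rule sum.union_disjoint) auto
    ultimately show ?thesis
      by simp
  qed
  show "low_mass U c t = (\<Sum>l<j. t l) + t j / 2"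
    unfolding low_mass_def weighted_sum_def c(1) lessThan_Suc_atMost split
    using c(2) by (simp add: share)
  show "high_mass U c t = t j / 2 + (\<Sum>l\<in>{j<..n}. t l)"
    unfolding high_mass_def weighted_sum_def c(1) lessThan_Suc_atMost split
    using c(2) by (simp add: share)
  have "weight c t U = (\<Sum>l\<le>n. if l = j then t l else 0)"
    unfolding weight_def weighted_sum_def c(1) lessThan_Suc_atMost
  proof (rule sum.cong)
    fix l assume "l \<in> {..n}"
    then have "c ! l = U \<longleftrightarrow> l = j"
      using below[of l] above[of l] c(3) by (cases l j rule: linorder_cases) auto
    then show "t l * of_bool (c ! l = U) = (if l = j then t l else 0)"
      by simp
  qed simp
  then show u: "weight c t U = t j"
    using c(2) by simp
  show "low_coords U c t l = (if l < j then t l else if l = j then t j / 2 else 0)"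
    using c(1,2) by (auto simp: low_coords_def low share)
  show "high_coords U c t l = (if l = 0 then t j / 2 else t (j + l))"
    using c(1,2) by (simp add: high_coords_def low u)
qed

text \<open>The map assembled from all simplices. \<open>h_map\<close> itself is given by a definite
  description over strict representatives, so continuity is proved for this map and
  transferred.\<close>

definition join_h ::
    "'a::euclidean_space set \<Rightarrow> 'a set \<Rightarrow> (nat \<times> nat \<times> 'a set list \<times> 'a set list) gpoint
       \<Rightarrow> ('a set list gpoint \<times> 'a set list gpoint) option" where
  "join_h V U = descend (susp (RT_join V U)) (\<lambda>n x. h_simplex V U n (map_option (susp_join_chain U) x))"

context
  fixes V U :: "'a::euclidean_space set"
  assumes V: "subspace V" and U: "U \<in> subs V" "U \<noteq> V" "U \<noteq> {0}"
begin

lemma psset_iso_join: "psset_iso (susp (RT_join V U)) (split_sset V U) (susp_join_chain U)"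
  by (rule psset_iso_susp_join[OF U(1) V U(2,3)])

lemma glue_invariant_join_h:
  "glue_invariant (susp (RT_join V U)) (\<lambda>n x. h_simplex V U n (map_option (susp_join_chain U) x))"
  by (rule glue_invariant_iso[OF psset_iso_join glue_invariant_h_simplex[OF U]])

lemma join_h_geo_pt:
  assumes "x \<in> simplices (susp (RT_join V U)) n" "t \<in> standard_simplex n"
  shows "join_h V U (geo_pt (susp (RT_join V U)) n x t) = h_simplex V U n (map_option (susp_join_chain U) x) t"
  unfolding join_h_def by (rule descend_geo_pt[OF glue_invariant_join_h assms])

lemma continuous_map_join_h:
  "continuous_map (space_of (Sigma_join V U)) (space_of (ST_smash V U)) (join_h V U)"
  unfolding join_h_def
  by (rule continuous_map_descend[OF glue_invariant_join_h])
    (intro continuous_map_h_simplex[OF V U] psset_iso_in[OF psset_iso_join])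

text \<open>The isomorphism induces an injective map on realizations, so equality in the join is
  reduced to chains, where weights decide it.\<close>

lemma join_geo_pt_eq_iff:
  assumes "x \<in> simplices (susp (RT_join V U)) n" "t \<in> standard_simplex n"
    "y \<in> simplices (susp (RT_join V U)) m" "s \<in> standard_simplex m"
  shows "geo_pt (susp (RT_join V U)) n x t = geo_pt (susp (RT_join V U)) m y s \<longleftrightarrow>
    geo_pt (split_sset V U) n (map_option (susp_join_chain U) x) t = geo_pt (split_sset V U) m (map_option (susp_join_chain U) y) s"
proof -
  let ?J = "susp (RT_join V U)" and ?E = "susp_join_chain U"
  let ?F = "descend ?J (\<lambda>n x. geo_pt (split_sset V U) n (map_option ?E x))"
  have F: "?F (geo_pt ?J n x t) = geo_pt (split_sset V U) n (map_option ?E x) t"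
    if "x \<in> simplices ?J n" "t \<in> standard_simplex n" for n x t
    by (rule descend_geo_pt[OF glue_invariant_iso[OF psset_iso_join glue_invariant_geo_pt] that])
  have "inj_on ?F (topspace (space_of (realization ?J)))"
    using homeomorphic_imp_injective_map[OF homeomorphic_map_psset_iso[OF psset_iso_join]] .
  then have "?F (geo_pt ?J n x t) = ?F (geo_pt ?J m y s) \<longleftrightarrow> geo_pt ?J n x t = geo_pt ?J m y s"
    by (rule inj_on_eq_iff) (use assms geo_pt_in_realization in blast)+
  then show ?thesis
    using F assms by simp
qed

lemma join_geo_pt_nonbase:
  assumes "y \<in> cells (susp (RT_join V U)) n" "t \<in> standard_simplex n"
  shows "geo_pt (susp (RT_join V U)) n (Some y) t \<noteq> base_of (Sigma_join V U) \<longleftrightarrow>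
    (\<forall>r\<in>{{0}, U, V}. weight (susp_join_chain U y) t r \<noteq> 0)"
proof -
  have d: "susp_join_chain U y \<in> cells (split_sset V U) n"
    using psset_iso_in[OF psset_iso_join, of "Some y" n] assms(1) by simp
  have "geo_pt (susp (RT_join V U)) n (Some y) t = base_of (Sigma_join V U) \<longleftrightarrow>
      geo_pt (split_sset V U) n (Some (susp_join_chain U y)) t = base_of (realization (split_sset V U))"
    unfolding base_of_realization by (subst join_geo_pt_eq_iff) (use assms in auto)
  then show ?thesis
    using chain_geo_pt_base_iff[OF d[unfolded split_sset_def] assms(2)] by (simp add: split_sset_def)
qed

lemma join_normal_form:
  assumes p: "p \<in> topspace (space_of (Sigma_join V U))" "p \<noteq> base_of (Sigma_join V U)"
  obtains n j A B t where "length A = j" "(1, j - 1, A, B) \<in> cells (susp (RT_join V U)) n"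
    "sorted_wrt (\<subset>) A" "sorted_wrt (\<subset>) B" "t \<in> standard_simplex n"
    "p = geo_pt (susp (RT_join V U)) n (Some (1, j - 1, A, B)) t"
proof -
  let ?J = "susp (RT_join V U)" and ?E = "susp_join_chain U"
  obtain n y t where y: "y \<in> cells ?J n" "t \<in> standard_simplex n" "p = geo_pt ?J n (Some y) t"
    using realization_nonbase_cases[OF p] .
  have d: "?E y \<in> cells (split_sset V U) n"
    using psset_iso_in[OF psset_iso_join, of "Some y" n] y by simp
  have w: "weight (?E y) t r \<noteq> 0" if "r \<in> {{0}, U, V}" for r
    using join_geo_pt_nonbase[OF y(1,2)] p(2) y(3) that by blast
  obtain m e s where e: "e \<in> cells (split_sset V U) m" "sorted_wrt (\<subset>) e" "s \<in> standard_simplex m"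
    "geo_pt (split_sset V U) n (Some (?E y)) t = geo_pt (split_sset V U) m (Some e) s"
    using chain_normal_form[OF d[unfolded split_sset_def] y(2) w] unfolding split_sset_def by metis
  have "Some e \<in> simplices (split_sset V U) m"
    using e(1) by simp
  then obtain y' where y': "y' \<in> simplices ?J m" "Some e = map_option ?E y'"
    by (rule psset_iso_surj[OF psset_iso_join])
  then obtain k j A B where z: "y' = Some (k, j, A, B)"
    by (cases y') auto
  have ee: "e = replicate k {0} @ A @ map (subspace_sum U) B"
    using y'(2) by (simp add: z susp_join_chain_def join_chain_def)
  have kj: "1 \<le> k" "(j, A, B) \<in> cells (RT_join V U) (m - k)"
    using y'(1) by (auto simp: z cells_susp)
  then have lA: "length A = Suc j"
    by (auto simp: cells_RT_join RT_chain cells_chain_sset)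
  \<comment> \<open>Two cone vertices would be two equal members \<open>{0}\<close> at the start of
    a strict chain.\<close>
  have "\<not> 2 \<le> k"
  proof
    assume "2 \<le> k"
    then have "e ! 0 \<subset> e ! 1"
      using sorted_wrt_nth_less[OF e(2), of 0 1] by (simp add: ee)
    then show False
      using \<open>2 \<le> k\<close> by (simp add: ee nth_append)
  qed
  then have k: "k = 1"
    using kj by simp
  have "sorted_wrt (\<subset>) (map (subspace_sum U) B)" and sA: "sorted_wrt (\<subset>) A"
    using e(2) by (auto simp: ee sorted_wrt_append)
  then have sB': "sorted_wrt (\<lambda>x y. subspace_sum U x \<subset> subspace_sum U y) B"
    by (simp add: sorted_wrt_map)
  have "sorted_wrt (\<subseteq>) B"
    using kj by (auto simp: cells_RT_join RT_chain cells_chain_sset)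
  then have sB: "sorted_wrt (\<subset>) B"
    using sB' by (fastforce simp: sorted_wrt_iff_nth_less)
  have "p = geo_pt ?J m y' s"
    unfolding y(3) by (subst join_geo_pt_eq_iff) (use y y' e in auto)
  then show thesis
    using that[of A "Suc j" B m s] lA y'(1) sA sB e(3) by (simp add: z k)
qed

lemma h_formula:
  assumes A: "length A = j" "sorted_wrt (\<subset>) A" and B: "sorted_wrt (\<subset>) B"
    and cell: "(1, j - 1, A, B) \<in> cells (susp (RT_join V U)) n" and t: "t \<in> standard_simplex n"
    and nb: "geo_pt (susp (RT_join V U)) n (Some (1, j - 1, A, B)) t \<noteq> base_of (Sigma_join V U)"
  shows "(let sa = (\<Sum>l<j. t l) + t j / 2;
             sb = t j / 2 + (\<Sum>l\<in>{j<..n}. t l);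
             a = (\<lambda>l. if l < j then t l / sa else if l = j then t j / 2 / sa else 0);
             b = (\<lambda>l. if l = 0 then t j / 2 / sb else if l \<le> n - j then t (j + l) / sb else 0)
         in smash_in (SigmaST U) (SigmaST (V \<ominus>\<^sub>\<bottom> U))
                  (geo_pt (ST_sset U) j (Some ({0} # A)) a)
                  (geo_pt (ST_sset (V \<ominus>\<^sub>\<bottom> U)) (n - j) (Some ({0} # B)) b)) =
    h_simplex V U n (Some (susp_join_chain U (1, j - 1, A, B))) t"
proof -
  define c where "c = {0} # A @ map (subspace_sum U) B"
  have c_eq: "susp_join_chain U (1, j - 1, A, B) = c"
    by (simp add: susp_join_chain_def join_chain_def c_def)
  have c: "c \<in> cells (split_sset V U) n"
    using psset_iso_in[OF psset_iso_join, of "Some (1, j - 1, A, B)" n] cell by (simp only: option.map c_eq Some_simplices)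
  have w: "weight c t r \<noteq> 0" if "r \<in> {{0}, U, V}" for r
    using join_geo_pt_nonbase[OF cell t] nb that unfolding c_eq by blast
  have A': "set A \<subseteq> subs U - {{0}}" "U \<in> set A"
    and B': "set B \<subseteq> subs (V \<ominus>\<^sub>\<bottom> U) - {{0}}"
    using cell by (auto simp: cells_susp cells_RT_join RT_chain cells_chain_sset)
  have jn: "0 < j"
    using A'(2) A(1) by (cases A) auto
  have lenc: "length c = Suc n"
    using c by (simp add: split_sset_def cells_chain_sset)
  then have lB: "length B = n - j" "j \<le> n"
    using A(1) by (auto simp: c_def)
  have Aj: "A ! (j - 1) = U"
    using strict_last[OF A(2) A'(2)] A'(1) A(1) by (auto simp: subs_def)
  have cj: "c ! j = U"
    using Aj jn A(1) by (simp add: c_def nth_Cons' nth_append)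
  have Bout: "\<forall>X\<in>set (map (subspace_sum U) B). \<not> X \<subseteq> U"
    using join_chain_nonzero_summand[OF U(1) V] B' by auto
  have c2: "c = ({0} # A) @ map (subspace_sum U) B"
    by (simp add: c_def)
  have sub_less: "c ! l \<subset> U" if "l < j" for l
  proof (cases l)
    case 0
    then show ?thesis
      using U(1,3) subs_zero_least[OF U(1)] by (auto simp: c_def subs_def subspace_0)
  next
    case (Suc k)
    then have "A ! k \<subset> A ! (j - 1)"
      using sorted_wrt_nth_less[OF A(2), of k "j - 1"] that A(1) by simp
    then show ?thesis
      using Suc that A(1) Aj by (auto simp: c_def nth_append)
  qed
  have out: "\<not> c ! l \<subseteq> U" if "j < l" "l \<le> n" for l
  proof -
    have "c ! l = map (subspace_sum U) B ! (l - Suc j)"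
      unfolding c2 nth_append using that A(1) by simp
    moreover have "l - Suc j < length (map (subspace_sum U) B)"
      using that lB by simp
    ultimately show ?thesis
      using Bout nth_mem by metis
  qed
  then have "\<forall>l<j. c ! l \<subset> U" "\<forall>l\<in>{j<..n}. \<not> c ! l \<subseteq> U"
    using sub_less by auto
  note F = split_formulas[OF lenc lB(2) cj this]
  have low: "low_part U c = {0} # A"
    unfolding F(1) using A(1) by (simp add: c2)
  have "dropWhile (\<lambda>X. X \<subseteq> U) c = map (subspace_sum U) B"
    unfolding F(2) using A(1) by (simp add: c2)
  moreover have "map ((\<lambda>W. W \<ominus>\<^sub>\<bottom> U) \<circ> subspace_sum U) B = B"
    by (rule map_idI) (use subspace_sum_subs(3)[OF U(1) V] B' in auto)
  ultimately have high: "high_part U c = {0} # B"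
    by (simp add: high_part_def)
  define sa where "sa = (\<Sum>l<j. t l) + t j / 2"
  define sb where "sb = t j / 2 + (\<Sum>l\<in>{j<..n}. t l)"
  have sa: "low_mass U c t = sa" and sb: "high_mass U c t = sb"
    unfolding sa_def sb_def by (rule F(3) F(4))+
  have nn: "\<And>l. 0 \<le> t l"
    using simplex_nonneg[OF t] .
  have VU: "\<not> V \<subseteq> U"
    using U by (auto simp: subs_def)
  \<comment> \<open>Off the basepoint \<open>{0}\<close> and \<open>V\<close> have positive weight.
    The former counts fully in the lower mass and the latter fully in the upper one, so neither
    denominator is 0.\<close>
  have "0 < weight c t {0}" "0 < weight c t V"
    using w weight_nonneg[of t c, OF nn] by (simp_all add: less_le)
  moreover have "low_share U {0} = 1" "low_share U V = 0"
    using subs_zero_least[OF U(1)] U(2,3) VU unfolding low_share_def by simp_all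
  ultimately have pos: "sa \<noteq> 0" "sb \<noteq> 0"
    using low_mass_ge[of t c "{0}" U, OF nn] high_mass_ge[of t c V U, OF nn] sa sb by auto
  have 1: "(\<lambda>l. if l < j then t l / sa else if l = j then t j / 2 / sa else 0) = (\<lambda>l. low_coords U c t l / sa)"
    by (simp add: F(6) fun_eq_iff)
  have 2: "(\<lambda>l. if l = 0 then t j / 2 / sb else if l \<le> n - j then t (j + l) / sb else 0) = (\<lambda>l. high_coords U c t l / sb)"
    using simplex_zero[OF t] by (auto simp: F(7) fun_eq_iff)
  show ?thesis
    unfolding Let_def sa_def[symmetric] sb_def[symmetric] 1 2 c_eq
    using pos by (simp add: h_simplex_def sa sb low high A(1))
qed

text \<open>Every strict representative that the description admits yields the value of
  \<open>join_h\<close> at \<open>p\<close>, so the description has at most one solution;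
  \<open>join_normal_form\<close> supplies a representative.\<close>

lemma h_map_eq_join_h:
  assumes p: "p \<in> topspace (space_of (Sigma_join V U))"
  shows "h_map V U p = join_h V U p"
proof (cases "p = base_of (Sigma_join V U)")
  case True
  have "join_h V U (base_of (Sigma_join V U)) = None"
    unfolding base_of_realization by (subst join_h_geo_pt) (auto simp: h_simplex_def)
  then show ?thesis
    using True by (simp add: h_map_def)
next
  case False
  obtain n j A B t where w: "length A = j" "(1, j - 1, A, B) \<in> cells (susp (RT_join V U)) n"
    "sorted_wrt (\<subset>) A" "sorted_wrt (\<subset>) B" "t \<in> standard_simplex n"
    "p = geo_pt (susp (RT_join V U)) n (Some (1, j - 1, A, B)) t"
    using join_normal_form[OF p False] .
  have val: "h_simplex V U n (Some (susp_join_chain U (1, j - 1, A, B))) t = join_h V U p"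
    if "(1, j - 1, A, B) \<in> cells (susp (RT_join V U)) n" "t \<in> standard_simplex n"
      "p = geo_pt (susp (RT_join V U)) n (Some (1, j - 1, A, B)) t" for n j A B t
    unfolding that(3) by (subst join_h_geo_pt) (use that in auto)
  show ?thesis
    unfolding h_map_def if_not_P[OF False]
  proof (rule the_equality, goal_cases)
    case 1
    show ?case
      by (rule exI[of _ n], rule exI[of _ j], rule exI[of _ A], rule exI[of _ B], rule exI[of _ t])
        (use w False val[OF w(2,5,6)] h_formula[OF w(1,3,4,2,5)] in \<open>simp add: Let_def\<close>)
  next
    case (2 q)
    then obtain n j A B t where w: "length A = j" "(1, j - 1, A, B) \<in> cells (susp (RT_join V U)) n"
      "sorted_wrt (\<subset>) A" "sorted_wrt (\<subset>) B" "t \<in> standard_simplex n"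
      "p = geo_pt (susp (RT_join V U)) n (Some (1, j - 1, A, B)) t"
      and q: "(let sa = (\<Sum>l<j. t l) + t j / 2;
             sb = t j / 2 + (\<Sum>l\<in>{j<..n}. t l);
             a = (\<lambda>l. if l < j then t l / sa else if l = j then t j / 2 / sa else 0);
             b = (\<lambda>l. if l = 0 then t j / 2 / sb else if l \<le> n - j then t (j + l) / sb else 0)
         in q = smash_in (SigmaST U) (SigmaST (V \<ominus>\<^sub>\<bottom> U))
                  (geo_pt (ST_sset U) j (Some ({0} # A)) a)
                  (geo_pt (ST_sset (V \<ominus>\<^sub>\<bottom> U)) (n - j) (Some ({0} # B)) b))"
      by (elim exE conjE) rule
    show ?case
      using q h_formula[OF w(1,3,4,2,5)] w(6) False val[OF w(2,5,6)] unfolding Let_def by simp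
  qed
qed

lemma pointed_map_h_map: "pointed_map (Sigma_join V U) (ST_smash V U) (h_map V U)"
  unfolding pointed_map_def
proof
  show "continuous_map (space_of (Sigma_join V U)) (space_of (ST_smash V U)) (h_map V U)"
    by (rule continuous_map_eq[OF continuous_map_join_h]) (simp add: h_map_eq_join_h)
  show "h_map V U (base_of (Sigma_join V U)) = base_of (ST_smash V U)"
    by (simp add: h_map_def ST_smash_def base_of_smash)
qed

end

section \<open>Step functions\<close>

lemma has_stepsD:
  assumes "has_steps V p n c t"
  shows "c \<in> cells (ST_sset V) n" "sorted_wrt (\<subset>) c" "t \<in> standard_simplex n" "\<And>k. k \<le> n \<Longrightarrow> 0 < t k"
    "p = geo_pt (ST_sset V) n (Some c) t" "length c = Suc n" "set c \<subseteq> subs V" "{0} \<in> set c" "V \<in> set c"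
  using assms unfolding has_steps_def by (auto simp: ST_sset_chain cells_chain_sset)

lemma has_steps_weight:
  assumes "has_steps V p n c t" "r \<in> set c"
  shows "weight c t r \<noteq> 0"
proof -
  obtain l where "l < length c" "c ! l = r"
    using assms(2) by (metis in_set_conv_nth)
  then show ?thesis
    using weight_distinct[OF strict_chain_distinct[OF has_stepsD(2)[OF assms(1)]], of l t]
      has_stepsD(4)[OF assms(1), of l] has_stepsD(6)[OF assms(1)] by auto
qed

lemma has_steps_nonbase:
  assumes "has_steps V p n c t"
  shows "p \<noteq> base_of (SigmaST V)"
  using chain_geo_pt_base_iff[OF has_stepsD(1)[OF assms, unfolded ST_sset_chain] has_stepsD(3)[OF assms]]
    has_steps_weight[OF assms] has_stepsD(5,8,9)[OF assms]
  by (auto simp: SigmaST_def ST_sset_chain)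

lemma has_steps_unique:
  assumes "has_steps V p n c t" "has_steps V p m d s"
  shows "n = m" "c = d" "t = s"
proof -
  note C = has_stepsD[OF assms(1)] and D = has_stepsD[OF assms(2)]
  have "geo_pt (chain_sset (subs V) {{0}, V}) n (Some c) t = geo_pt (chain_sset (subs V) {{0}, V}) m (Some d) s"
    using C(5) D(5) by (simp add: ST_sset_chain)
  then have w: "weight c t = weight d s"
    by (rule chain_geo_pt_weight) (use has_steps_weight[OF assms(1)] C(8,9) in auto)
  show "n = m" "c = d" "t = s"
    using strict_weight_unique[OF C(2) D(2) C(6) D(6) C(3) D(3) C(4) D(4) w] by simp_all
qed

lemma has_steps_exists:
  assumes "p \<in> topspace (space_of (SigmaST V))" "p \<noteq> base_of (SigmaST V)"
  obtains n c t where "has_steps V p n c t"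
proof -
  obtain n c t where c: "c \<in> cells (ST_sset V) n" "t \<in> standard_simplex n" "p = geo_pt (ST_sset V) n (Some c) t"
    using realization_nonbase_cases[OF assms[unfolded SigmaST_def]] .
  then have "weight c t r \<noteq> 0" if "r \<in> {{0}, V}" for r
    using chain_geo_pt_base_iff[of c "subs V" "{{0}, V}" n t] assms(2) that by (auto simp: SigmaST_def ST_sset_chain)
  then obtain m d s where "d \<in> cells (ST_sset V) m" "sorted_wrt (\<subset>) d" "s \<in> standard_simplex m"
    "\<And>k. k \<le> m \<Longrightarrow> 0 < s k" "p = geo_pt (ST_sset V) m (Some d) s"
    using chain_normal_form[OF c(1)[unfolded ST_sset_chain] c(2)] c(3) unfolding ST_sset_chain by metis
  then show thesis
    using that[of m d s] by (simp add: has_steps_def)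
qed

lemma has_steps_ends:
  assumes "has_steps V p n c t"
  shows "c ! 0 = {0}" "c ! n = V"
proof -
  note C = has_stepsD[OF assms]
  have in_c: "c ! l \<in> subs V" if "l \<le> n" for l
    using C(6,7) that by (auto simp: subset_iff)
  obtain l where l: "l \<le> n" "c ! l = {0}"
    using C(6,8) by (metis in_set_conv_nth less_Suc_eq_le)
  show "c ! 0 = {0}"
  proof (cases "l = 0")
    case False
    then have "c ! 0 \<subset> {0}"
      using sorted_wrt_nth_less[OF C(2), of 0 l] l C(6) by simp
    then show ?thesis
      using subs_zero_least[OF in_c[of 0]] by auto
  qed (use l in simp)
  obtain l where l: "l \<le> n" "c ! l = V"
    using C(6,9) by (metis in_set_conv_nth less_Suc_eq_le)
  show "c ! n = V"
  proof (cases "l = n")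
    case False
    then have "V \<subset> c ! n"
      using sorted_wrt_nth_less[OF C(2), of l n] l C(6) by simp
    then show ?thesis
      using in_c[of n] by (auto simp: subs_def)
  qed (use l in simp)
qed

lemma partial_sum_mono:
  fixes t :: "nat \<Rightarrow> real"
  assumes "\<And>l. 0 \<le> t l" "j \<le> k"
  shows "(\<Sum>l<j. t l) \<le> (\<Sum>l<k. t l)"
  by (rule sum_mono2) (use assms in auto)

lemma partial_sum_le_one:
  assumes "t \<in> standard_simplex n" "k \<le> Suc n"
  shows "(\<Sum>l<k. t l) \<le> 1"
  using partial_sum_mono[of t k "Suc n"] simplex_nonneg[OF assms(1)] simplex_sum[OF assms(1)] assms(2)
  by (simp only: lessThan_Suc_atMost)

lemma interval_cover:
  fixes t :: "nat \<Rightarrow> real"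
  assumes "0 < x" "x < (\<Sum>l<m. t l)" "\<And>k. k \<le> m \<Longrightarrow> x \<noteq> (\<Sum>l<k. t l)"
  shows "\<exists>k<m. (\<Sum>l<k. t l) < x \<and> x < (\<Sum>l\<le>k. t l)"
  using assms
proof (induction m)
  case (Suc m)
  show ?case
  proof (cases "x < (\<Sum>l<m. t l)")
    case True
    then show ?thesis
      using Suc by (metis le_SucI less_SucI)
  next
    case False
    then have "(\<Sum>l<m. t l) < x"
      using Suc.prems(3)[of m] by simp
    then show ?thesis
      using Suc.prems(2) by (intro exI[of _ m]) (simp add: lessThan_Suc_atMost)
  qed
qed simp

section \<open>Functions representing a point\<close>

definition represents_with :: "'a::euclidean_space set \<Rightarrow> (real \<Rightarrow> 'a set) \<Rightarrow> 'a set list gpoint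
    \<Rightarrow> nat \<Rightarrow> 'a set list \<Rightarrow> (nat \<Rightarrow> real) \<Rightarrow> bool" where
  "represents_with V \<phi> p n c t \<longleftrightarrow> has_steps V p n c t \<and>
     (\<forall>k\<le>n. finite {x. (\<Sum>l<k. t l) < x \<and> x < (\<Sum>l\<le>k. t l) \<and> \<phi> x \<noteq> c ! k})"

lemma represents_iff: "represents V \<phi> p \<longleftrightarrow> (\<exists>n c t. represents_with V \<phi> p n c t)"
  by (simp add: represents_def represents_with_def)

text \<open>The weights are read off from the step function up to null sets, so the represented point is unique.\<close>

lemma represents_measure:
  assumes r: "represents_with V \<phi> p n c t"
  shows "weight c t W = measure lborel {x \<in> {0<..<1}. \<phi> x = W}"
proof -
  have h: "has_steps V p n c t"
    and fin: "\<And>k. k \<le> n \<Longrightarrow> finite {x. (\<Sum>l<k. t l) < x \<and> x < (\<Sum>l\<le>k. t l) \<and> \<phi> x \<noteq> c ! k}"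
    using r by (auto simp: represents_with_def)
  note C = has_stepsD[OF h]
  have nn: "\<And>l. 0 \<le> t l"
    using simplex_nonneg[OF C(3)] .
  \<comment> \<open>The break points of the steps and the finitely many places where
    \<open>\<phi>\<close> deviates from its steps. Outside this null set, each level set of
    \<open>\<phi>\<close> in the unit interval agrees with an open step or is empty.\<close>
  define F where "F = (\<lambda>k. \<Sum>l<k. t l) ` {..Suc n} \<union>
    (\<Union>k\<in>{..n}. {x. (\<Sum>l<k. t l) < x \<and> x < (\<Sum>l\<le>k. t l) \<and> \<phi> x \<noteq> c ! k})"
  define E where "E = {x \<in> {0<..<1}. \<phi> x = W}"
  have finF: "finite F"
    unfolding F_def using fin by auto
  have cover: "\<exists>k\<le>n. (\<Sum>l<k. t l) < x \<and> x < (\<Sum>l\<le>k. t l) \<and> \<phi> x = c ! k" if "x \<in> {0<..<1} - F" for x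
  proof -
    have "(\<Sum>l<Suc n. t l) = 1"
      using simplex_sum[OF C(3)] by (simp only: lessThan_Suc_atMost)
    then have "\<exists>k<Suc n. (\<Sum>l<k. t l) < x \<and> x < (\<Sum>l\<le>k. t l)"
      by (intro interval_cover) (use that in \<open>auto simp: F_def\<close>)
    then show ?thesis
      using that unfolding F_def by (metis (mono_tags, lifting) DiffD2 UN_I UnCI atMost_iff less_Suc_eq_le mem_Collect_eq)
  qed
  have null: "F \<in> null_sets lborel" "E \<inter> F \<in> null_sets lborel"
    using finF by (auto intro!: finite_imp_null_set_lborel)
  have "E - F \<in> sets lborel \<and> measure lborel (E - F) = weight c t W"
  proof (cases "W \<in> set c")
    case True
    then obtain k where k: "k \<le> n" "c ! k = W"
      using C(6) by (metis in_set_conv_nth less_Suc_eq_le)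
    let ?I = "{(\<Sum>l<k. t l)<..<(\<Sum>l\<le>k. t l)}"
    have "E - F = ?I - F"
    proof
      show "E - F \<subseteq> ?I - F"
      proof
        fix x assume x: "x \<in> E - F"
        then obtain k' where k': "k' \<le> n" "(\<Sum>l<k'. t l) < x" "x < (\<Sum>l\<le>k'. t l)" "\<phi> x = c ! k'"
          using cover[of x] by (auto simp: E_def)
        then have "c ! k' = c ! k"
          using x k by (simp add: E_def)
        then have "k' = k"
          using strict_chain_distinct[OF C(2)] k(1) k'(1) C(6) by (simp add: nth_eq_iff_index_eq)
        then show "x \<in> ?I - F"
          using k' x by simp
      qed
      show "?I - F \<subseteq> E - F"
      proof
        fix x assume x: "x \<in> ?I - F"
        have "0 \<le> (\<Sum>l<k. t l)" "(\<Sum>l\<le>k. t l) \<le> 1"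
          using nn partial_sum_le_one[OF C(3), of "Suc k"] k(1) by (auto simp: sum_nonneg lessThan_Suc_atMost)
        then have "x \<in> {0<..<1}"
          using x by auto
        moreover have "\<phi> x = W"
          using x k by (auto simp: F_def)
        ultimately show "x \<in> E - F"
          using x by (simp add: E_def)
      qed
    qed
    moreover have "measure lborel (?I - F) = measure lborel ?I"
      by (rule measure_Diff_null_set[OF _ null(1)]) simp
    moreover have "?I - F \<in> sets lborel"
      using null(1) by auto
    moreover have "measure lborel ?I = t k"
      using nn[of k] by (simp add: lessThan_Suc_atMost[symmetric])
    moreover have "weight c t W = t k"
      using weight_distinct[OF strict_chain_distinct[OF C(2)], of k t] k C(6) by simp
    ultimately show ?thesis
      by simp
  next
    case False
    have "E - F = {}"
    proof (rule ccontr)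
      assume "E - F \<noteq> {}"
      then obtain x where x: "x \<in> E - F"
        by blast
      then obtain k where k: "k \<le> n" "\<phi> x = c ! k"
        using cover[of x] by (auto simp: E_def)
      then have "c ! k \<in> set c"
        using C(6) by (intro nth_mem) simp
      then have "W \<in> set c"
        using x k(2) by (simp add: E_def)
      then show False
        using False by simp
    qed
    then have "E - F \<in> sets lborel \<and> measure lborel (E - F) = 0"
      by (simp only: measure_empty sets.empty_sets simp_thms)
    then show ?thesis
      using False by (simp only: weight_not_in simp_thms)
  qed
  moreover have "measure lborel ((E - F) \<union> (E \<inter> F)) = measure lborel (E - F)"
    by (rule measure_Un_null_set) (use calculation null in auto)
  moreover have "(E - F) \<union> (E \<inter> F) = E"
    by blast
  ultimately show ?thesis
    by (simp add: E_def)
qed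

lemma point_of_eq:
  assumes "represents_with V \<phi> p n c t"
  shows "point_of V \<phi> = p"
  unfolding point_of_def
proof (rule the_equality)
  show "represents V \<phi> p"
    using assms represents_iff by blast
next
  fix q assume "represents V \<phi> q"
  then obtain m d s where q: "represents_with V \<phi> q m d s"
    using represents_iff by blast
  have "weight c t = weight d s"
    using represents_measure[OF assms] represents_measure[OF q] by (simp add: fun_eq_iff)
  moreover note C = has_stepsD[of V p n c t] and D = has_stepsD[of V q m d s]
  ultimately show "q = p"
    using assms q ST_geo_pt_cong[of c V n t d m s] C(1,3,5) D(1,3,5) by (simp add: represents_with_def)
qed

text \<open>\<open>step_fun\<close> is an arbitrary choice, so a representing function has to be
  exhibited; uniqueness of the strict chain then shows that the chosen function has the same
  steps.\<close>

lemma represents_step_fun: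
  assumes h: "has_steps V p n c t"
  shows "represents_with V (step_fun V p) p n c t"
proof -
  note C = has_stepsD[OF h]
  \<comment> \<open>The number of steps completed at \<open>x\<close> is the index of the current
    step.\<close>
  define \<phi> where "\<phi> = (\<lambda>x. c ! card {j. j \<le> n \<and> (\<Sum>l\<le>j. t l) \<le> x})"
  have "\<phi> x = c ! k" if "k \<le> n" "(\<Sum>l<k. t l) < x" "x < (\<Sum>l\<le>k. t l)" for k x
  proof -
    have "(\<Sum>l\<le>j. t l) \<le> x \<longleftrightarrow> j < k" if "j \<le> n" for j
    proof
      assume "j < k"
      then show "(\<Sum>l\<le>j. t l) \<le> x"
        using partial_sum_mono[of t "Suc j" k] simplex_nonneg[OF C(3)] \<open>(\<Sum>l<k. t l) < x\<close>
        by (simp add: lessThan_Suc_atMost)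
    next
      assume "(\<Sum>l\<le>j. t l) \<le> x"
      then have "(\<Sum>l<Suc j. t l) < (\<Sum>l<Suc k. t l)"
        using \<open>x < (\<Sum>l\<le>k. t l)\<close> by (simp only: lessThan_Suc_atMost)
      then have "\<not> Suc k \<le> Suc j"
        using partial_sum_mono[of t "Suc k" "Suc j"] simplex_nonneg[OF C(3)] by fastforce
      then show "j < k"
        by simp
    qed
    then have "{j. j \<le> n \<and> (\<Sum>l\<le>j. t l) \<le> x} = {..<k}"
      using \<open>k \<le> n\<close> by auto
    then show ?thesis
      by (simp add: \<phi>_def)
  qed
  then have "{x. (\<Sum>l<k. t l) < x \<and> x < (\<Sum>l\<le>k. t l) \<and> \<phi> x \<noteq> c ! k} = {}" if "k \<le> n" for k
    using that by blast
  then have "finite {x. (\<Sum>l<k. t l) < x \<and> x < (\<Sum>l\<le>k. t l) \<and> \<phi> x \<noteq> c ! k}" if "k \<le> n" for k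
    using that by (metis (mono_tags, lifting) finite.emptyI)
  then have "represents_with V \<phi> p n c t"
    using h by (simp add: represents_with_def)
  then have "represents V \<phi> p"
    using represents_iff by blast
  then have "represents V (step_fun V p) p"
    unfolding step_fun_def by (rule someI[of "\<lambda>\<phi>. represents V \<phi> p"])
  then obtain m d s where "represents_with V (step_fun V p) p m d s"
    using represents_iff by blast
  moreover from this have "n = m" "c = d" "t = s"
    using has_steps_unique[OF h] by (auto simp: represents_with_def)
  ultimately show ?thesis
    by simp
qed

text \<open>Deleting the finite set of exceptional points from an open step leaves an open set. The
  point at which the germ is taken is put back, which punctured and one-sided neighbourhoods
  ignore.\<close>

lemma represents_germs:
  assumes r: "represents_with V \<phi> p n c t" and k: "k \<le> n"
  shows "(\<Sum>l<k. t l) < x \<Longrightarrow> x < (\<Sum>l\<le>k. t l) \<Longrightarrow> \<forall>\<^sub>F y in at x. \<phi> y = c ! k"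
    and "\<forall>\<^sub>F y in at_right (\<Sum>l<k. t l). \<phi> y = c ! k"
    and "\<forall>\<^sub>F y in at_left (\<Sum>l\<le>k. t l). \<phi> y = c ! k"
proof -
  let ?a = "\<Sum>l<k. t l" and ?b = "\<Sum>l\<le>k. t l"
  define F where "F = {x. ?a < x \<and> x < ?b \<and> \<phi> x \<noteq> c ! k}"
  have fin: "finite F"
    using r k by (simp add: represents_with_def F_def)
  have op: "open (- (F - {x}))" for x
    using fin by (intro open_Compl finite_imp_closed) simp
  have ab: "?a < ?b"
    using has_stepsD(4)[of V p n c t k] r k by (simp add: represents_with_def lessThan_Suc_atMost[symmetric])
  show "\<forall>\<^sub>F y in at x. \<phi> y = c ! k" if "?a < x" "x < ?b"
    unfolding eventually_at_topological
    by (rule exI[of _ "{?a<..<?b} \<inter> - (F - {x})"], intro conjI open_Int op open_greaterThanLessThan)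
      (use that in \<open>auto simp: F_def\<close>)
  show "\<forall>\<^sub>F y in at_right ?a. \<phi> y = c ! k"
    unfolding eventually_at_topological
    by (rule exI[of _ "{..<?b} \<inter> - (F - {?a})"], intro conjI open_Int op open_lessThan)
      (use ab in \<open>auto simp: F_def\<close>)
  show "\<forall>\<^sub>F y in at_left ?b. \<phi> y = c ! k"
    unfolding eventually_at_topological
    by (rule exI[of _ "{?a<..} \<inter> - (F - {?b})"], intro conjI open_Int op open_greaterThan)
      (use ab in \<open>auto simp: F_def\<close>)
qed

lemma represents_ends:
  assumes r: "represents_with V \<phi> p n c t"
  shows "begins_with \<phi> {0}" "ends_with \<phi> V"
proof -
  have h: "has_steps V p n c t"
    using r by (simp add: represents_with_def)
  show "begins_with \<phi> {0}"
    using represents_germs(2)[OF r, of 0] has_steps_ends(1)[OF h] by (simp add: begins_with_def)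
  show "ends_with \<phi> V"
    using represents_germs(3)[OF r, of n] has_steps_ends(2)[OF h] simplex_sum[OF has_stepsD(3)[OF h]]
    by (simp add: ends_with_def)
qed

lemma step_value_eq:
  fixes x :: real
  assumes "\<forall>\<^sub>F y in at x. \<phi> y = W"
  shows "step_value \<phi> x = W" "\<not> cut_point \<phi> x"
proof -
  show "\<not> cut_point \<phi> x"
    using assms by (auto simp: cut_point_def)
  show "step_value \<phi> x = W"
    unfolding step_value_def
  proof (rule the_equality)
    show "\<forall>\<^sub>F y in at x. \<phi> y = W"
      by (rule assms)
  next
    fix W' assume "\<forall>\<^sub>F y in at x. \<phi> y = W'"
    then have "\<forall>\<^sub>F y in at x. W' = W"
      using assms by eventually_elim simp
    then show "W' = W"
      by simp
  qed
qed

lemma cut_point_jump: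
  fixes x :: real
  assumes "0 < x" "x < 1" "\<forall>\<^sub>F y in at_left x. \<phi> y = A" "\<forall>\<^sub>F y in at_right x. \<phi> y = B" "A \<noteq> B"
  shows "cut_point \<phi> x"
  unfolding cut_point_def
proof (intro conjI notI assms)
  assume "\<exists>W. \<forall>\<^sub>F y in at x. \<phi> y = W"
  then obtain W where W: "\<forall>\<^sub>F y in at_left x. \<phi> y = W" "\<forall>\<^sub>F y in at_right x. \<phi> y = W"
    by (auto simp: eventually_at_split)
  have "\<forall>\<^sub>F y in at_left x. W = A"
    using W(1) assms(3) by eventually_elim simp
  moreover have "\<forall>\<^sub>F y in at_right x. W = B"
    using W(2) assms(4) by eventually_elim simp
  ultimately show False
    using assms(5) by simp
qed

section \<open>Splitting step functions\<close>

lemma finite_affine_preimage: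
  fixes a b :: real
  assumes "finite {y. P y}" "a \<noteq> 0"
  shows "finite {x. P (a * x + b)}"
proof -
  have "finite ((\<lambda>x. a * x + b) -` {y. P y})"
    using assms by (intro finite_vimageI) (auto simp: inj_on_def)
  then show ?thesis
    by (simp add: vimage_def)
qed

lemma has_steps_strict:
  assumes "has_steps V p n c t" "j < k" "k \<le> n"
  shows "c ! j \<subset> c ! k" "dim (c ! j) < dim (c ! k)"
proof -
  note C = has_stepsD[OF assms(1)]
  show sub: "c ! j \<subset> c ! k"
    using sorted_wrt_nth_less[OF C(2), of j k] assms C(6) by simp
  have "c ! j \<in> subs V" "c ! k \<in> subs V"
    using C(6,7) assms by (auto simp: subset_iff)
  then have "subspace (c ! j)" "subspace (c ! k)"
    by (auto simp: subs_def)
  then show "dim (c ! j) < dim (c ! k)"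
    using dim_subset[of "c ! j" "c ! k"] subspace_eq_of_dim_eq[of "c ! j" "c ! k"] sub by (metis order_le_less psubset_eq)
qed

context
  fixes V :: "'a::euclidean_space set" and i :: nat
  assumes V: "subspace V" and i: "0 < i" "i < dim V"
begin

context
  fixes p n c t k \<phi> and s :: real
  assumes r: "represents_with V \<phi> p n c t" and k: "k \<le> n" "dim (c ! k) = i"
    and s: "s = (\<Sum>l<k. t l) + t k / 2"
begin

lemma represents_has_steps: "has_steps V p n c t"
  using r by (simp add: represents_with_def)

lemma step_length_pos: "l \<le> n \<Longrightarrow> 0 < t l" and step_length_nonneg: "0 \<le> t l"
  using has_stepsD(4)[OF represents_has_steps] simplex_nonneg[OF has_stepsD(3)[OF represents_has_steps]] by auto

lemma split_value_subspace: "c ! k \<in> subs V" "c ! k \<noteq> V" "c ! k \<noteq> {0}" "c ! k \<in> set c"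
proof -
  show "c ! k \<in> set c"
    using has_stepsD(6)[OF represents_has_steps] k(1) by (intro nth_mem) simp
  then show "c ! k \<in> subs V" "c ! k \<noteq> V" "c ! k \<noteq> {0}"
    using has_stepsD(7)[OF represents_has_steps] k(2) i by auto
qed

lemma split_cell: "c \<in> cells (split_sset V (c ! k)) n"
  using has_stepsD(1)[OF represents_has_steps] split_value_subspace(4) by (auto simp: split_sset_def ST_sset_chain cells_chain_sset)

lemma strict_split:
  shows "low_part (c ! k) c = take (Suc k) c" "dropWhile (\<lambda>X. X \<subseteq> c ! k) c = drop (Suc k) c"
    "low_mass (c ! k) c t = s" "high_mass (c ! k) c t = 1 - s"
    "low_coords (c ! k) c t l = (if l < k then t l else if l = k then t k / 2 else 0)"
    "high_coords (c ! k) c t l = (if l = 0 then t k / 2 else t (k + l))"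
proof -
  have "\<forall>l<k. c ! l \<subset> c ! k" "\<forall>l\<in>{k<..n}. \<not> c ! l \<subseteq> c ! k"
    using has_steps_strict(1)[OF represents_has_steps] k(1) by fastforce+
  note F = split_formulas[OF has_stepsD(6)[OF represents_has_steps] k(1) refl this]
  show "low_part (c ! k) c = take (Suc k) c" "dropWhile (\<lambda>X. X \<subseteq> c ! k) c = drop (Suc k) c"
    "low_mass (c ! k) c t = s"
    "low_coords (c ! k) c t l = (if l < k then t l else if l = k then t k / 2 else 0)"
    "high_coords (c ! k) c t l = (if l = 0 then t k / 2 else t (k + l))"
    using F by (simp_all add: s)
  then show "high_mass (c ! k) c t = 1 - s"
    using low_high_mass[OF has_stepsD(3,6)[OF represents_has_steps], of "c ! k"] by simp
qed

lemma split_time_between: "(\<Sum>l<k. t l) < s" "s < (\<Sum>l\<le>k. t l)" "0 < s" "s < 1"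
proof -
  show a: "(\<Sum>l<k. t l) < s" and b: "s < (\<Sum>l\<le>k. t l)"
    using step_length_pos[OF k(1)] by (auto simp: s lessThan_Suc_atMost[symmetric])
  have "0 \<le> (\<Sum>l<k. t l)"
    using step_length_nonneg by (simp add: sum_nonneg)
  then show "0 < s"
    using a by simp
  have "(\<Sum>l\<le>k. t l) \<le> 1"
    using partial_sum_le_one[OF has_stepsD(3)[OF represents_has_steps], of "Suc k"] k(1) by (simp add: lessThan_Suc_atMost)
  then show "s < 1"
    using b by simp
qed

text \<open>Rescaling by 1/s carries what happens before time \<open>s\<close> to the whole unit
  interval. Step \<open>k\<close> is cut at its midpoint and keeps half of its length, as in the
  lower coordinates of \<open>h\<close>.\<close>

lemma represents_low:
  "represents_with (c ! k) (\<phi> \<circ> (\<lambda>y. s * y))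
    (geo_pt (ST_sset (c ! k)) k (Some (low_part (c ! k) c)) (\<lambda>l. low_coords (c ! k) c t l / low_mass (c ! k) c t))
    k (low_part (c ! k) c) (\<lambda>l. low_coords (c ! k) c t l / low_mass (c ! k) c t)"
  unfolding represents_with_def has_steps_def
proof (intro conjI allI impI)
  let ?U = "c ! k" and ?a = "\<lambda>l. low_coords (c ! k) c t l / low_mass (c ! k) c t"
  have len: "length (low_part ?U c) = Suc k"
    using has_stepsD(6)[OF represents_has_steps] k(1) by (simp add: strict_split(1))
  show "low_part ?U c \<in> cells (ST_sset ?U) k"
    using split_chain_cells(1)[OF split_value_subspace(1,2) split_cell] len by (metis diff_Suc_1)
  show "sorted_wrt (\<subset>) (low_part ?U c)"
    unfolding strict_split(1) by (rule sorted_wrt_take[OF has_stepsD(2)[OF represents_has_steps]])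
  show "?a \<in> standard_simplex k"
    using low_coords_simplex[OF split_value_subspace(1,2) split_cell has_stepsD(3)[OF represents_has_steps]] split_time_between(3) len by (simp add: strict_split(3))
  show "0 < ?a l" if "l \<le> k" for l
    using that split_time_between(3) step_length_pos[of l] step_length_pos[of k] k(1) by (simp add: strict_split)
next
  fix j assume j: "j \<le> k"
  let ?U = "c ! k" and ?a = "\<lambda>l. low_coords (c ! k) c t l / low_mass (c ! k) c t"
  have sum1: "(\<Sum>l<j. ?a l) = (\<Sum>l<j. t l) / s"
    unfolding sum_divide_distrib using j by (intro sum.cong) (auto simp: strict_split)
  \<comment> \<open>An inequality is enough: for \<open>j = k\<close> the rescaled old step reaches
    beyond 1, but the new step only has to lie inside it.\<close>
  have "(\<Sum>l\<le>j. ?a l) \<le> (\<Sum>l\<le>j. t l / s)"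
  proof (rule sum_mono)
    fix l assume "l \<in> {..j}"
    have "low_coords ?U c t l \<le> t l"
      using step_length_nonneg[of l] by (auto simp: strict_split)
    then show "?a l \<le> t l / s"
      using split_time_between(3) by (simp add: strict_split(3) divide_right_mono)
  qed
  then have sum2: "(\<Sum>l\<le>j. ?a l) \<le> (\<Sum>l\<le>j. t l) / s"
    by (simp add: sum_divide_distrib)
  have nth: "low_part ?U c ! j = c ! j"
    using j by (simp add: strict_split(1))
  have "finite {x. (\<Sum>l<j. t l) < s * x + 0 \<and> s * x + 0 < (\<Sum>l\<le>j. t l) \<and> \<phi> (s * x + 0) \<noteq> c ! j}"
    by (rule finite_affine_preimage) (use r j k(1) split_time_between(3) in \<open>auto simp: represents_with_def\<close>)
  then show "finite {x. (\<Sum>l<j. ?a l) < x \<and> x < (\<Sum>l\<le>j. ?a l) \<and> (\<phi> \<circ> (\<lambda>y. s * y)) x \<noteq> low_part ?U c ! j}"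
  proof (rule rev_finite_subset, intro Collect_mono impI)
    fix x assume x: "(\<Sum>l<j. ?a l) < x \<and> x < (\<Sum>l\<le>j. ?a l) \<and> (\<phi> \<circ> (\<lambda>y. s * y)) x \<noteq> low_part ?U c ! j"
    then have "x < (\<Sum>l\<le>j. t l) / s" "(\<Sum>l<j. t l) / s < x"
      using sum1 sum2 by auto
    then have "s * x < (\<Sum>l\<le>j. t l)" "(\<Sum>l<j. t l) < s * x"
      using split_time_between(3) by (simp_all add: field_simps)
    then show "(\<Sum>l<j. t l) < s * x + 0 \<and> s * x + 0 < (\<Sum>l\<le>j. t l) \<and> \<phi> (s * x + 0) \<noteq> c ! j"
      using x nth by simp
  qed
qed (rule refl)

text \<open>The first upper step is what remains of step \<open>k\<close> after its midpoint
  \<open>s\<close>, so partial sums measure the time elapsed since \<open>s\<close>.\<close>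

lemma high_partial_sum: "j \<le> n - k \<Longrightarrow> (\<Sum>l\<le>j. high_coords (c ! k) c t l) = (\<Sum>l\<le>k + j. t l) - s"
  by (induction j) (simp_all add: strict_split(6) s lessThan_Suc_atMost[symmetric])

lemma represents_high:
  "represents_with (V \<ominus>\<^sub>\<bottom> c ! k) (\<lambda>y. \<phi> ((1 - s) * y + s) \<ominus>\<^sub>\<bottom> c ! k)
    (geo_pt (ST_sset (V \<ominus>\<^sub>\<bottom> c ! k)) (n - k) (Some (high_part (c ! k) c)) (\<lambda>l. high_coords (c ! k) c t l / high_mass (c ! k) c t))
    (n - k) (high_part (c ! k) c) (\<lambda>l. high_coords (c ! k) c t l / high_mass (c ! k) c t)"
  unfolding represents_with_def has_steps_def
proof (intro conjI allI impI)
  let ?U = "c ! k" and ?b = "\<lambda>l. high_coords (c ! k) c t l / high_mass (c ! k) c t"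
  have len: "Suc n - length (low_part ?U c) = n - k"
    using has_stepsD(6)[OF represents_has_steps] k(1) by (simp add: strict_split(1))
  show "high_part ?U c \<in> cells (ST_sset (V \<ominus>\<^sub>\<bottom> ?U)) (n - k)"
    using split_chain_cells(2)[OF split_value_subspace(1,2) split_cell] len by metis
  show "?b \<in> standard_simplex (n - k)"
    using high_coords_simplex[OF split_value_subspace(1,2) split_cell has_stepsD(3)[OF represents_has_steps]] split_time_between(4) len by (simp add: strict_split(4))
  show "0 < ?b l" if "l \<le> n - k" for l
    using that split_time_between(4) step_length_pos[of "k + l"] step_length_pos[of k] k(1) by (simp add: strict_split)
  have "sorted_wrt (\<subset>) (drop k c)"
    by (rule sorted_wrt_drop[OF has_stepsD(2)[OF represents_has_steps]])
  \<comment> \<open>The extra vertex \<open>{0}\<close> is the complement of \<open>U\<close> in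
    itself, so the upper chain consists of the complements of all members from index
    \<open>k\<close> on.\<close>
  have high: "high_part ?U c = map (\<lambda>W. W \<ominus>\<^sub>\<bottom> ?U) (drop k c)"
  proof -
    have "drop k c = c ! k # drop (Suc k) c"
      using has_stepsD(6)[OF represents_has_steps] k(1) by (simp add: Cons_nth_drop_Suc)
    moreover have "?U \<ominus>\<^sub>\<bottom> ?U = {0}"
      using split_value_subspace(1) by (intro ominus_self) (simp add: subs_def)
    ultimately show ?thesis
      by (simp add: high_part_def strict_split(2))
  qed
  show "sorted_wrt (\<subset>) (high_part ?U c)"
    unfolding sorted_wrt_iff_nth_less
  proof (intro allI impI)
    fix a b assume ab: "a < b" "b < length (high_part ?U c)"
    then have b: "k + b \<le> n"
      using has_stepsD(6)[OF represents_has_steps] by (simp add: high)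
    have in_c: "c ! (k + l) \<in> set c" if "l \<le> b" for l
      using has_stepsD(6)[OF represents_has_steps] b that by (intro nth_mem) simp
    have sub: "subspace (c ! (k + l))" "?U \<subseteq> c ! (k + l)" if "l \<le> b" for l
      using in_c[OF that] has_stepsD(7)[OF represents_has_steps] has_steps_strict(1)[OF represents_has_steps, of k "k + l"] b that
      by (auto simp: subs_def intro: le_neq_implies_less) (cases "l = 0"; auto)+
    have "c ! (k + a) \<subset> c ! (k + b)"
      using has_steps_strict(1)[OF represents_has_steps, of "k + a" "k + b"] ab b by simp
    \<comment> \<open>Members above \<open>U\<close> are determined by their complements: adding
      \<open>U\<close> recovers the member.\<close>
    moreover have "c ! (k + a) \<ominus>\<^sub>\<bottom> ?U \<noteq> c ! (k + b) \<ominus>\<^sub>\<bottom> ?U"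
    proof
      assume eq: "c ! (k + a) \<ominus>\<^sub>\<bottom> ?U = c ! (k + b) \<ominus>\<^sub>\<bottom> ?U"
      have e: "subspace_sum ?U (c ! (k + l) \<ominus>\<^sub>\<bottom> ?U) = c ! (k + l)" if "l \<le> b" for l
        by (rule subspace_sum_ominus[OF _ sub[OF that]]) (use split_value_subspace(1) in \<open>simp add: subs_def\<close>)
      have "c ! (k + a) = c ! (k + b)"
        using arg_cong[OF eq, of "subspace_sum ?U"] e[of a] e[of b] ab(1) by simp
      then show False
        using \<open>c ! (k + a) \<subset> c ! (k + b)\<close> by simp
    qed
    ultimately show "high_part ?U c ! a \<subset> high_part ?U c ! b"
      using ominus_mono[of "c ! (k + a)" "c ! (k + b)" ?U] ab b has_stepsD(6)[OF represents_has_steps] by (auto simp: high)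
  qed
  fix j assume j: "j \<le> n - k"
  have pos: "0 < 1 - s"
    using split_time_between(4) by simp
  have sum2: "(\<Sum>l\<le>j. ?b l) = ((\<Sum>l\<le>k + j. t l) - s) / (1 - s)"
    using high_partial_sum[OF j] by (simp add: sum_divide_distrib[symmetric] strict_split(4))
  \<comment> \<open>For \<open>j = 0\<close> the new step begins in the middle of step
    \<open>k\<close>, and the bound comes from \<open>s\<close> lying after the start of that step;
    later steps begin at old break points.\<close>
  have sum1: "(\<Sum>l<k + j. t l) < (1 - s) * x + s" if "(\<Sum>l<j. ?b l) < x" for x
  proof (cases j)
    case 0
    then have "0 < (1 - s) * x"
      using that pos by simp
    then show ?thesis
      using split_time_between(1) 0 by simp
  next
    case (Suc j')
    have "(\<Sum>l<j. ?b l) = ((\<Sum>l\<le>k + j'. t l) - s) / (1 - s)"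
      using high_partial_sum[of j'] j Suc by (simp add: sum_divide_distrib[symmetric] strict_split(4) lessThan_Suc_atMost)
    then have "(\<Sum>l\<le>k + j'. t l) - s < x * (1 - s)"
      using that by (simp add: pos_divide_less_eq[OF pos])
    then show ?thesis
      by (simp add: Suc lessThan_Suc_atMost mult.commute)
  qed
  have nth: "high_part ?U c ! j = c ! (k + j) \<ominus>\<^sub>\<bottom> ?U"
    using j k(1) has_stepsD(6)[OF represents_has_steps] nth_drop[of k c j] by (simp add: high)
  have "finite {x. (\<Sum>l<k + j. t l) < (1 - s) * x + s \<and> (1 - s) * x + s < (\<Sum>l\<le>k + j. t l) \<and> \<phi> ((1 - s) * x + s) \<noteq> c ! (k + j)}"
    by (rule finite_affine_preimage) (use r j k(1) pos in \<open>auto simp: represents_with_def\<close>)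
  then show "finite {x. (\<Sum>l<j. ?b l) < x \<and> x < (\<Sum>l\<le>j. ?b l) \<and> \<phi> ((1 - s) * x + s) \<ominus>\<^sub>\<bottom> ?U \<noteq> high_part ?U c ! j}"
  proof (rule rev_finite_subset, intro Collect_mono impI)
    fix x assume x: "(\<Sum>l<j. ?b l) < x \<and> x < (\<Sum>l\<le>j. ?b l) \<and> \<phi> ((1 - s) * x + s) \<ominus>\<^sub>\<bottom> ?U \<noteq> high_part ?U c ! j"
    have "x * (1 - s) < (\<Sum>l\<le>k + j. t l) - s"
      using x unfolding sum2 by (simp add: pos_less_divide_eq[OF pos])
    then have "(1 - s) * x + s < (\<Sum>l\<le>k + j. t l)"
      by (simp add: mult.commute)
    then show "(\<Sum>l<k + j. t l) < (1 - s) * x + s \<and> (1 - s) * x + s < (\<Sum>l\<le>k + j. t l) \<and>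
        \<phi> ((1 - s) * x + s) \<noteq> c ! (k + j)"
      using x sum1 nth by auto
  qed
qed (rule refl)

text \<open>The step lengths of the two rescaled halves are the normalized coordinates used by
  \<open>h\<close>, since the denominators are the lengths \<open>s\<close> and \<open>1 - s\<close>
  of the two intervals.\<close>

lemma h_simplex_point_of:
  "h_simplex V (c ! k) n (Some c) t = smash_in (SigmaST (c ! k)) (SigmaST (V \<ominus>\<^sub>\<bottom> c ! k))
    (point_of (c ! k) (\<phi> \<circ> (\<lambda>y. s * y))) (point_of (V \<ominus>\<^sub>\<bottom> c ! k) (\<lambda>y. \<phi> ((1 - s) * y + s) \<ominus>\<^sub>\<bottom> c ! k))"
proof -
  have "length (low_part (c ! k) c) = Suc k"
    using has_stepsD(6)[OF represents_has_steps] k(1) by (simp add: strict_split(1))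
  then show ?thesis
    using split_time_between(3,4) unfolding point_of_eq[OF represents_low] point_of_eq[OF represents_high]
    by (simp add: h_simplex_def strict_split(3,4))
qed

end

section \<open>The coproduct at a splitting time\<close>

lemma theta2_split:
  assumes h: "has_steps V p n c t" and k: "k \<le> n" "dim (c ! k) = i"
    and s: "s = (\<Sum>l<k. t l) + t k / 2"
  shows "theta2 V (Some (Some (\<lambda>y. s * y, \<lambda>y. (1 - s) * y + s), p)) =
    wedge_in (ST_smash V) (c ! k) (h_simplex V (c ! k) n (Some c) t)"
proof -
  let ?\<phi> = "step_fun V p"
  note r = represents_step_fun[OF h]
  note b = split_time_between[OF r k s]
  have ev: "\<forall>\<^sub>F y in at s. ?\<phi> y = c ! k"
    by (rule represents_germs(1)[OF r k(1) b(1,2)])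
  note E1 = represents_ends[OF represents_low[OF r k s]]
  note E2 = represents_ends[OF represents_high[OF r k s]]
  \<comment> \<open>The second embedding ends at the endpoint 1, and cut points are
    interior.\<close>
  have "\<not> cut_point ?\<phi> 1"
    by (simp add: cut_point_def)
  then show ?thesis
    using b(4) step_value_eq[OF ev] E1 E2 h_simplex_point_of[OF r k s]
    by (simp add: theta2_def Let_def)
qed

text \<open>The one-sided germs at \<open>s\<close> are consecutive members of a strict chain, hence
  different, so \<open>s\<close> is a cut point and the coproduct takes the base value.\<close>

lemma theta2_jump:
  assumes h: "has_steps V p n c t" and k: "k < n" and s: "s = (\<Sum>l\<le>k. t l)"
  shows "theta2 V (Some (Some (\<lambda>y. s * y, \<lambda>y. (1 - s) * y + s), p)) = None" "0 < s" "s < 1"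
proof -
  let ?\<phi> = "step_fun V p"
  note C = has_stepsD[OF h]
  note r = represents_step_fun[OF h]
  have nn: "\<And>l. 0 \<le> t l"
    using simplex_nonneg[OF C(3)] .
  have "(\<Sum>l<k. t l) \<ge> 0" "0 < t k" "0 < t (Suc k)"
    using nn C(4) k by (auto simp: sum_nonneg)
  moreover have "(\<Sum>l<Suc (Suc k). t l) \<le> 1"
    by (rule partial_sum_le_one[OF C(3)]) (use k in simp)
  ultimately show s01: "0 < s" "s < 1"
    by (auto simp: s lessThan_Suc_atMost[symmetric])
  have "\<forall>\<^sub>F y in at_left s. ?\<phi> y = c ! k"
    unfolding s by (rule represents_germs(3)[OF r]) (use k in simp)
  moreover have "\<forall>\<^sub>F y in at_right s. ?\<phi> y = c ! Suc k"
    using represents_germs(2)[OF r, of "Suc k"] k by (simp add: s lessThan_Suc_atMost)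
  moreover have "c ! k \<noteq> c ! Suc k"
    using has_steps_strict(1)[OF h, of k "Suc k"] k by auto
  ultimately have "cut_point ?\<phi> s"
    using cut_point_jump[OF s01] by blast
  then show "theta2 V (Some (Some (\<lambda>y. s * y, \<lambda>y. (1 - s) * y + s), p)) = None"
    using s01 by (simp add: theta2_def Let_def)
qed

section \<open>Existence and uniqueness of the splitting time\<close>

text \<open>Makes both intervals nondegenerate, so that the pair of embeddings exists.\<close>

lemma split_time_bounds:
  assumes "split_time V i p s"
  shows "0 < s" "s < 1"
proof -
  obtain n c t where h: "has_steps V p n c t" and
    "(\<exists>k\<le>n. dim (c ! k) = i \<and> s = (\<Sum>l<k. t l) + t k / 2) \<or>
         (\<forall>k\<le>n. dim (c ! k) \<noteq> i) \<and>
         (\<exists>k<n. dim (c ! k) < i \<and> i < dim (c ! Suc k) \<and> s = (\<Sum>l\<le>k. t l))"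
    using assms unfolding split_time_def by blast
  then consider k where "k \<le> n" "dim (c ! k) = i" "s = (\<Sum>l<k. t l) + t k / 2"
    | k where "k < n" "s = (\<Sum>l\<le>k. t l)"
    by blast
  then have "0 < s \<and> s < 1"
  proof cases
    case 1
    then show ?thesis
      using split_time_between(3,4)[OF represents_step_fun[OF h] 1] by simp
  next
    case 2
    then show ?thesis
      using theta2_jump(2,3)[OF h 2] by simp
  qed
  then show "0 < s" "s < 1"
    by auto
qed

text \<open>Dimensions increase strictly along the chain, so there is at most one step of dimension
  \<open>i\<close> and at most one jump across it.\<close>

lemma split_time_unique:
  assumes "split_time V i p s" "split_time V i p s'"
  shows "s = s'"
proof -
  obtain n c t where h: "has_steps V p n c t" and 1:
    "(\<exists>k\<le>n. dim (c ! k) = i \<and> s = (\<Sum>l<k. t l) + t k / 2) \<or>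
         (\<forall>k\<le>n. dim (c ! k) \<noteq> i) \<and>
         (\<exists>k<n. dim (c ! k) < i \<and> i < dim (c ! Suc k) \<and> s = (\<Sum>l\<le>k. t l))"
    using assms(1) unfolding split_time_def by blast
  have 2: "(\<exists>k\<le>n. dim (c ! k) = i \<and> s' = (\<Sum>l<k. t l) + t k / 2) \<or>
         (\<forall>k\<le>n. dim (c ! k) \<noteq> i) \<and>
         (\<exists>k<n. dim (c ! k) < i \<and> i < dim (c ! Suc k) \<and> s' = (\<Sum>l\<le>k. t l))"
    using assms(2) has_steps_unique[OF h] unfolding split_time_def by blast
  have lt: "dim (c ! j) < dim (c ! k)" if "j < k" "k \<le> n" for j k
    using has_steps_strict(2)[OF h that] .
  show ?thesis
  proof (cases "\<exists>k\<le>n. dim (c ! k) = i")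
    case True
    then obtain k k' where "k \<le> n" "dim (c ! k) = i" "s = (\<Sum>l<k. t l) + t k / 2"
      "k' \<le> n" "dim (c ! k') = i" "s' = (\<Sum>l<k'. t l) + t k' / 2"
      using 1 2 by blast
    moreover from this have "k = k'"
      using lt[of k k'] lt[of k' k] by (cases k k' rule: linorder_cases) auto
    ultimately show ?thesis
      by simp
  next
    case False
    then obtain k k' where kk: "k < n" "dim (c ! k) < i" "i < dim (c ! Suc k)" "s = (\<Sum>l\<le>k. t l)"
      "k' < n" "dim (c ! k') < i" "i < dim (c ! Suc k')" "s' = (\<Sum>l\<le>k'. t l)"
      using 1 2 by blast
    \<comment> \<open>If \<open>k < k'\<close>, then the dimension at \<open>k'\<close> is at least
      the one at \<open>Suc k\<close>, which exceeds \<open>i\<close>, contrary to the choice of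
      \<open>k'\<close>; the other case is symmetric.\<close>
    have "\<not> k < k'" "\<not> k' < k"
      using lt[of "Suc k" k'] lt[of "Suc k'" k] kk by (metis Suc_lessI less_imp_le less_asym less_trans)+
    then show ?thesis
      using kk by simp
  qed
qed

text \<open>Dimensions run from 0 at \<open>{0}\<close> to \<open>dim V\<close>, which exceeds
  \<open>i\<close>, so they either attain \<open>i\<close> or jump across it.\<close>

lemma split_time_exists:
  assumes h: "has_steps V p n c t"
  obtains s where "split_time V i p s"
proof (cases "\<exists>k\<le>n. dim (c ! k) = i")
  case True
  then obtain k where "k \<le> n" "dim (c ! k) = i"
    by blast
  then show ?thesis
    using that[of "(\<Sum>l<k. t l) + t k / 2"] h unfolding split_time_def by blast
next
  case False
  have "dim (c ! 0) < i" "i < dim (c ! n)"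
    using has_steps_ends[OF h] i by simp_all
  then obtain k where "k < n" "dim (c ! k) < i" "\<not> dim (c ! Suc k) < i"
  proof -
    have "\<exists>k<n. dim (c ! k) < i \<and> \<not> dim (c ! Suc k) < i"
    proof (rule ccontr)
      assume neg: "\<not> ?thesis"
      have "k \<le> n \<Longrightarrow> dim (c ! k) < i" for k
        by (induction k) (use neg \<open>dim (c ! 0) < i\<close> in auto)
      then show False
        using \<open>i < dim (c ! n)\<close> by fastforce
    qed
    then show ?thesis
      using that by blast
  qed
  moreover from this have "i < dim (c ! Suc k)"
    using False by (metis Suc_leI linorder_neqE_nat)
  ultimately show ?thesis
    using that[of "\<Sum>l\<le>k. t l"] h False unfolding split_time_def by blast
qed

text \<open>A point off the basepoint has exactly one splitting time, which in turn determines the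
  pair of embeddings; the basepoint corresponds to \<open>None\<close>.\<close>

lemma bij_betw_forget:
  "bij_betw (forget V) (topspace (space_of (SigmaST_i V i))) (topspace (space_of (SigmaST V)))"
  unfolding bij_betw_def
proof
  have nb: "p \<noteq> base_of (SigmaST V)" if "split_time V i p s" for p s
    using that has_steps_nonbase unfolding split_time_def by blast
  show "inj_on (forget V) (topspace (space_of (SigmaST_i V i)))"
  proof (rule inj_onI)
    fix z z' assume z: "z \<in> topspace (space_of (SigmaST_i V i))" "z' \<in> topspace (space_of (SigmaST_i V i))"
      and eq: "forget V z = forget V z'"
    show "z = z'"
    proof (cases rule: SigmaST_i_cases[OF z(1)])
      case 1
      then show ?thesis
        using eq nb by (cases rule: SigmaST_i_cases[OF z(2)]) (auto simp: forget_def)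
    next
      case (2 p s)
      show ?thesis
      proof (cases rule: SigmaST_i_cases[OF z(2)])
        case 1
        then show ?thesis
          using eq nb 2 by (auto simp: forget_def)
      next
        case (2 p' s')
        then show ?thesis
          using eq \<open>z = Some (p, _)\<close> \<open>split_time V i p s\<close> split_time_unique[of p s s'] by (simp add: forget_def)
      qed
    qed
  qed
  show "forget V ` topspace (space_of (SigmaST_i V i)) = topspace (space_of (SigmaST V))"
  proof
    show "forget V ` topspace (space_of (SigmaST_i V i)) \<subseteq> topspace (space_of (SigmaST V))"
      by (rule continuous_map_image_subset_topspace[OF continuous_map_forget])
    show "topspace (space_of (SigmaST V)) \<subseteq> forget V ` topspace (space_of (SigmaST_i V i))"
    proof
      fix p assume p: "p \<in> topspace (space_of (SigmaST V))"
      show "p \<in> forget V ` topspace (space_of (SigmaST_i V i))"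
      proof (cases "p = base_of (SigmaST V)")
        case True
        then show ?thesis
          using None_SigmaST_i by (intro image_eqI[of _ _ None]) (simp_all add: forget_def)
      next
        case False
        obtain n c t where "has_steps V p n c t"
          using has_steps_exists[OF p False] .
        then obtain s where s: "split_time V i p s"
          using split_time_exists by blast
        note b = split_time_bounds[OF s]
        note e = split_pair_little_intervals[OF b]
        let ?e = "(\<lambda>y. s * y, \<lambda>y. (1 - s) * y + s)"
        have "smash_in (SigmaST V) D12_plus p (Some ?e) \<in> topspace (space_of (smash (SigmaST V) D12_plus))"
          using p e(1) by (auto simp: topspace_smash topspace_D12_plus)
        then have "Some (p, Some ?e) \<in> topspace (space_of (smash (SigmaST V) D12_plus))"
          using False by (simp add: smash_in_def base_of_D12_plus)
        then have "Some (p, Some ?e) \<in> topspace (space_of (SigmaST_i V i))"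
          using s e unfolding SigmaST_i_def by auto
        then show ?thesis
          by (rule rev_image_eqI) (simp add: forget_def)
      qed
    qed
  qed
qed

section \<open>Commutativity of the square\<close>

text \<open>All maps on this side are evaluated on the strict chain of \<open>p\<close>. The initial
  \<open>{0}\<close> removed on passing to the building is restored by
  \<open>susp_join_chain\<close>, so \<open>h_simplex\<close> sees the original chain and
  weights.\<close>

lemma right_dehn_eq:
  assumes h: "has_steps V p n c t"
  shows "k \<le> n \<Longrightarrow> dim (c ! k) = i \<Longrightarrow> right_map V (Sigma_dehn V i (ST_to_RT V p)) =
      wedge_in (ST_smash V) (c ! k) (h_simplex V (c ! k) n (Some c) t)"
    and "\<forall>k\<le>n. dim (c ! k) \<noteq> i \<Longrightarrow> right_map V (Sigma_dehn V i (ST_to_RT V p)) = None"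
proof -
  note C = has_stepsD[OF h]
  have V0: "V \<noteq> {0}"
    by (rule dim_pos_nonzero[OF i(2)])
  define k0 where "k0 = length (takeWhile (\<lambda>W. W = {0}) c)"
  define c0 where "c0 = dropWhile (\<lambda>W. W = {0}) c"
  have "takeWhile (\<lambda>W. W = {0}) c = replicate k0 {0}"
    unfolding k0_def by (rule replicate_eqI) (auto dest: set_takeWhileD)
  then have c: "c = replicate k0 {0} @ c0"
    unfolding c0_def using takeWhile_dropWhile_id[of "\<lambda>W. W = {0}" c] by simp
  have cell: "(k0, c0) \<in> cells (susp (RT V)) n"
    using psset_iso_in[OF psset_iso_ST_RT[OF V V0], of "Some c" n] C(1) by (simp add: k0_def c0_def)
  have RT: "ST_to_RT V p = geo_pt (susp (RT V)) n (Some (k0, c0)) t"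
    unfolding C(5) by (subst ST_to_RT_geo_pt[OF V V0]) (use C(1,3) in \<open>auto simp: k0_def c0_def\<close>)
  have D: "Sigma_dehn V i (ST_to_RT V p) = dehn_simplex V i n (Some (k0, c0)) t"
    unfolding RT Sigma_dehn_descend
    by (rule descend_geo_pt[OF glue_invariant_dehn[OF V i]]) (use cell C(3) in auto)
  have c0_sub: "set c0 \<subseteq> set c"
    by (subst c) auto
  show "right_map V (Sigma_dehn V i (ST_to_RT V p)) = None" if none: "\<forall>k\<le>n. dim (c ! k) \<noteq> i"
  proof -
    have "dim X \<noteq> i" if X: "X \<in> set c0" for X
    proof -
      obtain l where "l < length c" "X = c ! l"
        using c0_sub X by (metis in_set_conv_nth subsetD)
      then show ?thesis
        using none C(6) by simp
    qed
    then have "dehn_simplex V i n (Some (k0, c0)) t = None"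
      by (rule dehn_simplex_no_dim)
    then show ?thesis
      by (simp add: D right_map_def wedge_map_def)
  qed
  show "right_map V (Sigma_dehn V i (ST_to_RT V p)) =
      wedge_in (ST_smash V) (c ! k) (h_simplex V (c ! k) n (Some c) t)" if k: "k \<le> n" "dim (c ! k) = i"
  proof -
    let ?U = "c ! k"
    note U = split_value_subspace[OF represents_step_fun[OF h] k refl]
    have "?U \<in> set c0"
    proof -
      have "?U \<in> set (replicate k0 {0}) \<union> set c0"
        using U(4) by (metis c set_append)
      then show ?thesis
        using U(3) by auto
    qed
    then obtain z where z: "(k0, z) \<in> cells (susp (RT_join V ?U)) n"
      "susp_join_chain ?U (k0, z) = replicate k0 {0} @ c0"
      "\<And>t. dehn_simplex V i n (Some (k0, c0)) t = wedge_in (Sigma_join V) ?U (geo_pt (susp (RT_join V ?U)) n (Some (k0, z)) t)"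
      using dehn_simplex_dim[OF cell _ k(2) i(2)] by metis
    have "geo_pt (susp (RT_join V ?U)) n (Some (k0, z)) t \<in> topspace (space_of (Sigma_join V ?U))"
      using geo_pt_in_realization z(1) C(3) by (metis Some_simplices)
    then have "h_map V ?U (geo_pt (susp (RT_join V ?U)) n (Some (k0, z)) t) = h_simplex V ?U n (Some c) t"
      using h_map_eq_join_h[OF V U(1-3)] join_h_geo_pt[OF V U(1-3), of "Some (k0, z)" n t] z(1,2) C(3) c by simp
    then show ?thesis
      by (simp add: D z(3) right_map_wedge_in)
  qed
qed

lemma theta2_i_eq:
  assumes z: "z \<in> topspace (space_of (SigmaST_i V i))"
  shows "theta2_i V i z = right_map V (Sigma_dehn V i (left_map V z))"
proof (cases rule: SigmaST_i_cases[OF z])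
  case 1
  have V0: "V \<noteq> {0}"
    by (rule dim_pos_nonzero[OF i(2)])
  have "left_map V None = base_of (realization (susp (RT V)))"
    using ST_to_RT_base[OF V V0] by (simp add: left_map_def forget_def)
  moreover have "Sigma_dehn V i (base_of (realization (susp (RT V)))) = None"
    using pointed_map_Sigma_dehn[OF V i] by (simp add: pointed_map_def wedge_def)
  ultimately show ?thesis
    using z by (simp add: 1 theta2_i_def theta2_def right_map_def wedge_map_def)
next
  case (2 p s)
  obtain n c t where h: "has_steps V p n c t" and
    st: "(\<exists>k\<le>n. dim (c ! k) = i \<and> s = (\<Sum>l<k. t l) + t k / 2) \<or>
         (\<forall>k\<le>n. dim (c ! k) \<noteq> i) \<and>
         (\<exists>k<n. dim (c ! k) < i \<and> i < dim (c ! Suc k) \<and> s = (\<Sum>l\<le>k. t l))"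
    using 2(2) unfolding split_time_def by blast
  have th: "theta2_i V i z = theta2 V (Some (Some (\<lambda>y. s * y, \<lambda>y. (1 - s) * y + s), p))"
    using z by (simp add: theta2_i_def 2(1))
  have left: "left_map V z = ST_to_RT V p"
    by (simp add: 2(1) left_map_def forget_def)
  from st show ?thesis
  proof (elim disjE exE conjE)
    fix k assume k: "k \<le> n" "dim (c ! k) = i" "s = (\<Sum>l<k. t l) + t k / 2"
    show ?thesis
      unfolding th left theta2_split[OF h k] right_dehn_eq(1)[OF h k(1,2)] ..
  next
    fix k assume "\<forall>k\<le>n. dim (c ! k) \<noteq> i" and k: "k < n" "s = (\<Sum>l\<le>k. t l)"
    then show ?thesis
      unfolding th left theta2_jump(1)[OF h k] by (simp add: right_dehn_eq(2)[OF h])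
  qed
qed

end

theorem proposition4p24:
  fixes V :: "'a::euclidean_space set" and i :: nat
  assumes "subspace V" and "0 < i" and "i < dim V"
  shows "pointed_map (SigmaST_i V i) (wedge (subs_dim V i) (ST_smash V)) (theta2_i V i) \<and>
    pointed_map (SigmaST_i V i) (realization (susp (RT V))) (left_map V) \<and>
    bij_betw (forget V) (topspace (space_of (SigmaST_i V i))) (topspace (space_of (SigmaST V))) \<and>
    homeomorphic_map (space_of (SigmaST V)) (space_of (realization (susp (RT V)))) (ST_to_RT V) \<and>
    pointed_map (realization (susp (RT V))) (wedge (subs_dim V i) (Sigma_join V)) (Sigma_dehn V i) \<and>
    pointed_map (wedge (subs_dim V i) (Sigma_join V)) (wedge (subs_dim V i) (ST_smash V)) (right_map V) \<and>
    (\<forall>z \<in> topspace (space_of (SigmaST_i V i)).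
       theta2_i V i z = right_map V (Sigma_dehn V i (left_map V z)))"
proof -
  have V0: "V \<noteq> {0}"
    by (rule dim_pos_nonzero[OF assms(3)])
  have left: "pointed_map (SigmaST_i V i) (realization (susp (RT V))) (left_map V)"
    by (rule pointed_map_left_map[OF assms(1) V0])
  have dehn: "pointed_map (realization (susp (RT V))) (wedge (subs_dim V i) (Sigma_join V)) (Sigma_dehn V i)"
    by (rule pointed_map_Sigma_dehn[OF assms])
  have right: "pointed_map (wedge (subs_dim V i) (Sigma_join V)) (wedge (subs_dim V i) (ST_smash V)) (right_map V)"
    unfolding right_map_def
  proof (rule pointed_map_wedge_map)
    fix U assume U: "U \<in> subs_dim V i"
    show "pointed_map (Sigma_join V U) (ST_smash V U) (h_map V U)"
      using pointed_map_h_map[OF assms(1)] subs_dimD[OF U assms(2,3)] by blast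
  qed
  have eq: "theta2_i V i z = right_map V (Sigma_dehn V i (left_map V z))"
    if "z \<in> topspace (space_of (SigmaST_i V i))" for z
    using theta2_i_eq[OF assms that] .
  have "continuous_map (space_of (SigmaST_i V i)) (space_of (wedge (subs_dim V i) (ST_smash V)))
      (right_map V \<circ> (Sigma_dehn V i \<circ> left_map V))"
    using left dehn right unfolding pointed_map_def by (blast intro: continuous_map_compose)
  then have "continuous_map (space_of (SigmaST_i V i)) (space_of (wedge (subs_dim V i) (ST_smash V))) (theta2_i V i)"
    by (rule continuous_map_eq) (simp add: eq)
  moreover have "theta2_i V i (base_of (SigmaST_i V i)) = base_of (wedge (subs_dim V i) (ST_smash V))"
  proof -
    have "theta2_i V i None = None"
      using None_SigmaST_i[of V i] by (simp add: theta2_i_def theta2_def)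
    then show ?thesis
      by (simp add: SigmaST_i_def wedge_def)
  qed
  ultimately have "pointed_map (SigmaST_i V i) (wedge (subs_dim V i) (ST_smash V)) (theta2_i V i)"
    by (simp add: pointed_map_def)
  then show ?thesis
    using left bij_betw_forget[OF assms] homeomorphic_map_ST_to_RT[OF assms(1) V0] dehn right eq by blast
qed

end
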